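(* Consider a two-phase composite with isotropic phases $\mathsf L_j=\sigma_j\otimes I_2+r_0\mathsf T$, $j=1,2$ (the same $r_0$ in both phases), where $\sigma_1$ and $\sigma_2$ are not scalar multiples of one another and $\det\sigma_1=\det\sigma_2$. Let $\lambda_1,\lambda_2$ be the two roots (in either order) of $\det(\sigma_2-\lambda\sigma_1)=0$, and put \[ S_1=\frac{\sigma_2-\lambda_1\sigma_1}{\lambda_2-\lambda_1},\qquad S_2=\frac{\sigma_2-\lambda_2\sigma_1}{\lambda_1-\lambda_2},\qquad \sigma^*=\Sigma(\lambda_1). \] Then \[ \mathsf L^*=r_0\mathsf T+\left(\frac{S_1}{\det\sigma^*}+S_2\right)\otimes\sigma^* . \]
   Context: Let $R_\perp=\begin{pmatrix}0&-1\\1&0\end{pmatrix}$ and let $I_2$ be the $2\times2$ identity. Let $\mathcal T=\mathbb R^2\oplus\mathbb R^2$. Operators on $\mathcal T$ are written as $2\times2$ block matrices with real $2\times 2$ blocks, and $A\otimes B$ is the block matrix with blocks $A_{ij}B$. Put $\mathsf T=R_\perp\otimes R_\perp$. The phases $\mathsf L_j$ are assumed positive definite: $\sigma_j$ is a real symmetric positive definite $2\times2$ matrix and $r_0\in\mathbb R$ with $r_0^2<\det\sigma_j$. A two-phase composite is given by a measurable partition of the period cell $[0,1]^2=A_1\cup A_2$ (the microstructure) and the periodic tensor field $\mathsf L(x)=\mathsf L_j$ for $x\in A_j$. Its effective tensor $\mathsf L^*$ is defined by $\mathsf L^*E_0=\int_{[0,1]^2}\mathsf L(x)E(x)\,dx$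 for $E_0\in\mathcal T$, where $E=E_0+(\nabla\varphi_1,\nabla\varphi_2)$ with $\varphi_1,\varphi_2\in H^1_{\rm per}$ is the unique such field for which both $\mathbb R^2$-components of $\mathsf L E$ are divergence-free. For $h>0$, $\Sigma(h)$ is the effective ($2\times2$ symmetric) conductivity of the two-dimensional conducting composite with the same microstructure and conductivities $I_2$ on $A_1$ and $hI_2$ on $A_2$: $\Sigma(h)e_0=\int\sigma(e_0+\nabla\varphi)\,dx$ with $\nabla\cdot\sigma(e_0+\nabla\varphi)=0$, $\varphi\in H^1_{\rm per}$. *)

theory Defs
  imports "HOL-Analysis.Analysis"
begin

subsection \<open>Function spaces on the period cell\<close>

abbreviation cell :: "(real^2) measure" where
  "cell \<equiv> lebesgue_on (cbox 0 1)"

definition cell_periodic :: "(real^2 \<Rightarrow> 'a) \<Rightarrow> bool" where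
  "cell_periodic f \<longleftrightarrow> (\<forall>x i. f (x + axis i 1) = f x)"

definition square_integrable :: "(real^2 \<Rightarrow> 'a::euclidean_space) \<Rightarrow> bool" where
  "square_integrable f \<longleftrightarrow>
     f \<in> borel_measurable cell \<and> integrable cell (\<lambda>x. (norm (f x))\<^sup>2)"

text \<open>Infinite differentiability: \<open>D m n\<close> is the mixed partial derivative of order \<open>m\<close> in the
  first and \<open>n\<close> in the second variable.\<close>

definition smooth :: "(real^2 \<Rightarrow> real) \<Rightarrow> bool" where
  "smooth \<psi> \<longleftrightarrow> (\<exists>D :: nat \<Rightarrow> nat \<Rightarrow> real^2 \<Rightarrow> real. D 0 0 = \<psi> \<and>
     (\<forall>m n x. (D m n has_derivative
        (\<lambda>v. v $ 1 * D (Suc m) n x + v $ 2 * D m (Suc n) x)) (at x)))"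

definition grad :: "(real^2 \<Rightarrow> real) \<Rightarrow> real^2 \<Rightarrow> real^2" where
  "grad \<psi> x = (\<chi> i. frechet_derivative \<psi> (at x) (axis i 1))"

definition test_function :: "(real^2 \<Rightarrow> real) \<Rightarrow> bool" where
  "test_function \<psi> \<longleftrightarrow> smooth \<psi> \<and> cell_periodic \<psi>"

text \<open>Weak derivatives are tested against smooth \<^emph>\<open>periodic\<close> functions, integrating over one cell:
  these are the distributional derivatives on the torus, equivalently those on the plane of
  the periodic extensions. Gradients and fluxes enter only through their restriction to the cell,
  up to null sets.\<close>

definition has_weak_gradient :: "(real^2 \<Rightarrow> real) \<Rightarrow> (real^2 \<Rightarrow> real^2) \<Rightarrow> bool" where
  "has_weak_gradient \<phi> G \<longleftrightarrow>
     (\<forall>\<psi>. test_function \<psi> \<longrightarrow> (\<forall>i.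
        (\<integral>x. \<phi> x * grad \<psi> x $ i \<partial>cell) = - (\<integral>x. G x $ i * \<psi> x \<partial>cell)))"

definition H1_per :: "(real^2 \<Rightarrow> real) \<Rightarrow> (real^2 \<Rightarrow> real^2) \<Rightarrow> bool"
  \<comment> \<open>\<open>\<phi>\<close> belongs to the periodic Sobolev space and \<open>G\<close> represents its gradient\<close> where
  "H1_per \<phi> G \<longleftrightarrow> cell_periodic \<phi> \<and> square_integrable \<phi> \<and> square_integrable G \<and>
     has_weak_gradient \<phi> G"

definition divergence_free :: "(real^2 \<Rightarrow> real^2) \<Rightarrow> bool" where
  "divergence_free J \<longleftrightarrow> square_integrable J \<and>
     (\<forall>\<psi>. test_function \<psi> \<longrightarrow> (\<integral>x. J x \<bullet> grad \<psi> x \<partial>cell) = 0)"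

definition two_phase :: "(real^2) set \<Rightarrow> 'a \<Rightarrow> 'a \<Rightarrow> real^2 \<Rightarrow> 'a" where
  "two_phase A a b x = (if x \<in> A then a else b)"

subsection \<open>Effective conductivity\<close>

definition conduction_field ::
    "(real^2 \<Rightarrow> real^2^2) \<Rightarrow> real^2 \<Rightarrow> (real^2 \<Rightarrow> real^2) \<Rightarrow> bool" where
  "conduction_field \<sigma> e0 e \<longleftrightarrow>
     (\<exists>\<phi> G. H1_per \<phi> G \<and> (\<forall>x. e x = e0 + G x)) \<and> divergence_free (\<lambda>x. \<sigma> x *v e x)"

definition effective_conductivity :: "(real^2 \<Rightarrow> real^2^2) \<Rightarrow> real^2^2" where
  "effective_conductivity \<sigma> =
     (THE S. \<forall>e0. \<exists>e. conduction_field \<sigma> e0 e \<and> S *v e0 = (\<integral>x. \<sigma> x *v e x \<partial>cell))"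

definition Sigma_eff :: "(real^2) set \<Rightarrow> real \<Rightarrow> real^2^2" where
  "Sigma_eff A1 h = effective_conductivity (two_phase A1 (mat 1) (h *\<^sub>R mat 1))"

subsection \<open>Two coupled fields\<close>

text \<open>An element \<open>E\<close> of \<open>real^2^2\<close> is the pair of vectors \<open>E $ 1\<close>, \<open>E $ 2\<close>, and an operator \<open>L\<close> has the
  blocks \<open>L $ i $ j\<close>, each a two-by-two matrix.\<close>

type_synonym field_pair = "real^2^2"
type_synonym block_op = "real^2^2^2^2"

definition apply_block :: "block_op \<Rightarrow> field_pair \<Rightarrow> field_pair" (infixr "\<star>" 70) where
  "L \<star> E = (\<chi> i. \<Sum>j\<in>UNIV. L $ i $ j *v E $ j)"

definition kron :: "real^2^2 \<Rightarrow> real^2^2 \<Rightarrow> block_op" (infixl "\<otimes>" 75) where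
  "A \<otimes> B = (\<chi> i j. A $ i $ j *\<^sub>R B)"

definition R_perp :: "real^2^2" where
  "R_perp = vector [vector [0, -1], vector [1, 0]]"

definition T_op :: block_op where
  "T_op = R_perp \<otimes> R_perp"

definition coupled_field ::
    "(real^2 \<Rightarrow> block_op) \<Rightarrow> field_pair \<Rightarrow> (real^2 \<Rightarrow> field_pair) \<Rightarrow> bool" where
  "coupled_field L E0 E \<longleftrightarrow>
     (\<exists>\<phi>1 \<phi>2 G1 G2. H1_per \<phi>1 G1 \<and> H1_per \<phi>2 G2 \<and>
        (\<forall>x. E x = E0 + vector [G1 x, G2 x])) \<and>
     (\<forall>i. divergence_free (\<lambda>x. (L x \<star> E x) $ i))"

definition effective_tensor :: "(real^2 \<Rightarrow> block_op) \<Rightarrow> block_op" where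
  "effective_tensor L =
     (THE M. \<forall>E0. \<exists>E. coupled_field L E0 E \<and> M \<star> E0 = (\<integral>x. L x \<star> E x \<partial>cell))"

definition sym_pos_def :: "real^2^2 \<Rightarrow> bool" where
  "sym_pos_def A \<longleftrightarrow> transpose A = A \<and> (\<forall>x. x \<noteq> 0 \<longrightarrow> 0 < x \<bullet> (A *v x))"

definition isotropic_phase :: "real^2^2 \<Rightarrow> real \<Rightarrow> block_op" where
  "isotropic_phase \<sigma> r = \<sigma> \<otimes> mat 1 + r *\<^sub>R T_op"

end

theory Submission
  imports Defs
begin

text \<open>Since \<open>det \<sigma>1 = det \<sigma>2\<close>, the roots satisfy \<open>lam1 * lam2 = 1\<close>, and \<open>S1 = \<alpha> u u\<^sup>T\<close>, \<open>S2 = \<beta> v v\<^sup>T\<close>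
  with \<open>u\<close>, \<open>v\<close> independent. Writing \<open>a\<close> for the conductivity \<open>1\<close>, \<open>lam1\<close> and \<open>b = 1/a\<close>, the local tensor is
  \<open>(b S1 + a S2) \<otimes> I + r0 T\<close>. The term \<open>r0 T\<close> is a null Lagrangian, because rotated gradients are
  divergence-free, so \<open>u \<bullet> E\<close> and \<open>v \<bullet> E\<close> solve the scalar problems for \<open>b\<close> and \<open>a\<close> separately.
  By Keller's duality the effective conductivity of \<open>1/a\<close> is that of \<open>a\<close> divided by its
  determinant. Fields are obtained by projecting in \<open>L\<^sup>2\<close> onto the closure of the gradients of test
  functions; the Poincare inequality identifies the limits as gradients, and completeness of the
  trigonometric system identifies that closure with the mean-free curl-free fields.\<close>

text \<open>Both effective quantities are described by \<open>THE\<close>, so existence of fields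
  and uniqueness of their mean fluxes have to be established, not only the algebraic formula. The
  obstacle is that divergences and weak gradients are tested against smooth periodic functions only,
  whereas uniqueness and symmetry pair a flux with a field that is merely square integrable, and
  duality needs potentials for rotated fluxes. Both needs are met by \<open>hodge\<close>. It
  requires no mollification: a mean-free field orthogonal to all gradients and all rotated gradients
  of waves has vanishing Fourier coefficients. The reciprocal conductivities come from the pencil.
  With equal determinants \<open>det (\<sigma>2 - l *\<^sub>R \<sigma>1)\<close> has equal leading
  and constant coefficients; moreover \<open>\<sigma>1 = S1 + S2\<close> and
  \<open>\<sigma>2 = lam2 S1 + lam1 S2\<close>. So the weight \<open>1\<close> or
  \<open>lam2\<close> on \<open>S1\<close> is the reciprocal of the weight \<open>1\<close> or
  \<open>lam1\<close> on \<open>S2\<close>, and the one matrix \<open>Sigma_eff A1 lam1\<close>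
  settles both scalar problems.\<close>

lemma tendsto_zero_of_power2:
  fixes f :: "'b \<Rightarrow> real"
  assumes "((\<lambda>n. (f n)\<^sup>2) \<longlongrightarrow> 0) F"
  shows "(f \<longlongrightarrow> 0) F"
  using tendsto_real_sqrt[OF assms] by (simp add: tendsto_rabs_zero_iff)

lemma finite_measure_cell: "finite_measure cell"
  by (intro finite_measure_lebesgue_on) simp

lemma measure_cell [simp]: "measure cell (cbox 0 1) = 1"
proof -
  have "measure cell (cbox 0 1) = measure lebesgue (cbox (0::real^2) 1)"
    by (subst measure_restrict_space) auto
  also have "\<dots> = measure lborel (cbox (0::real^2) 1)"
    by simp
  also have "\<dots> = 1"
    by (simp add: content_cbox_cart interval_ne_empty_cart)
  finally show ?thesis .
qed

lemma integrable_cell_const [simp]: "integrable cell (\<lambda>x. c::'a::euclidean_space)"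
  using finite_measure.integrable_const[OF finite_measure_cell] by auto

lemma integral_cell_const [simp]: "(\<integral>x. c \<partial>cell) = (c::'a::euclidean_space)"
  using measure_cell by simp

subsection \<open>Square integrable functions on the cell\<close>

lemma square_integrable_cong_AE:
  assumes "square_integrable f" "g \<in> borel_measurable cell" "AE x in cell. f x = g x"
  shows "square_integrable g"
  using assms unfolding square_integrable_def
  by (auto intro: integrable_cong_AE_imp)

lemma square_integrableD:
  assumes "square_integrable f"
  shows square_integrable_measurable: "f \<in> borel_measurable cell"
    and square_integrable_norm: "integrable cell (\<lambda>x. (norm (f x))\<^sup>2)"
  using assms by (auto simp: square_integrable_def)

lemma square_integrable_const [simp, intro]: "square_integrable (\<lambda>x. c)"
  by (auto simp: square_integrable_def)

lemma square_integrable_bounded_linear: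
  assumes "bounded_linear T" "square_integrable f"
  shows "square_integrable (\<lambda>x. T (f x))"
proof -
  obtain K where K: "\<And>x. norm (T x) \<le> norm x * K" "0 \<le> K"
    using bounded_linear.nonneg_bounded[OF assms(1)] by blast
  have m: "(\<lambda>x. T (f x)) \<in> borel_measurable cell"
    using square_integrable_measurable[OF assms(2)]
      borel_measurable_continuous_onI[OF linear_continuous_on[OF assms(1)]]
    by (metis measurable_compose)
  have "integrable cell (\<lambda>x. (norm (T (f x)))\<^sup>2)"
  proof (rule Bochner_Integration.integrable_bound)
    show "integrable cell (\<lambda>x. K\<^sup>2 * (norm (f x))\<^sup>2)"
      using assms(2) by (simp add: square_integrable_def)
    show "AE x in cell. norm ((norm (T (f x)))\<^sup>2) \<le> norm (K\<^sup>2 * (norm (f x))\<^sup>2)"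
      using K by (auto simp: power_mult_distrib[symmetric] mult.commute intro!: AE_I2 power_mono)
  qed (use m in measurable)
  with m show ?thesis by (simp add: square_integrable_def)
qed

lemma square_integrable_add [intro]:
  assumes "square_integrable f" "square_integrable g"
  shows "square_integrable (\<lambda>x. f x + g x)"
proof -
  have m [measurable]: "f \<in> borel_measurable cell" "g \<in> borel_measurable cell"
    using assms by (auto simp: square_integrable_def)
  have "integrable cell (\<lambda>x. (norm (f x + g x))\<^sup>2)"
  proof (rule Bochner_Integration.integrable_bound)
    show "integrable cell (\<lambda>x. 2 * (norm (f x))\<^sup>2 + 2 * (norm (g x))\<^sup>2)"
      using assms by (simp add: square_integrable_def)
    have "(norm (f x + g x))\<^sup>2 \<le> 2 * (norm (f x))\<^sup>2 + 2 * (norm (g x))\<^sup>2" for x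
    proof -
      have "(norm (f x + g x))\<^sup>2 \<le> (norm (f x) + norm (g x))\<^sup>2"
        by (intro power_mono norm_triangle_ineq) auto
      also have "\<dots> \<le> 2 * (norm (f x))\<^sup>2 + 2 * (norm (g x))\<^sup>2"
        using sum_squares_bound[of "norm (f x)" "norm (g x)"] by (simp add: power2_sum)
      finally show ?thesis .
    qed
    then show "AE x in cell. norm ((norm (f x + g x))\<^sup>2) \<le> norm (2 * (norm (f x))\<^sup>2 + 2 * (norm (g x))\<^sup>2)"
      by (intro AE_I2) simp
  qed measurable
  then show ?thesis by (simp add: square_integrable_def)
qed

lemma square_integrable_scaleR [intro]:
  "square_integrable f \<Longrightarrow> square_integrable (\<lambda>x. c *\<^sub>R f x)"
  by (rule square_integrable_bounded_linear[OF bounded_linear_scaleR_right])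

lemma square_integrable_uminus [intro]:
  "square_integrable f \<Longrightarrow> square_integrable (\<lambda>x. - f x)"
  using square_integrable_scaleR[of f "-1"] by simp

lemma square_integrable_diff [intro]:
  "square_integrable f \<Longrightarrow> square_integrable g \<Longrightarrow> square_integrable (\<lambda>x. f x - g x)"
  using square_integrable_add[of f "\<lambda>x. - g x"] by auto

lemma square_integrable_matrix [intro]:
  fixes A :: "real^2^2"
  shows "square_integrable f \<Longrightarrow> square_integrable (\<lambda>x. A *v f x)"
  by (rule square_integrable_bounded_linear[OF matrix_vector_mul_bounded_linear])

lemma square_integrable_nth [intro]:
  fixes f :: "real^2 \<Rightarrow> real^2"
  shows "square_integrable f \<Longrightarrow> square_integrable (\<lambda>x. f x $ i)"
  by (rule square_integrable_bounded_linear[OF bounded_linear_vec_nth])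

lemma square_integrable_weight:
  fixes a :: "real^2 \<Rightarrow> real"
  assumes a: "a \<in> borel_measurable cell" "\<And>x. \<bar>a x\<bar> \<le> B" and f: "square_integrable f"
  shows "square_integrable (\<lambda>x. a x *\<^sub>R f x)"
proof -
  have m [measurable]: "a \<in> borel_measurable cell" "f \<in> borel_measurable cell"
    using assms by (auto simp: square_integrable_def)
  have "integrable cell (\<lambda>x. (norm (a x *\<^sub>R f x))\<^sup>2)"
  proof (rule Bochner_Integration.integrable_bound)
    show "integrable cell (\<lambda>x. B\<^sup>2 * (norm (f x))\<^sup>2)"
      using assms by (simp add: square_integrable_def)
    have "\<bar>a x\<bar>\<^sup>2 \<le> B\<^sup>2" for x
      using a(2) by (intro power_mono) auto
    then show "AE x in cell. norm ((norm (a x *\<^sub>R f x))\<^sup>2) \<le> norm (B\<^sup>2 * (norm (f x))\<^sup>2)"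
      by (intro AE_I2) (auto simp: power_mult_distrib intro!: mult_right_mono)
  qed measurable
  then show ?thesis by (simp add: square_integrable_def)
qed

lemma integrable_inner_cell:
  assumes "square_integrable f" "square_integrable g"
  shows "integrable cell (\<lambda>x. f x \<bullet> g x)"
proof -
  have m [measurable]: "f \<in> borel_measurable cell" "g \<in> borel_measurable cell"
    using assms by (auto simp: square_integrable_def)
  show ?thesis
  proof (rule Bochner_Integration.integrable_bound)
    show "integrable cell (\<lambda>x. (norm (f x))\<^sup>2 + (norm (g x))\<^sup>2)"
      using assms by (simp add: square_integrable_def)
    have "\<bar>f x \<bullet> g x\<bar> \<le> (norm (f x))\<^sup>2 + (norm (g x))\<^sup>2" for x
      using Cauchy_Schwarz_ineq2[of "f x" "g x"] sum_squares_bound[of "norm (f x)" "norm (g x)"]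
        norm_ge_zero[of "f x"] norm_ge_zero[of "g x"] mult_nonneg_nonneg[of "norm (f x)" "norm (g x)"]
      by linarith
    then show "AE x in cell. norm (f x \<bullet> g x) \<le> norm ((norm (f x))\<^sup>2 + (norm (g x))\<^sup>2)"
      by (intro AE_I2) simp
  qed measurable
qed

lemma integrable_mult_cell:
  fixes f g :: "real^2 \<Rightarrow> real"
  shows "square_integrable f \<Longrightarrow> square_integrable g \<Longrightarrow> integrable cell (\<lambda>x. f x * g x)"
  using integrable_inner_cell[of f g] by simp

lemma square_integrable_imp_integrable:
  assumes "square_integrable (f :: real^2 \<Rightarrow> 'a::euclidean_space)"
  shows "integrable cell f"
proof -
  have m [measurable]: "f \<in> borel_measurable cell"
    using assms by (auto simp: square_integrable_def)
  show ?thesis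
  proof (rule Bochner_Integration.integrable_bound)
    show "integrable cell (\<lambda>x. (norm (f x))\<^sup>2 + 1)"
      using assms by (simp add: square_integrable_def)
    have "norm (f x) \<le> (norm (f x))\<^sup>2 + 1" for x
      using zero_le_power2[of "norm (f x) - 1"] zero_le_power2[of "norm (f x)"] norm_ge_zero[of "f x"]
      unfolding power2_diff power_one by linarith
    then show "AE x in cell. norm (f x) \<le> norm ((norm (f x))\<^sup>2 + 1)"
      by (intro AE_I2) simp
  qed measurable
qed

lemma integral_norm_diff_scaled:
  assumes f: "square_integrable f" and g: "square_integrable g"
  shows "(\<integral>x. (norm (f x - t *\<^sub>R g x))\<^sup>2 \<partial>cell) =
    (\<integral>x. (norm (f x))\<^sup>2 \<partial>cell) - 2 * t * (\<integral>x. f x \<bullet> g x \<partial>cell) + t\<^sup>2 * (\<integral>x. (norm (g x))\<^sup>2 \<partial>cell)"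
proof -
  have "(norm (f x - t *\<^sub>R g x))\<^sup>2 = (norm (f x))\<^sup>2 - 2 * t * (f x \<bullet> g x) + t\<^sup>2 * (norm (g x))\<^sup>2" for x
    unfolding power2_norm_eq_inner by (simp add: inner_diff inner_commute power2_eq_square algebra_simps)
  moreover have "integrable cell (\<lambda>x. 2 * t * (f x \<bullet> g x))" "integrable cell (\<lambda>x. t\<^sup>2 * (norm (g x))\<^sup>2)"
    "integrable cell (\<lambda>x. (norm (f x))\<^sup>2)"
    using integrable_inner_cell[OF f g] f g by (auto simp: square_integrable_def)
  ultimately show ?thesis
    by simp
qed

text \<open>For \<open>C > 0\<close> the choice \<open>t = B / C\<close> minimises the quadratic. No
  sign of \<open>C\<close> is assumed, so \<open>C < 0\<close> is refuted by a large
  \<open>t\<close>. Stated for plain numbers because it serves twice: for the Cauchy-Schwarz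
  inequality and, with \<open>A\<close> a small error, for near-minimisers in
  \<open>L2_projection\<close>.\<close>

lemma quadratic_nonneg_discriminant:
  fixes A B C :: real
  assumes "\<And>t. 0 \<le> A - 2 * t * B + t\<^sup>2 * C"
  shows "B\<^sup>2 \<le> A * C"
proof (cases "C = 0")
  case True
  have "B = 0"
  proof (rule ccontr)
    assume "B \<noteq> 0"
    \<comment> \<open>This \<open>t\<close> turns \<open>A - 2 * t * B\<close> into
      \<open>-1\<close>.\<close>
    then show False
      using assms[of "(A + 1) / (2 * B)"] True by (simp add: field_simps)
  qed
  then show ?thesis using True by simp
next
  case False
  have "C > 0"
  proof (rule ccontr)
    assume "\<not> C > 0"
    then have C: "C < 0" using False by simp
    \<comment> \<open>\<open>s\<close> is at least 1 and so large that \<open>s * (- C)\<close>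
      exceeds \<open>\<bar>A\<bar> + 2 * \<bar>B\<bar>\<close> by 1; the quadratic at
      \<open>s\<close> is then at most \<open>- s\<close>.\<close>
    define s where "s = (\<bar>A\<bar> + 2 * \<bar>B\<bar> + 1) / (- C) + 1"
    have s: "s \<ge> 1" "s * (- C) \<ge> \<bar>A\<bar> + 2 * \<bar>B\<bar> + 1"
      using C by (auto simp: s_def field_simps divide_nonneg_neg)
    have "s * (\<bar>A\<bar> + 2 * \<bar>B\<bar> + 1) \<le> s * (s * (- C))"
      using s by (intro mult_left_mono) auto
    moreover have "s * \<bar>A\<bar> \<ge> A"
      using s mult_right_mono[of 1 s "\<bar>A\<bar>"] by simp
    moreover have "s * \<bar>B\<bar> \<ge> - s * B"
      using s by (auto simp: abs_if)
    ultimately show False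
      using assms[of s] s by (simp add: power2_eq_square algebra_simps)
  qed
  then show ?thesis
    using assms[of "B / C"] by (simp add: field_simps power2_eq_square)
qed

section \<open>Cauchy-Schwarz inequality, mean-square convergence and projections\<close>

lemma Cauchy_Schwarz_cell:
  assumes f: "square_integrable f" and g: "square_integrable g"
  shows "(\<integral>x. f x \<bullet> g x \<partial>cell)\<^sup>2 \<le> (\<integral>x. (norm (f x))\<^sup>2 \<partial>cell) * (\<integral>x. (norm (g x))\<^sup>2 \<partial>cell)"
proof (rule quadratic_nonneg_discriminant)
  show "0 \<le> (\<integral>x. (norm (f x))\<^sup>2 \<partial>cell) - 2 * t * (\<integral>x. f x \<bullet> g x \<partial>cell) + t\<^sup>2 * (\<integral>x. (norm (g x))\<^sup>2 \<partial>cell)" for t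
    unfolding integral_norm_diff_scaled[OF f g, symmetric] by (rule Bochner_Integration.integral_nonneg) simp
qed

text \<open>The integral of a non-integrable function is \<open>0\<close>, so the predicate carries
  information only for square integrable functions; the lemmas that use it ensure this
  separately.\<close>

definition L2_tendsto :: "(nat \<Rightarrow> real^2 \<Rightarrow> 'a::euclidean_space) \<Rightarrow> (real^2 \<Rightarrow> 'a) \<Rightarrow> bool" where
  "L2_tendsto h f \<longleftrightarrow> (\<lambda>n. \<integral>x. (norm (h n x - f x))\<^sup>2 \<partial>cell) \<longlonglongrightarrow> 0"

lemma L2_tendsto_inner:
  assumes "L2_tendsto h f" "\<And>n. square_integrable (h n)" "square_integrable f" "square_integrable g"
  shows "(\<lambda>n. \<integral>x. h n x \<bullet> g x \<partial>cell) \<longlonglongrightarrow> (\<integral>x. f x \<bullet> g x \<partial>cell)"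
proof -
  let ?C = "\<integral>x. (norm (g x))\<^sup>2 \<partial>cell"
  have d: "(\<integral>x. h n x \<bullet> g x \<partial>cell) - (\<integral>x. f x \<bullet> g x \<partial>cell) = (\<integral>x. (h n x - f x) \<bullet> g x \<partial>cell)" for n
    using integrable_inner_cell[OF assms(2) assms(4)] integrable_inner_cell[OF assms(3) assms(4)]
    by (simp add: inner_diff_left)
  have "(\<lambda>n. (\<integral>x. (norm (h n x - f x))\<^sup>2 \<partial>cell) * ?C) \<longlonglongrightarrow> 0"
    using tendsto_mult_right[of "\<lambda>n. \<integral>x. (norm (h n x - f x))\<^sup>2 \<partial>cell" 0 sequentially ?C] assms(1)
    by (simp add: L2_tendsto_def)
  then have "(\<lambda>n. ((\<integral>x. h n x \<bullet> g x \<partial>cell) - (\<integral>x. f x \<bullet> g x \<partial>cell))\<^sup>2) \<longlonglongrightarrow> 0"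
  proof (rule Lim_null_comparison[rotated], intro always_eventually allI)
    fix n
    show "norm (((\<integral>x. h n x \<bullet> g x \<partial>cell) - (\<integral>x. f x \<bullet> g x \<partial>cell))\<^sup>2)
      \<le> (\<integral>x. (norm (h n x - f x))\<^sup>2 \<partial>cell) * ?C"
      unfolding d using Cauchy_Schwarz_cell[of "\<lambda>x. h n x - f x" g] assms by auto
  qed
  then have "(\<lambda>n. (\<integral>x. h n x \<bullet> g x \<partial>cell) - (\<integral>x. f x \<bullet> g x \<partial>cell)) \<longlonglongrightarrow> 0"
    by (rule tendsto_zero_of_power2)
  then show ?thesis
    by (simp add: LIM_zero_iff)
qed

text \<open>The Riesz-Fischer argument: an almost everywhere convergent subsequence supplies the
  candidate limit, and Fatou's lemma, applied in the second index of the Cauchy condition, turns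
  pointwise convergence into convergence in mean square.\<close>

lemma L2_complete:
  fixes h :: "nat \<Rightarrow> real^2 \<Rightarrow> 'a::euclidean_space"
  assumes sq: "\<And>n. square_integrable (h n)"
    and cau: "\<And>e. e > 0 \<Longrightarrow> \<exists>N. \<forall>m\<ge>N. \<forall>n\<ge>N. (\<integral>x. (norm (h m x - h n x))\<^sup>2 \<partial>cell) < e"
  obtains f where "square_integrable f" "L2_tendsto h f"
proof -
  have [measurable]: "h n \<in> borel_measurable cell" for n
    using sq by (auto simp: square_integrable_def)
  have sqd: "square_integrable (\<lambda>x. h m x - h n x)" for m n
    using sq by auto
  have sqn: "square_integrable (\<lambda>x. norm (h m x - h n x))" for m n
    using sqd[of m n] by (auto simp: square_integrable_def)
  \<comment> \<open>On a space of measure 1 the mean distance is bounded by the root mean-square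
    distance, so the L1 criterion for almost everywhere convergent subsequences applies.\<close>
  have "\<exists>N. \<forall>i\<ge>N. \<forall>j\<ge>N. (LINT x|cell. norm (h i x - h j x)) < e" if "e > 0" for e
  proof -
    obtain N where N: "\<And>m n. m \<ge> N \<Longrightarrow> n \<ge> N \<Longrightarrow> (\<integral>x. (norm (h m x - h n x))\<^sup>2 \<partial>cell) < e\<^sup>2"
      using cau[of "e\<^sup>2"] \<open>e > 0\<close> zero_less_power[of e 2] by meson
    have "(LINT x|cell. norm (h i x - h j x)) < e" if "i \<ge> N" "j \<ge> N" for i j
    proof -
      have "(LINT x|cell. norm (h i x - h j x))\<^sup>2 \<le> (\<integral>x. (norm (h i x - h j x))\<^sup>2 \<partial>cell)"
        using Cauchy_Schwarz_cell[OF sqn square_integrable_const[of 1], of i j] by simp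
      also have "\<dots> < e\<^sup>2" using N that by simp
      finally show ?thesis using \<open>e > 0\<close> by (simp add: power2_less_imp_less)
    qed
    then show ?thesis by blast
  qed
  then obtain r where r: "strict_mono r" "AE x in cell. Cauchy (\<lambda>i. h (r i) x)"
    using cauchy_L1_AE_cauchy_subseq[of cell h] square_integrable_imp_integrable[OF sq] by blast
  define f where "f x = lim (\<lambda>i. h (r i) x)" for x
  have [measurable]: "f \<in> borel_measurable cell"
    unfolding f_def by measurable
  have conv: "AE x in cell. (\<lambda>i. h (r i) x) \<longlonglongrightarrow> f x"
    using r(2) by eventually_elim (simp add: f_def Cauchy_convergent_iff convergent_LIMSEQ_iff)
  \<comment> \<open>The limit is taken along \<open>r\<close>; since \<open>r i \<ge> i\<close>, the
    bound assumed for all \<open>m \<ge> N\<close> holds eventually along it. Finiteness of the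
    nonnegative integral also gives integrability.\<close>
  have fatou: "integrable cell (\<lambda>x. (norm (h n x - f x))\<^sup>2) \<and> (\<integral>x. (norm (h n x - f x))\<^sup>2 \<partial>cell) \<le> e"
    if "e > 0" and N: "\<forall>m\<ge>N. (\<integral>x. (norm (h n x - h m x))\<^sup>2 \<partial>cell) \<le> e" for n N e
  proof -
    have "(\<integral>\<^sup>+x. ennreal ((norm (h n x - f x))\<^sup>2) \<partial>cell) =
        (\<integral>\<^sup>+x. liminf (\<lambda>i. ennreal ((norm (h n x - h (r i) x))\<^sup>2)) \<partial>cell)"
    proof (rule nn_integral_cong_AE)
      show "AE x in cell. ennreal ((norm (h n x - f x))\<^sup>2) = liminf (\<lambda>i. ennreal ((norm (h n x - h (r i) x))\<^sup>2))"
        using conv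
      proof eventually_elim
        case (elim x)
        have "(\<lambda>i. ennreal ((norm (h n x - h (r i) x))\<^sup>2)) \<longlonglongrightarrow> ennreal ((norm (h n x - f x))\<^sup>2)"
          by (intro tendsto_ennrealI tendsto_intros elim)
        then show ?case
          by (metis lim_imp_Liminf trivial_limit_sequentially)
      qed
    qed
    also have "\<dots> \<le> liminf (\<lambda>i. \<integral>\<^sup>+x. ennreal ((norm (h n x - h (r i) x))\<^sup>2) \<partial>cell)"
      by (rule nn_integral_liminf) measurable
    also have "\<dots> = liminf (\<lambda>i. ennreal (\<integral>x. (norm (h n x - h (r i) x))\<^sup>2 \<partial>cell))"
      using sqd by (subst nn_integral_eq_integral) (auto simp: square_integrable_def)
    also have "\<dots> \<le> ennreal e"
    proof -
      have "eventually (\<lambda>i. ennreal (\<integral>x. (norm (h n x - h (r i) x))\<^sup>2 \<partial>cell) \<le> ennreal e) sequentially"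
        using eventually_ge_at_top[of N]
      proof eventually_elim
        case (elim i)
        then have "r i \<ge> N" using seq_suble[OF r(1), of i] by linarith
        then show ?case using N by (intro ennreal_leI) auto
      qed
      from Liminf_mono[OF this] show ?thesis
        by (simp add: Liminf_const)
    qed
    finally have le: "(\<integral>\<^sup>+x. ennreal ((norm (h n x - f x))\<^sup>2) \<partial>cell) \<le> ennreal e" .
    then have int: "integrable cell (\<lambda>x. (norm (h n x - f x))\<^sup>2)"
      by (intro integrableI_bounded) (auto simp: le_less_trans[OF _ ennreal_less_top] intro: le_less_trans)
    then show ?thesis
      using le \<open>e > 0\<close> by (simp add: nn_integral_eq_integral)
  qed
  have L: "\<exists>N. \<forall>n\<ge>N. integrable cell (\<lambda>x. (norm (h n x - f x))\<^sup>2) \<and> (\<integral>x. (norm (h n x - f x))\<^sup>2 \<partial>cell) \<le> e" if e: "e > 0" for e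
    using cau[OF e] fatou[OF e] by (meson less_imp_le)
  have "square_integrable f"
  proof -
    obtain n where "integrable cell (\<lambda>x. (norm (h n x - f x))\<^sup>2)"
      using L[of 1] by auto
    then have "square_integrable (\<lambda>x. h n x - f x)"
      by (simp add: square_integrable_def)
    from square_integrable_diff[OF sq[of n] this] show ?thesis by simp
  qed
  moreover have "L2_tendsto h f"
    unfolding L2_tendsto_def
  proof (rule LIMSEQ_I)
    fix e :: real assume "e > 0"
    then obtain N where "\<forall>n\<ge>N. (\<integral>x. (norm (h n x - f x))\<^sup>2 \<partial>cell) \<le> e / 2"
      using L[of "e/2"] by auto
    then show "\<exists>no. \<forall>n\<ge>no. norm ((\<integral>x. (norm (h n x - f x))\<^sup>2 \<partial>cell) - 0) < e"
      using \<open>e > 0\<close> by (intro exI[of _ N]) (auto intro: le_less_trans)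
  qed
  ultimately show ?thesis using that by blast
qed

text \<open>\<open>V\<close> is a subspace that need not be closed, so \<open>p\<close> is only
  known to lie in its closure. The minimising sequence \<open>v\<close> is returned as well, because
  later arguments need the elements of \<open>V\<close> that approximate \<open>p\<close>.\<close>

lemma L2_projection:
  fixes V :: "(real^2 \<Rightarrow> 'a::euclidean_space) set"
  assumes V: "\<And>v. v \<in> V \<Longrightarrow> square_integrable v" "(\<lambda>x. 0) \<in> V"
    "\<And>v w. v \<in> V \<Longrightarrow> w \<in> V \<Longrightarrow> (\<lambda>x. v x + w x) \<in> V"
    "\<And>v c. v \<in> V \<Longrightarrow> (\<lambda>x. c *\<^sub>R v x) \<in> V"
    and f: "square_integrable f"
  obtains p v where "square_integrable p" "\<And>n. v n \<in> V" "L2_tendsto v p"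
    "\<And>w. w \<in> V \<Longrightarrow> (\<integral>x. (f x - p x) \<bullet> w x \<partial>cell) = 0"
proof -
  define Q where "Q u = (\<integral>x. (norm (u x))\<^sup>2 \<partial>cell)" for u :: "real^2 \<Rightarrow> 'a"
  define d where "d = Inf ((\<lambda>v. Q (\<lambda>x. f x - v x)) ` V)"
  have Q0: "0 \<le> Q u" for u
    unfolding Q_def by (rule Bochner_Integration.integral_nonneg) simp
  have bdd: "bdd_below ((\<lambda>v. Q (\<lambda>x. f x - v x)) ` V)"
    unfolding bdd_below_def using Q0 by blast
  have d_le: "d \<le> Q (\<lambda>x. f x - v x)" if "v \<in> V" for v
    unfolding d_def using bdd that by (auto intro: cInf_lower)
  have "\<exists>v\<in>V. Q (\<lambda>x. f x - v x) < d + 1 / real (Suc n)" for n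
  proof -
    have "\<exists>y\<in>(\<lambda>v. Q (\<lambda>x. f x - v x)) ` V. y < d + 1 / real (Suc n)"
      by (rule cInf_lessD) (use V(2) in \<open>auto simp: d_def\<close>)
    then show ?thesis by blast
  qed
  then obtain v where v: "\<And>n. v n \<in> V" "\<And>n. Q (\<lambda>x. f x - v n x) < d + 1 / real (Suc n)"
    by metis
  have sv: "square_integrable (v n)" for n using v V by blast
  have sfv: "square_integrable (\<lambda>x. f x - v n x)" for n using f sv by auto
  \<comment> \<open>Parallelogram law: the midpoint of \<open>v m\<close> and \<open>v n\<close>
    lies in \<open>V\<close>, hence has squared distance at least \<open>d\<close> from
    \<open>f\<close>, which forces near-minimisers to be close to each other.\<close>
  have par: "Q (\<lambda>x. v m x - v n x) \<le> 2 / real (Suc m) + 2 / real (Suc n)" for m n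
  proof -
    let ?w = "\<lambda>x. (1/2) *\<^sub>R (v m x + v n x)"
    have le: "2 * a + 2 * b - 4 * c \<le> 2 * (d + x) + 2 * (d + y) - 4 * d"
      if "d \<le> c" "a < d + x" "b < d + y" for a b c x y :: real
      using that by argo
    have wV: "?w \<in> V" using v V by blast
    have sw: "square_integrable (\<lambda>x. f x - ?w x)" using f V(1)[OF wV] by auto
    have "(norm (v m x - v n x))\<^sup>2 = 2 * (norm (f x - v m x))\<^sup>2 + 2 * (norm (f x - v n x))\<^sup>2 - 4 * (norm (f x - ?w x))\<^sup>2" for x
      unfolding power2_norm_eq_inner by (simp add: inner_diff inner_add inner_commute algebra_simps)
    then have "Q (\<lambda>x. v m x - v n x) = 2 * Q (\<lambda>x. f x - v m x) + 2 * Q (\<lambda>x. f x - v n x) - 4 * Q (\<lambda>x. f x - ?w x)"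
      unfolding Q_def using square_integrable_norm[OF sw] square_integrable_norm[OF sfv[of m]] square_integrable_norm[OF sfv[of n]]
      by simp
    also have "\<dots> \<le> 2 * (d + 1 / real (Suc m)) + 2 * (d + 1 / real (Suc n)) - 4 * d"
      by (rule le[OF d_le[OF wV] v(2)[of m] v(2)[of n]])
    finally show ?thesis by simp
  qed
  obtain p where p: "square_integrable p" "L2_tendsto v p"
  proof (rule L2_complete[of v])
    fix e :: real assume "e > 0"
    then obtain N where N: "1 / real (Suc N) < e / 4"
      using nat_approx_posE[of "e/4"] by auto
    have "(\<integral>x. (norm (v m x - v n x))\<^sup>2 \<partial>cell) < e" if "m \<ge> N" "n \<ge> N" for m n
    proof -
      have "1 / real (Suc m) \<le> 1 / real (Suc N)" "1 / real (Suc n) \<le> 1 / real (Suc N)"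
        using that by (auto simp: frac_le)
      then show ?thesis using par[of m n] N unfolding Q_def by simp
    qed
    then show "\<exists>N. \<forall>m\<ge>N. \<forall>n\<ge>N. (\<integral>x. (norm (v m x - v n x))\<^sup>2 \<partial>cell) < e" by blast
  qed (use sv in auto)
  have "(\<integral>x. (f x - p x) \<bullet> w x \<partial>cell) = 0" if w: "w \<in> V" for w
  proof -
    have sw: "square_integrable w" using V w by blast
    let ?B = "\<lambda>n. \<integral>x. (f x - v n x) \<bullet> w x \<partial>cell"
    \<comment> \<open>Perturbing the near-minimiser \<open>v n\<close> by
      \<open>t *\<^sub>R w\<close> cannot lower the squared distance below \<open>d\<close>; the
      resulting quadratic in \<open>t\<close> bounds the square of \<open>?B n\<close> by the excess
      \<open>1 / real (Suc n)\<close> times \<open>Q w\<close>.\<close>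
    have le: "(?B n)\<^sup>2 \<le> (1 / real (Suc n)) * Q w" for n
    proof (rule quadratic_nonneg_discriminant)
      fix t
      have "(\<lambda>x. v n x + t *\<^sub>R w x) \<in> V" using v V w by blast
      from d_le[OF this] have "d \<le> Q (\<lambda>x. (f x - v n x) - t *\<^sub>R w x)"
        by (simp add: algebra_simps)
      also have "\<dots> = Q (\<lambda>x. f x - v n x) - 2 * t * ?B n + t\<^sup>2 * Q w"
        unfolding Q_def by (rule integral_norm_diff_scaled[OF sfv sw])
      finally show "0 \<le> 1 / real (Suc n) - 2 * t * ?B n + t\<^sup>2 * Q w"
        using v(2)[of n] by linarith
    qed
    have "(\<lambda>n. (1 / real (Suc n)) * Q w) \<longlonglongrightarrow> 0"
      using tendsto_mult_right[OF LIMSEQ_inverse_real_of_nat, of "Q w"] by (simp add: inverse_eq_divide)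
    then have "(\<lambda>n. (?B n)\<^sup>2) \<longlonglongrightarrow> 0"
      by (rule Lim_null_comparison[rotated]) (use le in auto)
    then have "?B \<longlonglongrightarrow> 0"
      by (rule tendsto_zero_of_power2)
    moreover have "?B \<longlonglongrightarrow> (\<integral>x. f x \<bullet> w x \<partial>cell) - (\<integral>x. p x \<bullet> w x \<partial>cell)"
      using tendsto_diff[OF tendsto_const L2_tendsto_inner[OF p(2) sv p(1) sw]]
        integrable_inner_cell[OF f sw] integrable_inner_cell[OF sv sw]
      by (simp add: inner_diff_left)
    ultimately have "(\<integral>x. f x \<bullet> w x \<partial>cell) - (\<integral>x. p x \<bullet> w x \<partial>cell) = 0"
      using LIMSEQ_unique by blast
    then show ?thesis
      using integrable_inner_cell[OF f sw] integrable_inner_cell[OF p(1) sw] by (simp add: inner_diff_left)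
  qed
  then show ?thesis using that p v by blast
qed

subsection \<open>Smooth periodic functions\<close>

text \<open>The coordinate map to pairs sends boxes to boxes of equal content, so the change of
  variables has factor 1. It makes Fubini's theorem for continuous functions of pairs available on
  \<open>real^2\<close>.\<close>

lemma has_integral_vec2_pair:
  fixes f :: "real^2 \<Rightarrow> real"
  assumes "((\<lambda>(s, t). f (vector [s, t])) has_integral i) (cbox (0, 0) (1, 1))"
  shows "(f has_integral i) (cbox 0 1)"
proof -
  define g :: "real^2 \<Rightarrow> real \<times> real" where "g x = (x $ 1, x $ 2)" for x
  define h :: "real \<times> real \<Rightarrow> real^2" where "h p = vector [fst p, snd p]" for p
  have hg: "h (g x) = x" for x
    by (simp add: h_def g_def vec_eq_iff forall_2)
  have gh: "g (h x) = x" for x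
    by (simp add: h_def g_def)
  have gim: "g ` cbox u v = cbox (u $ 1, u $ 2) (v $ 1, v $ 2)" for u v
  proof (rule set_eqI)
    fix p :: "real \<times> real"
    have "p \<in> g ` cbox u v \<longleftrightarrow> h p \<in> cbox u v"
      by (metis gh hg image_eqI imageE)
    also have "\<dots> \<longleftrightarrow> p \<in> cbox (u $ 1, u $ 2) (v $ 1, v $ 2)"
      by (cases p) (auto simp: h_def mem_box_cart forall_2)
    finally show "p \<in> g ` cbox u v \<longleftrightarrow> p \<in> cbox (u $ 1, u $ 2) (v $ 1, v $ 2)" .
  qed
  have him: "h ` cbox u v = cbox (h u) (h v)" for u v
  proof (rule set_eqI)
    fix x :: "real^2"
    have "x \<in> h ` cbox u v \<longleftrightarrow> g x \<in> cbox u v"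
      by (metis gh hg image_eqI imageE)
    also have "\<dots> \<longleftrightarrow> x \<in> cbox (h u) (h v)"
      by (cases u, cases v) (auto simp: h_def g_def mem_box_cart forall_2)
    finally show "x \<in> h ` cbox u v \<longleftrightarrow> x \<in> cbox (h u) (h v)" .
  qed
  have c: "Sigma_Algebra.measure lborel (g ` cbox u v) = 1 * Sigma_Algebra.measure lborel (cbox u v)" for u v
  proof (cases "cbox u v = {}")
    case False
    then have "u $ i \<le> v $ i" for i by (simp add: interval_ne_empty_cart)
    then show ?thesis
      using False unfolding gim content_Pair by (simp add: content_cbox_cart prod_2 UNIV_2)
  qed simp
  have cg: "continuous (at x) g" for x
    unfolding g_def by (intro continuous_intros)
  have "((\<lambda>x. (case g x of (s, t) \<Rightarrow> f (vector [s, t]))) has_integral (1 / 1) *\<^sub>R i) (h ` cbox (0, 0) (1, 1))"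
    by (rule has_integral_twiddle[where g = g and h = h and r = 1])
       (use hg gh cg gim him c assms in \<open>auto\<close>)
  moreover have "(case g x of (s, t) \<Rightarrow> f (vector [s, t])) = f x" for x
    using hg[of x] by (simp add: g_def h_def)
  moreover have "h ` cbox (0, 0) (1, 1) = cbox 0 1"
    unfolding him by (auto simp: h_def vec_eq_iff forall_2 intro!: arg_cong2[of _ _ _ _ cbox])
  ultimately show ?thesis by simp
qed

lemma integrable_cell_continuous:
  fixes f :: "real^2 \<Rightarrow> 'a::euclidean_space"
  assumes "continuous_on UNIV f"
  shows "integrable cell f"
  by (rule continuous_imp_integrable) (rule continuous_on_subset[OF assms subset_UNIV])

lemma square_integrable_continuous:
  fixes f :: "real^2 \<Rightarrow> 'a::euclidean_space"
  assumes "continuous_on UNIV f"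
  shows "square_integrable f"
proof -
  have c: "continuous_on UNIV (\<lambda>x. (norm (f x))\<^sup>2)"
    by (intro continuous_intros assms)
  show ?thesis
    unfolding square_integrable_def
    using integrable_cell_continuous[OF c] borel_measurable_integrable[OF integrable_cell_continuous[OF assms]]
    by simp
qed

lemma continuous_vec2_pair:
  fixes f :: "real^2 \<Rightarrow> real"
  assumes "continuous_on UNIV f"
  shows "continuous_on S (\<lambda>(s, t). f (vector [s, t]))"
proof -
  have "(\<lambda>(s, t). f (vector [s, t])) = f \<circ> (\<lambda>p. \<chi> i. if i = 1 then fst p else snd p)"
  proof
    fix p :: "real \<times> real"
    have "(vector [fst p, snd p] :: real^2) = (\<chi> i. if i = 1 then fst p else snd p)"
      by (simp add: vec_eq_iff forall_2)
    then show "(case p of (s, t) \<Rightarrow> f (vector [s, t])) = (f \<circ> (\<lambda>p. \<chi> i. if i = 1 then fst p else snd p)) p"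
      by (simp add: case_prod_beta)
  qed
  moreover have "continuous_on S (\<lambda>p :: real \<times> real. (\<chi> i. if i = 1 then fst p else snd p) :: real^2)"
  proof (intro continuous_on_vec_lambda)
    fix i :: 2
    show "continuous_on S (\<lambda>p :: real \<times> real. if i = 1 then fst p else snd p)"
      by (cases "i = 1") (auto intro!: continuous_intros)
  qed
  ultimately show ?thesis
    using continuous_on_compose[OF _ continuous_on_subset[OF assms subset_UNIV]] by simp
qed

lemma continuous_vec2_fst:
  fixes f :: "real^2 \<Rightarrow> real"
  assumes "continuous_on UNIV f"
  shows "continuous_on S (\<lambda>s. f (vector [s, t]))"
  using continuous_on_compose2[OF continuous_vec2_pair[OF assms, of UNIV], of S "\<lambda>s. (s, t)"]
  by (simp add: continuous_on_Pair)

lemma continuous_vec2_snd: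
  fixes f :: "real^2 \<Rightarrow> real"
  assumes "continuous_on UNIV f"
  shows "continuous_on S (\<lambda>t. f (vector [s, t]))"
  using continuous_on_compose2[OF continuous_vec2_pair[OF assms, of UNIV], of S "\<lambda>t. (s, t)"]
  by (simp add: continuous_on_Pair)

text \<open>Both orders of integration are recorded so that a partial derivative can always be
  integrated in its own variable before the other.\<close>

lemma integral_cell_iterated:
  fixes f :: "real^2 \<Rightarrow> real"
  assumes "continuous_on UNIV f"
  shows "(\<integral>x. f x \<partial>cell) = integral {0..1} (\<lambda>s. integral {0..1} (\<lambda>t. f (vector [s, t])))"
    and "(\<integral>x. f x \<partial>cell) = integral {0..1} (\<lambda>t. integral {0..1} (\<lambda>s. f (vector [s, t])))"
proof -
  let ?u = "\<lambda>(s, t). f (vector [s, t])"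
  have c: "continuous_on (cbox (0, 0) (1, 1)) ?u"
    by (rule continuous_vec2_pair[OF assms])
  have "(\<integral>x. f x \<partial>cell) = integral (cbox 0 1) f"
    by (rule lebesgue_integral_eq_integral) (auto intro: integrable_cell_continuous[OF assms])
  also have "\<dots> = integral (cbox (0, 0) (1, 1)) ?u"
    by (intro integral_unique has_integral_vec2_pair integrable_integral integrable_continuous c)
  finally show 1: "(\<integral>x. f x \<partial>cell) = integral {0..1} (\<lambda>s. integral {0..1} (\<lambda>t. f (vector [s, t])))"
    using integral_prod_continuous[OF c] by simp
  show "(\<integral>x. f x \<partial>cell) = integral {0..1} (\<lambda>t. integral {0..1} (\<lambda>s. f (vector [s, t])))"
    unfolding 1 using integral_swap_continuous[of 0 0 1 1 "\<lambda>s t. f (vector [s, t])"] c by simp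
qed

lemma vector_shift:
  "(vector [s + 1, t] :: real^2) = vector [s, t] + axis 1 1"
  "(vector [s, t + 1] :: real^2) = vector [s, t] + axis 2 1"
  by (auto simp: vec_eq_iff forall_2 axis_def)

lemma partial_derivative_vec2:
  fixes f :: "real^2 \<Rightarrow> real"
  assumes "\<And>x. (f has_derivative (\<lambda>v. v \<bullet> g x)) (at x)"
  shows "((\<lambda>s. f (vector [s, t])) has_vector_derivative g (vector [s, t]) $ 1) (at s within S)"
    and "((\<lambda>t. f (vector [s, t])) has_vector_derivative g (vector [s, t]) $ 2) (at t within S)"
proof -
  have e: "(vector [s, t] :: real^2) = s *\<^sub>R axis 1 1 + t *\<^sub>R axis 2 1" for s t
    by (simp add: vec_eq_iff forall_2 axis_def)
  have "((\<lambda>s. f (s *\<^sub>R axis 1 1 + t *\<^sub>R axis 2 1)) has_derivative (\<lambda>h. (h *\<^sub>R axis 1 1) \<bullet> g (s *\<^sub>R axis 1 1 + t *\<^sub>R axis 2 1))) (at s within S)"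
    by (rule has_derivative_compose[OF _ assms, where f = "\<lambda>s. s *\<^sub>R axis 1 1 + t *\<^sub>R axis 2 1"])
       (auto intro!: derivative_eq_intros)
  then show "((\<lambda>s. f (vector [s, t])) has_vector_derivative g (vector [s, t]) $ 1) (at s within S)"
    unfolding e has_vector_derivative_def by (simp add: inner_axis')
  have "((\<lambda>t. f (s *\<^sub>R axis 1 1 + t *\<^sub>R axis 2 1)) has_derivative (\<lambda>h. (h *\<^sub>R axis 2 1) \<bullet> g (s *\<^sub>R axis 1 1 + t *\<^sub>R axis 2 1))) (at t within S)"
    by (rule has_derivative_compose[OF _ assms, where f = "\<lambda>t. s *\<^sub>R axis 1 1 + t *\<^sub>R axis 2 1"])
       (auto intro!: derivative_eq_intros)
  then show "((\<lambda>t. f (vector [s, t])) has_vector_derivative g (vector [s, t]) $ 2) (at t within S)"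
    unfolding e has_vector_derivative_def by (simp add: inner_axis')
qed

text \<open>The fundamental theorem of calculus along each line leaves the difference of
  \<open>f\<close> at opposite ends, which vanishes by periodicity. Applied to products this is
  integration by parts without boundary terms.\<close>

lemma integral_gradient_periodic:
  fixes f :: "real^2 \<Rightarrow> real"
  assumes d: "\<And>x. (f has_derivative (\<lambda>v. v \<bullet> g x)) (at x)" and per: "cell_periodic f"
    and g: "continuous_on UNIV g"
  shows "(\<integral>x. g x $ i \<partial>cell) = 0"
proof -
  have c: "continuous_on UNIV (\<lambda>x. g x $ i)" for i
    by (intro continuous_intros g)
  have 1: "integral {0..1} (\<lambda>s. g (vector [s, t]) $ 1) = 0" for t
    using fundamental_theorem_of_calculus[OF _ partial_derivative_vec2(1)[OF d], of 0 1 t]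
      per vector_shift(1)[of 0 t]
    by (simp add: cell_periodic_def integral_unique)
  have 2: "integral {0..1} (\<lambda>t. g (vector [s, t]) $ 2) = 0" for s
    using fundamental_theorem_of_calculus[OF _ partial_derivative_vec2(2)[OF d], of 0 1 s]
      per vector_shift(2)[of s 0]
    by (simp add: cell_periodic_def integral_unique)
  have "i = 1 \<or> i = 2" by (rule exhaust_2)
  then show ?thesis
    using integral_cell_iterated(2)[OF c, of 1] integral_cell_iterated(1)[OF c, of 2] 1 2 by auto
qed

section \<open>Calculus of smooth periodic test functions\<close>

lemma smooth_grad:
  assumes D: "\<forall>m n x. (D m n has_derivative (\<lambda>v. v $ 1 * D (Suc m) n x + v $ 2 * D m (Suc n) x)) (at x)"
  shows "grad (D m n) x = vector [D (Suc m) n x, D m (Suc n) x]"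
proof -
  have "frechet_derivative (D m n) (at x) = (\<lambda>v. v $ 1 * D (Suc m) n x + v $ 2 * D m (Suc n) x)"
    using frechet_derivative_at[OF D[rule_format]] by simp
  then show ?thesis
    by (simp add: grad_def vec_eq_iff forall_2 axis_def)
qed

lemma inner_vec2: "(v :: real^2) \<bullet> w = v $ 1 * w $ 1 + v $ 2 * w $ 2"
  by (simp add: inner_vec_def UNIV_2)

lemma has_derivative_grad:
  assumes "smooth \<psi>"
  shows "(\<psi> has_derivative (\<lambda>v. v \<bullet> grad \<psi> x)) (at x)"
proof -
  obtain D where D: "D 0 0 = \<psi>" "\<forall>m n x. (D m n has_derivative (\<lambda>v. v $ 1 * D (Suc m) n x + v $ 2 * D m (Suc n) x)) (at x)"
    using assms by (auto simp: smooth_def)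
  show ?thesis
    using D(2)[rule_format, of 0 0 x] smooth_grad[OF D(2), of 0 0 x] by (simp add: D(1) inner_vec2)
qed

lemma grad_eqI:
  assumes "(\<psi> has_derivative (\<lambda>v. v \<bullet> w)) (at x)"
  shows "grad \<psi> x = w"
  using frechet_derivative_at[OF assms, symmetric] by (simp add: grad_def vec_eq_iff inner_axis')

text \<open>Shifting one index of the array \<open>D\<close> yields the array of a partial
  derivative. Symmetry of second derivatives is built into \<open>smooth\<close>: both mixed
  derivatives are \<open>D 1 1\<close>.\<close>

lemma smooth_partial:
  assumes "smooth \<psi>"
  shows "smooth (\<lambda>x. grad \<psi> x $ i)"
    and "grad (\<lambda>x. grad \<psi> x $ 1) x $ 2 = grad (\<lambda>x. grad \<psi> x $ 2) x $ 1"
proof -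
  obtain D where D: "D 0 0 = \<psi>" "\<forall>m n x. (D m n has_derivative (\<lambda>v. v $ 1 * D (Suc m) n x + v $ 2 * D m (Suc n) x)) (at x)"
    using assms by (auto simp: smooth_def)
  have g: "grad \<psi> = (\<lambda>x. vector [D 1 0 x, D 0 1 x])"
    using smooth_grad[OF D(2), of 0 0] by (auto simp: D(1))
  have "smooth (D 1 0)" "smooth (D 0 1)"
    unfolding smooth_def using D(2)
    by (intro exI[of _ "\<lambda>m n. D (Suc m) n"] exI[of _ "\<lambda>m n. D m (Suc n)"]; simp)+
  moreover have "i = 1 \<or> i = 2" by (rule exhaust_2)
  ultimately show "smooth (\<lambda>x. grad \<psi> x $ i)"
    unfolding g by auto
  show "grad (\<lambda>x. grad \<psi> x $ 1) x $ 2 = grad (\<lambda>x. grad \<psi> x $ 2) x $ 1"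
    unfolding g using smooth_grad[OF D(2), of 1 0] smooth_grad[OF D(2), of 0 1] by simp
qed

lemma smooth_continuous: "smooth \<psi> \<Longrightarrow> continuous_on UNIV \<psi>"
  by (intro continuous_at_imp_continuous_on ballI has_derivative_continuous[OF has_derivative_grad])

lemma smooth_grad_continuous:
  assumes "smooth \<psi>"
  shows "continuous_on UNIV (grad \<psi>)"
proof -
  have "continuous_on UNIV (\<lambda>x. \<chi> i. grad \<psi> x $ i)"
    by (intro continuous_on_vec_lambda smooth_continuous smooth_partial(1) assms)
  then show ?thesis by simp
qed

lemma test_functionD:
  assumes "test_function \<psi>"
  shows "smooth \<psi>" "cell_periodic \<psi>" "continuous_on UNIV \<psi>" "continuous_on UNIV (grad \<psi>)"
    "square_integrable \<psi>" "square_integrable (grad \<psi>)"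
  using assms smooth_continuous smooth_grad_continuous square_integrable_continuous
  by (auto simp: test_function_def)

text \<open>Allows a weak gradient to be tested against derivatives of test functions, which is how
  its curl is seen to vanish.\<close>

lemma test_function_partial:
  assumes "test_function \<psi>"
  shows "test_function (\<lambda>x. grad \<psi> x $ i)"
proof -
  have "grad \<psi> (x + axis j 1) = grad \<psi> x" for x j
  proof (rule grad_eqI[symmetric])
    have "(\<psi> has_derivative (\<lambda>v. v \<bullet> grad \<psi> (x + axis j 1))) (at (x + axis j 1))"
      by (rule has_derivative_grad) (use assms in \<open>simp add: test_function_def\<close>)
    then have "((\<lambda>x. \<psi> (x + axis j 1)) has_derivative (\<lambda>v. v \<bullet> grad \<psi> (x + axis j 1))) (at x)"
      using has_derivative_compose[of "\<lambda>x. x + axis j 1" "\<lambda>v. v" x UNIV \<psi>]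
      by (simp add: has_derivative_add_const)
    then show "(\<psi> has_derivative (\<lambda>v. v \<bullet> grad \<psi> (x + axis j 1))) (at x)"
      using assms by (simp add: test_function_def cell_periodic_def)
  qed
  then show ?thesis
    using assms smooth_partial(1) by (simp add: test_function_def cell_periodic_def)
qed

lemma test_function_lincomb:
  assumes "test_function \<psi>" "test_function \<eta>"
  shows "test_function (\<lambda>x. a * \<psi> x + b * \<eta> x)"
    and "grad (\<lambda>x. a * \<psi> x + b * \<eta> x) x = a *\<^sub>R grad \<psi> x + b *\<^sub>R grad \<eta> x"
proof -
  obtain D where D: "D 0 0 = \<psi>" "\<And>m n x. (D m n has_derivative (\<lambda>v. v $ 1 * D (Suc m) n x + v $ 2 * D m (Suc n) x)) (at x)"
    using assms(1) by (auto simp: smooth_def test_function_def)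
  obtain E where E: "E 0 0 = \<eta>" "\<And>m n x. (E m n has_derivative (\<lambda>v. v $ 1 * E (Suc m) n x + v $ 2 * E m (Suc n) x)) (at x)"
    using assms(2) by (auto simp: smooth_def test_function_def)
  have "smooth (\<lambda>x. a * \<psi> x + b * \<eta> x)"
    unfolding smooth_def
    by (intro exI[of _ "\<lambda>m n x. a * D m n x + b * E m n x"])
      (auto simp: D(1) E(1) algebra_simps intro!: derivative_eq_intros D(2) E(2))
  then show "test_function (\<lambda>x. a * \<psi> x + b * \<eta> x)"
    using assms by (simp add: test_function_def cell_periodic_def)
  show "grad (\<lambda>x. a * \<psi> x + b * \<eta> x) x = a *\<^sub>R grad \<psi> x + b *\<^sub>R grad \<eta> x"
    by (rule grad_eqI)
      (auto intro!: derivative_eq_intros has_derivative_grad assms[THEN test_functionD(1)] simp: inner_add)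
qed

lemma test_function_const: "test_function (\<lambda>x. c)" "grad (\<lambda>x. c) x = 0"
proof -
  show "test_function (\<lambda>x. c)"
    unfolding test_function_def smooth_def cell_periodic_def
    by (intro conjI exI[of _ "\<lambda>m n x. if m = 0 \<and> n = 0 then c else 0"]) auto
  show "grad (\<lambda>x. c) x = 0"
    by (rule grad_eqI) simp
qed

text \<open>The product \<open>\<phi> * \<psi>\<close> is periodic, so its gradient integrates to
  zero; the product rule does the rest.\<close>

lemma has_weak_gradient_grad:
  assumes "test_function \<phi>"
  shows "has_weak_gradient \<phi> (grad \<phi>)"
  unfolding has_weak_gradient_def
proof (intro allI impI)
  fix \<psi> i assume psi: "test_function \<psi>"
  note c = test_functionD(3-4)[OF assms] test_functionD(3-4)[OF psi]
  let ?g = "\<lambda>x. \<phi> x *\<^sub>R grad \<psi> x + \<psi> x *\<^sub>R grad \<phi> x"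
  have "(\<integral>x. ?g x $ i \<partial>cell) = 0"
  proof (rule integral_gradient_periodic)
    show "((\<lambda>x. \<phi> x * \<psi> x) has_derivative (\<lambda>v. v \<bullet> ?g x)) (at x)" for x
      by (auto intro!: derivative_eq_intros has_derivative_grad assms[THEN test_functionD(1)] psi[THEN test_functionD(1)]
          simp: inner_add algebra_simps)
    show "cell_periodic (\<lambda>x. \<phi> x * \<psi> x)"
      using assms psi by (simp add: test_function_def cell_periodic_def)
    show "continuous_on UNIV ?g"
      by (intro continuous_intros c)
  qed
  moreover have "integrable cell (\<lambda>x. \<phi> x * grad \<psi> x $ i)" "integrable cell (\<lambda>x. \<psi> x * grad \<phi> x $ i)"
    by (intro integrable_cell_continuous continuous_intros c)+
  ultimately show "(\<integral>x. \<phi> x * grad \<psi> x $ i \<partial>cell) = - (\<integral>x. grad \<phi> x $ i * \<psi> x \<partial>cell)"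
    by (simp add: mult.commute)
qed

subsection \<open>The Poincare inequality\<close>

lemma power2_sum_le: "(a + b)\<^sup>2 \<le> 2 * a\<^sup>2 + 2 * (b::real)\<^sup>2"
  using zero_le_power2[of "a - b"] by (simp add: power2_eq_square algebra_simps)

lemma abs_diff_integral_le:
  fixes v :: "real \<Rightarrow> real"
  assumes c: "continuous_on {0..1} v" and b: "\<And>r. r \<in> {0..1} \<Longrightarrow> \<bar>c - v r\<bar> \<le> K"
  shows "\<bar>c - integral {0..1} v\<bar> \<le> K"
proof -
  have "c - integral {0..1} v = integral {0..1} (\<lambda>r. c - v r)"
    using Henstock_Kurzweil_Integration.integral_diff[OF integrable_const_ivl integrable_continuous_interval[OF c], of c]
    by simp
  moreover have "norm (integral {0..1} (\<lambda>r. c - v r)) \<le> K * (1 - 0)"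
    by (rule integral_bound) (auto intro!: continuous_intros c b)
  ultimately show ?thesis by simp
qed

lemma abs_diff_le_integral_abs:
  fixes v w :: "real \<Rightarrow> real"
  assumes v: "\<And>r S. (v has_vector_derivative w r) (at r within S)" and w: "continuous_on {0..1} w"
    and s: "s \<in> {0..1}" "s' \<in> {0..1}"
  shows "\<bar>v s - v s'\<bar> \<le> integral {0..1} (\<lambda>r. \<bar>w r\<bar>)"
proof -
  have *: "\<bar>v b - v a\<bar> \<le> integral {0..1} (\<lambda>r. \<bar>w r\<bar>)" if "a \<le> b" "a \<in> {0..1}" "b \<in> {0..1}" for a b
  proof -
    have sub: "{a..b} \<subseteq> {0..1}" using that by auto
    have i: "(w has_integral (v b - v a)) {a..b}"
      by (rule fundamental_theorem_of_calculus) (use that v in auto)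
    have ia: "(\<lambda>r. \<bar>w r\<bar>) integrable_on {0..1}" "(\<lambda>r. \<bar>w r\<bar>) integrable_on {a..b}"
      using sub by (auto intro!: integrable_continuous_interval continuous_intros w continuous_on_subset[OF w])
    have "\<bar>v b - v a\<bar> = norm (integral {a..b} w)"
      using i by (simp add: integral_unique)
    also have "\<dots> \<le> integral {a..b} (\<lambda>r. \<bar>w r\<bar>)"
      using i ia by (intro integral_norm_bound_integral) auto
    also have "\<dots> \<le> integral {0..1} (\<lambda>r. \<bar>w r\<bar>)"
      by (rule integral_subset_le) (use sub ia in auto)
    finally show ?thesis .
  qed
  show ?thesis
    using *[of s s'] *[of s' s] s by (cases "s \<le> s'") (auto simp: abs_minus_commute)
qed

text \<open>The variance of \<open>\<bar>w\<bar>\<close> over the unit interval is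
  nonnegative.\<close>

lemma integral_abs_power2_le:
  fixes w :: "real \<Rightarrow> real"
  assumes w: "continuous_on {0..1} w"
  shows "(integral {0..1} (\<lambda>r. \<bar>w r\<bar>))\<^sup>2 \<le> integral {0..1} (\<lambda>r. (w r)\<^sup>2)"
proof -
  define c where "c = integral {0..1} (\<lambda>r. \<bar>w r\<bar>)"
  have i: "(\<lambda>r. \<bar>w r\<bar>) integrable_on {0..1}" "(\<lambda>r. (w r)\<^sup>2) integrable_on {0..1}"
    by (auto intro!: integrable_continuous_interval continuous_intros w)
  have "0 \<le> integral {0..1} (\<lambda>r. (\<bar>w r\<bar> - c)\<^sup>2)"
    by (intro Henstock_Kurzweil_Integration.integral_nonneg integrable_continuous_interval continuous_intros w) auto
  also have "(\<lambda>r. (\<bar>w r\<bar> - c)\<^sup>2) = (\<lambda>r. (w r)\<^sup>2 - (2 * c) * \<bar>w r\<bar> + c\<^sup>2)"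
    by (auto simp: power2_diff algebra_simps)
  also have "integral {0..1} \<dots> = integral {0..1} (\<lambda>r. (w r)\<^sup>2) - 2 * c * c + c\<^sup>2"
    using integrable_diff[OF i(2) integrable_on_mult_right[OF i(1), of "2 * c"]]
      Henstock_Kurzweil_Integration.integral_diff[OF i(2) integrable_on_mult_right[OF i(1), of "2 * c"]]
    by (simp add: Henstock_Kurzweil_Integration.integral_add[OF _ integrable_const_ivl] flip: c_def)
  finally show ?thesis
    by (simp add: c_def power2_eq_square)
qed

lemma integrable_inner_integral:
  fixes f :: "real^2 \<Rightarrow> real"
  assumes "continuous_on UNIV f"
  shows "(\<lambda>t. integral {0..1} (\<lambda>s. f (vector [s, t]))) integrable_on {0..1}"
    and "continuous_on {0..1} (\<lambda>t. integral {0..1} (\<lambda>s. f (vector [s, t])))"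
proof -
  have "continuous_on ({0..1} \<times> cbox 0 1) (\<lambda>(t, s). f (vector [s, t]))"
    using continuous_on_compose2[OF continuous_vec2_pair[OF assms, of UNIV] continuous_on_swap]
    by (simp add: case_prod_beta)
  then show "continuous_on {0..1} (\<lambda>t. integral {0..1} (\<lambda>s. f (vector [s, t])))"
    using integral_continuous_on_param[of "{0..1}" 0 1 "\<lambda>t s. f (vector [s, t])"] by simp
  then show "(\<lambda>t. integral {0..1} (\<lambda>s. f (vector [s, t]))) integrable_on {0..1}"
    by (rule integrable_continuous_interval)
qed

text \<open>The deviation from the mean splits as \<open>(\<psi> - A t) + (A t - m)\<close>, where
  \<open>A t\<close> is the mean over the line at height \<open>t\<close>. Each part is controlled
  by one partial derivative through a one-dimensional estimate; the constant 2 is the price of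
  \<open>power2_sum_le\<close>.\<close>

lemma poincare:
  assumes "test_function \<psi>"
  shows "(\<integral>x. (\<psi> x - (\<integral>x. \<psi> x \<partial>cell))\<^sup>2 \<partial>cell) \<le> 2 * (\<integral>x. (norm (grad \<psi> x))\<^sup>2 \<partial>cell)"
proof -
  note c = test_functionD(3,4)[OF assms]
  note d = has_derivative_grad[OF test_functionD(1)[OF assms]]
  have cg: "continuous_on UNIV (\<lambda>x. grad \<psi> x $ i)" for i
    by (intro continuous_intros c)
  have cg2: "continuous_on UNIV (\<lambda>x. (grad \<psi> x $ i)\<^sup>2)" for i
    by (intro continuous_intros c)
  have cga: "continuous_on UNIV (\<lambda>x. \<bar>grad \<psi> x $ i\<bar>)" for i
    by (intro continuous_intros c)
  define m where "m = (\<integral>x. \<psi> x \<partial>cell)"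
  define A where "A t = integral {0..1} (\<lambda>s. \<psi> (vector [s, t]))" for t
  define P where "P t = integral {0..1} (\<lambda>s. (grad \<psi> (vector [s, t]) $ 1)\<^sup>2)" for t
  define Q where "Q = (\<integral>x. \<bar>grad \<psi> x $ 2\<bar> \<partial>cell)"
  define Q2 where "Q2 = (\<integral>x. (grad \<psi> x $ 2)\<^sup>2 \<partial>cell)"
  have 1: "(\<psi> (vector [s, t]) - A t)\<^sup>2 \<le> P t" if "s \<in> {0..1}" for s t
  proof -
    have "\<bar>\<psi> (vector [s, t]) - A t\<bar> \<le> integral {0..1} (\<lambda>r. \<bar>grad \<psi> (vector [r, t]) $ 1\<bar>)"
      unfolding A_def
      by (intro abs_diff_integral_le abs_diff_le_integral_abs[OF partial_derivative_vec2(1)[OF d]]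
          continuous_vec2_fst c cg that)
    then have "(\<psi> (vector [s, t]) - A t)\<^sup>2 \<le> (integral {0..1} (\<lambda>r. \<bar>grad \<psi> (vector [r, t]) $ 1\<bar>))\<^sup>2"
      by (metis abs_ge_zero power2_abs power_mono)
    also have "\<dots> \<le> P t"
      unfolding P_def by (intro integral_abs_power2_le continuous_vec2_fst cg)
    finally show ?thesis .
  qed
  \<comment> \<open>\<open>A\<close> is not differentiated under the integral sign: the
    one-dimensional bound in the second variable is integrated over \<open>s\<close>
    instead.\<close>
  have 2: "\<bar>A t - A t'\<bar> \<le> Q" if "t \<in> {0..1}" "t' \<in> {0..1}" for t t'
  proof -
    have i: "(\<lambda>s. \<psi> (vector [s, t])) integrable_on {0..1}" for t
      by (intro integrable_continuous_interval continuous_vec2_fst c)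
    have cs: "continuous_on ({0..1} \<times> cbox 0 1) (\<lambda>(s, t). \<bar>grad \<psi> (vector [s, t]) $ 2\<bar>)"
      using continuous_vec2_pair[OF cga] by simp
    have "A t - A t' = integral {0..1} (\<lambda>s. \<psi> (vector [s, t]) - \<psi> (vector [s, t']))"
      unfolding A_def using i by (simp add: Henstock_Kurzweil_Integration.integral_diff)
    also have "norm \<dots> \<le> integral {0..1} (\<lambda>s. integral {0..1} (\<lambda>r. \<bar>grad \<psi> (vector [s, r]) $ 2\<bar>))"
    proof (rule integral_norm_bound_integral)
      show "(\<lambda>s. \<psi> (vector [s, t]) - \<psi> (vector [s, t'])) integrable_on {0..1}"
        using i by (intro integrable_diff)
      show "(\<lambda>s. integral {0..1} (\<lambda>r. \<bar>grad \<psi> (vector [s, r]) $ 2\<bar>)) integrable_on {0..1}"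
        using integral_continuous_on_param[OF cs] by (intro integrable_continuous_interval) simp
      show "norm (\<psi> (vector [s, t]) - \<psi> (vector [s, t'])) \<le> integral {0..1} (\<lambda>r. \<bar>grad \<psi> (vector [s, r]) $ 2\<bar>)" for s
        unfolding real_norm_def
        by (intro abs_diff_le_integral_abs[OF partial_derivative_vec2(2)[OF d]] continuous_vec2_snd cg that)
    qed
    also have "\<dots> = Q"
      unfolding Q_def by (rule integral_cell_iterated(1)[symmetric, OF cga])
    finally show ?thesis by simp
  qed
  have cA: "continuous_on {0..1} A"
    unfolding A_def by (rule integrable_inner_integral(2)[OF c(1)])
  have mA: "m = integral {0..1} A"
    unfolding m_def A_def by (rule integral_cell_iterated(2)[OF c(1)])
  have QQ: "Q\<^sup>2 \<le> Q2"
    using Cauchy_Schwarz_cell[OF square_integrable_continuous[OF cga[of 2]] square_integrable_const[of 1]]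
    by (simp add: Q_def Q2_def)
  have 3: "(A t - m)\<^sup>2 \<le> Q2" if "t \<in> {0..1}" for t
  proof -
    have "\<bar>A t - m\<bar> \<le> Q"
      unfolding mA by (intro abs_diff_integral_le cA 2 that)
    then have "(A t - m)\<^sup>2 \<le> Q\<^sup>2"
      by (metis abs_ge_zero power2_abs power_mono)
    with QQ show ?thesis by simp
  qed
  have 4: "(\<psi> (vector [s, t]) - m)\<^sup>2 \<le> 2 * P t + 2 * Q2" if "s \<in> {0..1}" "t \<in> {0..1}" for s t
  proof -
    let ?a = "\<psi> (vector [s, t]) - A t" and ?b = "A t - m"
    have "(?a + ?b)\<^sup>2 \<le> 2 * ?a\<^sup>2 + 2 * ?b\<^sup>2"
      by (rule power2_sum_le)
    with 1[OF that(1), of t] 3[OF that(2)] show ?thesis by simp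
  qed
  have cm: "continuous_on UNIV (\<lambda>x. (\<psi> x - m)\<^sup>2)"
    by (intro continuous_intros c)
  have P: "P integrable_on {0..1}" and PI: "integral {0..1} P = (\<integral>x. (grad \<psi> x $ 1)\<^sup>2 \<partial>cell)"
    unfolding P_def using integrable_inner_integral(1)[OF cg2] integral_cell_iterated(2)[OF cg2] by auto
  have "(\<integral>x. (\<psi> x - m)\<^sup>2 \<partial>cell) = integral {0..1} (\<lambda>t. integral {0..1} (\<lambda>s. (\<psi> (vector [s, t]) - m)\<^sup>2))"
    by (rule integral_cell_iterated(2)[OF cm])
  also have "\<dots> \<le> integral {0..1} (\<lambda>t. 2 * P t + 2 * Q2)"
  proof (rule integral_le)
    show "(\<lambda>t. integral {0..1} (\<lambda>s. (\<psi> (vector [s, t]) - m)\<^sup>2)) integrable_on {0..1}"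
      by (rule integrable_inner_integral(1)[OF cm])
    show "(\<lambda>t. 2 * P t + 2 * Q2) integrable_on {0..1}"
      by (intro integrable_add integrable_on_mult_right P integrable_const_ivl)
    fix t :: real assume t: "t \<in> {0..1}"
    have "integral {0..1} (\<lambda>s. (\<psi> (vector [s, t]) - m)\<^sup>2) \<le> integral {0..1} (\<lambda>s::real. 2 * P t + 2 * Q2)"
    proof (rule integral_le)
      show "(\<lambda>s. (\<psi> (vector [s, t]) - m)\<^sup>2) integrable_on {0..1}"
        by (rule integrable_continuous_interval[OF continuous_vec2_fst[OF cm]])
    qed (use 4 t in auto)
    then show "integral {0..1} (\<lambda>s. (\<psi> (vector [s, t]) - m)\<^sup>2) \<le> 2 * P t + 2 * Q2" by simp
  qed
  also have "\<dots> = 2 * integral {0..1} P + 2 * Q2"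
    using Henstock_Kurzweil_Integration.integral_add[OF integrable_on_mult_right[OF P, of 2] integrable_const_ivl]
    by simp
  also have "\<dots> = 2 * (\<integral>x. (norm (grad \<psi> x))\<^sup>2 \<partial>cell)"
    unfolding PI Q2_def power2_norm_eq_inner inner_vec2
    using integrable_cell_continuous[OF cg2] by (simp add: power2_eq_square)
  finally show ?thesis unfolding m_def .
qed

section \<open>Mean-square limits of gradients\<close>

lemma L2_tendsto_Cauchy:
  assumes "L2_tendsto h f" "\<And>n. square_integrable (h n)" "square_integrable f" "e > 0"
  shows "\<exists>N. \<forall>m\<ge>N. \<forall>n\<ge>N. (\<integral>x. (norm (h m x - h n x))\<^sup>2 \<partial>cell) < e"
proof -
  have e4: "e / 4 > 0" using assms by simp
  obtain N where N0: "\<forall>n\<ge>N. norm ((\<integral>x. (norm (h n x - f x))\<^sup>2 \<partial>cell) - 0) < e / 4"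
    using LIMSEQ_D[OF assms(1)[unfolded L2_tendsto_def] e4] by blast
  have N: "(\<integral>x. (norm (h n x - f x))\<^sup>2 \<partial>cell) < e / 4" if "n \<ge> N" for n
    using N0[rule_format, OF that] by simp
  have "(\<integral>x. (norm (h m x - h n x))\<^sup>2 \<partial>cell) < e" if "m \<ge> N" "n \<ge> N" for m n
  proof -
    have i: "integrable cell (\<lambda>x. (norm (h n x - f x))\<^sup>2)" for n
      by (rule square_integrable_norm) (intro square_integrable_diff assms)
    have "(norm (h m x - h n x))\<^sup>2 \<le> 2 * (norm (h m x - f x))\<^sup>2 + 2 * (norm (h n x - f x))\<^sup>2" for x
    proof -
      have "norm (h m x - h n x) \<le> norm (h m x - f x) + norm (h n x - f x)"
        by (metis dist_norm dist_triangle2)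
      then have "(norm (h m x - h n x))\<^sup>2 \<le> (norm (h m x - f x) + norm (h n x - f x))\<^sup>2"
        by (intro power_mono) auto
      also have "\<dots> \<le> 2 * (norm (h m x - f x))\<^sup>2 + 2 * (norm (h n x - f x))\<^sup>2"
        by (rule power2_sum_le)
      finally show ?thesis .
    qed
    then have "(\<integral>x. (norm (h m x - h n x))\<^sup>2 \<partial>cell) \<le> (\<integral>x. 2 * (norm (h m x - f x))\<^sup>2 + 2 * (norm (h n x - f x))\<^sup>2 \<partial>cell)"
      using i square_integrable_norm[OF square_integrable_diff[OF assms(2) assms(2)], of m n]
      by (intro Bochner_Integration.integral_mono) auto
    also have "\<dots> = 2 * (\<integral>x. (norm (h m x - f x))\<^sup>2 \<partial>cell) + 2 * (\<integral>x. (norm (h n x - f x))\<^sup>2 \<partial>cell)"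
      using i by simp
    also have "\<dots> < e"
      using N[OF that(1)] N[OF that(2)] by simp
    finally show ?thesis .
  qed
  then show ?thesis by blast
qed

text \<open>The boundary is discarded twice: where a periodic extension must choose a value, and
  where \<open>torus_map\<close> fails to be injective.\<close>

lemma null_cell_boundary: "AE x in cell. x \<in> box 0 1"
proof -
  have "negligible (cbox 0 1 - box (0::real^2) 1)"
    by (rule negligible_frontier_interval)
  then have "cbox 0 1 - box (0::real^2) 1 \<in> null_sets lebesgue"
    by (simp add: negligible_iff_null_sets)
  then have "AE x in lebesgue. x \<notin> cbox 0 1 - box (0::real^2) 1"
    by (rule AE_not_in)
  then show ?thesis
    by (auto simp: AE_restrict_space_iff elim!: eventually_mono)
qed

text \<open>A mean-square limit is determined only on the cell, whereas \<open>H1_per\<close> asks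
  for a function periodic on the whole plane. Composition with the fractional part makes it
  periodic, at the cost of its values on a null set.\<close>

lemma periodic_representative:
  fixes f :: "real^2 \<Rightarrow> real"
  assumes f: "square_integrable f"
  obtains g where "cell_periodic g" "square_integrable g" "AE x in cell. g x = f x"
proof -
  define fr :: "real^2 \<Rightarrow> real^2" where "fr x = (\<chi> i. frac (x $ i))" for x
  \<comment> \<open>Points whose fractional part has a zero coordinate get the value
    \<open>0\<close>. All sides of the cell are thus treated alike, and on the cell \<open>g\<close>
    is \<open>f\<close> cut off to the open box.\<close>
  define g where "g x = (if fr x \<in> box 0 1 then f (fr x) else 0)" for x
  have per: "cell_periodic g"
  proof -
    have "fr (x + axis i 1) = fr x" for x i
      by (simp add: fr_def vec_eq_iff axis_def frac_1_eq)
    then show ?thesis by (simp add: cell_periodic_def g_def)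
  qed
  have g_eq: "g x = (if x \<in> box 0 1 then f x else 0)" if "x \<in> cbox 0 1" for x
  proof (cases "\<forall>i. x $ i < 1")
    case True
    then have "fr x = x"
      using that by (auto simp: fr_def vec_eq_iff mem_box_cart frac_eq)
    then show ?thesis by (simp add: g_def)
  next
    case False
    then obtain i where "\<not> x $ i < 1" by blast
    moreover have "x $ i \<le> 1" using that by (simp add: mem_box_cart)
    ultimately have "x $ i = 1" by linarith
    then have "fr x $ i = 0" "x \<notin> box 0 1"
      by (auto simp: fr_def mem_box_cart intro!: exI[of _ i])
    then have "fr x \<notin> box 0 1"
      by (metis less_irrefl mem_box_cart(1) zero_index)
    then show ?thesis using \<open>x \<notin> box 0 1\<close> by (simp add: g_def)
  qed
  have [measurable]: "f \<in> borel_measurable cell"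
    using f by (simp add: square_integrable_def)
  have bx: "box (0::real^2) 1 \<inter> space cell \<in> sets cell"
    by (subst sets_restrict_space_iff) (auto simp: space_restrict_space)
  have "(\<lambda>x. if x \<in> box 0 1 then f x else 0) \<in> borel_measurable cell"
    by (rule measurable_If_set) (use bx in auto)
  then have gm: "g \<in> borel_measurable cell"
    by (subst measurable_cong[where g = "\<lambda>x. if x \<in> box 0 1 then f x else 0"]) (auto simp: g_eq)
  have ae: "AE x in cell. g x = f x"
    using null_cell_boundary
  proof eventually_elim
    case (elim x)
    then have "x \<in> cbox 0 1" using box_subset_cbox by blast
    with elim show ?case by (simp add: g_eq)
  qed
  then have "square_integrable g"
    by (intro square_integrable_cong_AE[OF f gm]) (auto elim: eventually_mono)
  then show ?thesis using that per ae by blast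
qed

text \<open>Convergence of gradients says nothing about additive constants, so the potentials are
  normalised to mean zero. The Poincare inequality makes them a Cauchy sequence, and both sides of
  the weak identity pass to the limit.\<close>

lemma H1_per_L2_limit:
  assumes t: "\<And>n. test_function (t n)" and G: "square_integrable G"
    and lim: "L2_tendsto (\<lambda>n. grad (t n)) G"
  obtains \<phi> where "H1_per \<phi> G"
proof -
  define u where "u n x = 1 * t n x + 1 * (- (\<integral>x. t n x \<partial>cell))" for n x
  have u: "test_function (u n)" and gu: "grad (u n) x = grad (t n) x" for n x
    using test_function_lincomb[OF t test_function_const(1), of 1 n 1 "- (\<integral>x. t n x \<partial>cell)"]
    unfolding u_def by (simp_all add: test_function_const)
  have su: "square_integrable (u n)" and sg: "square_integrable (grad (t n))" for n
    using test_functionD u t by auto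
  have cau: "(\<integral>x. (norm (u m x - u n x))\<^sup>2 \<partial>cell) \<le> 2 * (\<integral>x. (norm (grad (t m) x - grad (t n) x))\<^sup>2 \<partial>cell)" for m n
  proof -
    let ?d = "\<lambda>x. t m x - t n x"
    have d: "test_function ?d" "\<And>x. grad ?d x = grad (t m) x - grad (t n) x"
      using test_function_lincomb[OF t t, of 1 m "-1" n] by simp_all
    have "(\<integral>x. ?d x \<partial>cell) = (\<integral>x. t m x \<partial>cell) - (\<integral>x. t n x \<partial>cell)"
      using square_integrable_imp_integrable[OF test_functionD(5)[OF t]] by simp
    then have "u m x - u n x = ?d x - (\<integral>x. ?d x \<partial>cell)" for x
      by (simp add: u_def)
    then show ?thesis using poincare[OF d(1)] by (simp add: d(2))
  qed
  obtain f where f: "square_integrable f" "L2_tendsto u f"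
  proof (rule L2_complete[of u])
    fix e :: real assume "e > 0"
    then have "e / 2 > 0" by simp
    from L2_tendsto_Cauchy[OF lim sg G this] obtain N where
      N: "\<And>m n. m \<ge> N \<Longrightarrow> n \<ge> N \<Longrightarrow> (\<integral>x. (norm (grad (t m) x - grad (t n) x))\<^sup>2 \<partial>cell) < e / 2"
      by blast
    have "(\<integral>x. (norm (u m x - u n x))\<^sup>2 \<partial>cell) < e" if "m \<ge> N" "n \<ge> N" for m n
      using cau[of m n] N[OF that] by linarith
    then show "\<exists>N. \<forall>m\<ge>N. \<forall>n\<ge>N. (\<integral>x. (norm (u m x - u n x))\<^sup>2 \<partial>cell) < e" by blast
  qed (use su in auto)
  obtain \<phi> where phi: "cell_periodic \<phi>" "square_integrable \<phi>" "AE x in cell. \<phi> x = f x"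
    by (rule periodic_representative[OF f(1)])
  have "has_weak_gradient \<phi> G"
    unfolding has_weak_gradient_def
  proof (intro allI impI)
    fix \<psi> i assume psi: "test_function \<psi>"
    have sp: "square_integrable (\<lambda>x. grad \<psi> x $ i)" "square_integrable (\<lambda>x. \<psi> x *\<^sub>R axis i (1::real))"
      using test_functionD[OF psi] by (auto intro!: square_integrable_continuous continuous_intros)
    have "(\<integral>x. \<phi> x * grad \<psi> x $ i \<partial>cell) = (\<integral>x. f x * grad \<psi> x $ i \<partial>cell)"
    proof (rule integral_cong_AE)
      show "AE x in cell. \<phi> x * grad \<psi> x $ i = f x * grad \<psi> x $ i"
        using phi(3) by eventually_elim simp
    qed (use phi f sp in \<open>auto simp: square_integrable_def\<close>)
    moreover have "(\<lambda>n. \<integral>x. u n x * grad \<psi> x $ i \<partial>cell) \<longlonglongrightarrow> (\<integral>x. f x * grad \<psi> x $ i \<partial>cell)"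
      using L2_tendsto_inner[OF f(2) su f(1) sp(1)] by simp
    moreover have "(\<integral>x. u n x * grad \<psi> x $ i \<partial>cell) = - (\<integral>x. grad (t n) x \<bullet> (\<psi> x *\<^sub>R axis i 1) \<partial>cell)" for n
      using has_weak_gradient_grad[OF u, of n] psi
      by (simp add: has_weak_gradient_def gu inner_axis mult.commute)
    moreover have "(\<lambda>n. - (\<integral>x. grad (t n) x \<bullet> (\<psi> x *\<^sub>R axis i 1) \<partial>cell)) \<longlonglongrightarrow> - (\<integral>x. G x \<bullet> (\<psi> x *\<^sub>R axis i 1) \<partial>cell)"
      by (intro tendsto_minus L2_tendsto_inner[OF lim sg G sp(2)])
    ultimately have "(\<integral>x. \<phi> x * grad \<psi> x $ i \<partial>cell) = - (\<integral>x. G x \<bullet> (\<psi> x *\<^sub>R axis i 1) \<partial>cell)"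
      using LIMSEQ_unique by simp
    then show "(\<integral>x. \<phi> x * grad \<psi> x $ i \<partial>cell) = - (\<integral>x. G x $ i * \<psi> x \<partial>cell)"
      by (simp add: inner_axis mult.commute)
  qed
  then show ?thesis
    using that phi G by (simp add: H1_per_def)
qed

subsection \<open>Completeness of the trigonometric system\<close>

text \<open>A free phase replaces the pair of sine and cosine: derivatives and products stay within
  the span of one family, up to phase shifts by \<open>pi / 2\<close>.\<close>

definition wave :: "int \<Rightarrow> int \<Rightarrow> real \<Rightarrow> real^2 \<Rightarrow> real" where
  "wave k l \<theta> x = sin (2 * pi * (of_int k * x $ 1 + of_int l * x $ 2) + \<theta>)"

inductive trig_poly :: "(real^2 \<Rightarrow> real) \<Rightarrow> bool" where
  wave: "trig_poly (\<lambda>x. c * wave k l \<theta> x)"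
| add: "trig_poly s \<Longrightarrow> trig_poly t \<Longrightarrow> trig_poly (\<lambda>x. s x + t x)"

lemma trig_poly_cmult: "trig_poly t \<Longrightarrow> trig_poly (\<lambda>x. a * t x)"
proof (induction rule: trig_poly.induct)
  case (wave c k l \<theta>)
  show ?case using trig_poly.wave[of "a * c" k l \<theta>] by (simp add: mult.assoc)
next
  case (add s t)
  show ?case using trig_poly.add[OF add.IH] by (simp add: distrib_left)
qed

lemma trig_poly_const: "trig_poly (\<lambda>x. c)"
  using trig_poly.wave[of c 0 0 "pi / 2"] by (simp add: wave_def)

text \<open>Product-to-sum formula; the cosines appear as waves with phase advanced by
  \<open>pi / 2\<close>.\<close>

lemma wave_mult:
  "wave k l \<theta> x * wave k' l' \<theta>' x =
    1/2 * wave (k - k') (l - l') (\<theta> - \<theta>' + pi / 2) x + (- 1/2) * wave (k + k') (l + l') (\<theta> + \<theta>' + pi / 2) x"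
proof -
  let ?a = "2 * pi * (of_int k * x $ 1 + of_int l * x $ 2) + \<theta>"
  let ?b = "2 * pi * (of_int k' * x $ 1 + of_int l' * x $ 2) + \<theta>'"
  have "wave (k - k') (l - l') (\<theta> - \<theta>' + pi / 2) x = sin ((?a - ?b) + pi / 2)"
    "wave (k + k') (l + l') (\<theta> + \<theta>' + pi / 2) x = sin ((?a + ?b) + pi / 2)"
    unfolding wave_def by (simp_all add: algebra_simps)
  then have "wave (k - k') (l - l') (\<theta> - \<theta>' + pi / 2) x = cos (?a - ?b)"
    "wave (k + k') (l + l') (\<theta> + \<theta>' + pi / 2) x = cos (?a + ?b)"
    by (simp_all add: sin_add)
  then show ?thesis
    by (simp add: wave_def sin_times_sin)
qed

lemma trig_poly_mult:
  assumes "trig_poly s" "trig_poly t"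
  shows "trig_poly (\<lambda>x. s x * t x)"
  using assms(1)
proof (induction rule: trig_poly.induct)
  case (wave c k l \<theta>)
  show ?case
    using assms(2)
  proof (induction rule: trig_poly.induct)
    case (wave c' k' l' \<theta>')
    have "c * wave k l \<theta> x * (c' * wave k' l' \<theta>' x) = (c * c') * (wave k l \<theta> x * wave k' l' \<theta>' x)" for x
      by simp
    then show ?case
      unfolding wave_mult by (simp only:) (intro trig_poly_cmult trig_poly.intros)
  next
    case (add s t)
    show ?case using trig_poly.add[OF add.IH] by (simp add: distrib_left)
  qed
next
  case (add s t)
  show ?case using trig_poly.add[OF add.IH] by (simp add: distrib_right)
qed

section \<open>Uniform approximation on the torus\<close>

lemma continuous_wave: "continuous_on UNIV (wave k l \<theta>)"
  unfolding wave_def by (intro continuous_intros)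

lemma trig_poly_continuous: "trig_poly t \<Longrightarrow> continuous_on UNIV t"
  by (induction rule: trig_poly.induct) (intro continuous_intros continuous_wave; assumption)+

text \<open>Realises the torus as a compact subset of a Euclidean space, where the theorems of
  Tietze and Stone-Weierstrass apply; real polynomials there pull back to trigonometric
  polynomials.\<close>

definition torus_map :: "real^2 \<Rightarrow> complex \<times> complex" where
  "torus_map x = (cis (2 * pi * x $ 1), cis (2 * pi * x $ 2))"

lemma continuous_torus_map: "continuous_on S torus_map"
  unfolding torus_map_def by (intro continuous_intros)

lemma cis_2pi_inj:
  assumes "cis (2 * pi * a) = cis (2 * pi * b)" "0 < a" "a < 1" "0 < b" "b < 1"
  shows "a = b"
proof -
  have "sin (2 * pi * a) = sin (2 * pi * b) \<and> cos (2 * pi * a) = cos (2 * pi * b)"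
    using assms(1) by (simp add: complex_eq_iff)
  then have "\<exists>n::int. 2 * pi * a = 2 * pi * b + 2 * pi * of_int n"
    by (simp add: sin_cos_eq_iff)
  then obtain n :: int where "2 * pi * a = 2 * pi * (b + of_int n)"
    by (auto simp: distrib_left)
  then have n: "a = b + of_int n" by simp
  then have "of_int n < (1::real)" "of_int n > (-1::real)" using assms by auto
  then have "n = 0" by linarith
  then show ?thesis using n by simp
qed

lemma inj_on_torus_map: "inj_on torus_map (box 0 1)"
  by (rule inj_onI) (auto simp: torus_map_def mem_box_cart vec_eq_iff forall_2 intro: cis_2pi_inj)

lemma trig_poly_polynomial:
  assumes "real_polynomial_function p"
  shows "trig_poly (\<lambda>x. p (torus_map x))"
  using assms
proof (induction rule: real_polynomial_function.induct)
  case (linear f)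
  interpret bounded_linear f by (rule linear)
  have "torus_map x = cos (2 * pi * x $ 1) *\<^sub>R (1, 0) + sin (2 * pi * x $ 1) *\<^sub>R (\<i>, 0) +
      (cos (2 * pi * x $ 2) *\<^sub>R (0, 1) + sin (2 * pi * x $ 2) *\<^sub>R (0, \<i>))" for x
    by (simp add: torus_map_def complex_eq_iff)
  then have "f (torus_map x) = cos (2 * pi * x $ 1) * f (1, 0) + sin (2 * pi * x $ 1) * f (\<i>, 0) +
      (cos (2 * pi * x $ 2) * f (0, 1) + sin (2 * pi * x $ 2) * f (0, \<i>))" for x
    by (simp only: add scaleR real_scaleR_def)
  moreover have "cos (2 * pi * x $ 1) = wave 1 0 (pi / 2) x" "sin (2 * pi * x $ 1) = wave 1 0 0 x"
    "cos (2 * pi * x $ 2) = wave 0 1 (pi / 2) x" "sin (2 * pi * x $ 2) = wave 0 1 0 x" for x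
    by (simp_all add: wave_def sin_add)
  ultimately have e: "f (torus_map x) = f (1, 0) * wave 1 0 (pi / 2) x + f (\<i>, 0) * wave 1 0 0 x +
      (f (0, 1) * wave 0 1 (pi / 2) x + f (0, \<i>) * wave 0 1 0 x)" for x
    by (simp only: mult.commute)
  show ?case unfolding e by (intro trig_poly.intros)
next
  case (const c)
  show ?case by (rule trig_poly_const)
qed (auto intro: trig_poly.add trig_poly_mult)

text \<open>\<open>g\<close> is not assumed periodic, so approximation on the whole cell cannot be
  expected. On \<open>K\<close>, away from the boundary, \<open>torus_map\<close> is injective and
  \<open>g\<close> descends to the image of \<open>K\<close>; Tietze extends it with the bound 1,
  and polynomials approximate the extension on the image of the cell. The global bound
  \<open>1 + e\<close> is kept for dominated convergence.\<close>

lemma trig_poly_approx: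
  assumes g: "continuous_on UNIV g" "\<And>x. \<bar>g x\<bar> \<le> 1" and K: "compact K" "K \<subseteq> box 0 1" and e: "e > 0"
  obtains t where "trig_poly t" "\<And>x. x \<in> K \<Longrightarrow> \<bar>t x - g x\<bar> < e" "\<And>x. x \<in> cbox 0 1 \<Longrightarrow> \<bar>t x\<bar> \<le> 1 + e"
proof -
  have "inj_on torus_map K" using inj_on_torus_map K(2) by (rule inj_on_subset)
  then obtain r where r: "homeomorphism K (torus_map ` K) torus_map r"
    using homeomorphism_compact[OF K(1) continuous_torus_map refl] by blast
  have rK: "r (torus_map x) = x" if "x \<in> K" for x
    using r that by (simp add: homeomorphism_def)
  have cont: "continuous_on (torus_map ` K) (\<lambda>y. g (r y))"
    using continuous_on_compose2[OF g(1)] r by (auto simp: homeomorphism_def)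
  have cl: "closedin (top_of_set UNIV) (torus_map ` K)"
    using compact_imp_closed[OF compact_continuous_image[OF continuous_torus_map K(1)]] by simp
  obtain h where h: "continuous_on UNIV h" "\<And>y. y \<in> torus_map ` K \<Longrightarrow> h y = g (r y)" "\<And>y. norm (h y) \<le> 1"
    using Tietze[OF cont cl, of 1] g(2) by (metis UNIV_I real_norm_def zero_le_one)
  have cS: "compact (torus_map ` cbox 0 1)"
    by (rule compact_continuous_image[OF continuous_torus_map compact_cbox])
  obtain p where p: "real_polynomial_function p" "\<And>y. y \<in> torus_map ` cbox 0 1 \<Longrightarrow> \<bar>h y - p y\<bar> < e"
    using Stone_Weierstrass_real_polynomial_function[OF cS continuous_on_subset[OF h(1) subset_UNIV] e] by blast
  show ?thesis
  proof (rule that[OF trig_poly_polynomial[OF p(1)]])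
    fix x assume "x \<in> K"
    then have "x \<in> cbox 0 1" using K(2) box_subset_cbox by blast
    then show "\<bar>p (torus_map x) - g x\<bar> < e"
      using p(2)[of "torus_map x"] h(2)[of "torus_map x"] rK[OF \<open>x \<in> K\<close>] \<open>x \<in> K\<close>
      by (simp add: abs_minus_commute)
  next
    fix x :: "real^2" assume "x \<in> cbox 0 1"
    then have "\<bar>h (torus_map x) - p (torus_map x)\<bar> < e" by (intro p(2)) auto
    moreover have "\<bar>h (torus_map x)\<bar> \<le> 1" using h(3) by simp
    ultimately show "\<bar>p (torus_map x)\<bar> \<le> 1 + e" by linarith
  qed
qed

text \<open>Trigonometric polynomials that converge boundedly and almost everywhere to
  \<open>sgn (f x)\<close> turn orthogonality into a vanishing integral of
  \<open>\<bar>f\<bar>\<close>.\<close>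

lemma AE_eq_0_if_orthogonal_trig_poly:
  assumes f: "integrable cell f" and ortho: "\<And>t. trig_poly t \<Longrightarrow> (\<integral>x. f x * t x \<partial>cell) = 0"
  shows "AE x in cell. f x = 0"
proof -
  have [measurable]: "f \<in> borel_measurable cell"
    using f by (rule borel_measurable_integrable)
  have "(\<lambda>x. sgn (f x)) \<in> borel_measurable cell"
    by measurable
  then have "(\<lambda>x. sgn (f x)) measurable_on cbox 0 1"
    by (simp add: measurable_on_iff_borel_measurable)
  then obtain N g where N: "negligible N" and g: "\<And>n. continuous_on UNIV (g n)"
    "\<And>x. x \<notin> N \<Longrightarrow> (\<lambda>n. g n x) \<longlonglongrightarrow> (if x \<in> cbox 0 1 then sgn (f x) else 0)"
    unfolding measurable_on_def by blast
  \<comment> \<open>Truncation to the interval from -1 to 1 keeps the limit \<open>sgn (f x)\<close>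
    and provides the uniform bound that \<open>trig_poly_approx\<close> asks for.\<close>
  define g' where "g' n x = max (-1) (min 1 (g n x))" for n :: nat and x
  have g'c: "continuous_on UNIV (g' n)" and g'b: "\<bar>g' n x\<bar> \<le> 1" for n x
    unfolding g'_def by (auto intro!: continuous_intros g)
  have g': "(\<lambda>n. g' n x) \<longlonglongrightarrow> sgn (f x)" if "x \<notin> N" "x \<in> cbox 0 1" for x
  proof -
    have "(\<lambda>n. g' n x) \<longlonglongrightarrow> max (-1) (min 1 (sgn (f x)))"
      unfolding g'_def using g(2)[OF that(1)] that(2) by (intro tendsto_intros) simp
    then show ?thesis by (simp add: sgn_if split: if_splits)
  qed
  \<comment> \<open>One sequence serves as the margin of \<open>K n\<close> inside the cell and as
    the approximation error. The sets \<open>K n\<close> exhaust the open box, and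
    \<open>c n \<le> 1\<close> gives the dominating factor 2.\<close>
  define c where "c n = 1 / real (n + 2)" for n
  define K where "K n = cbox (\<chi> i. c n) (\<chi> i. 1 - c n) \<inter> (cbox 0 1 :: (real^2) set)" for n
  have cpos: "c n > 0" for n by (simp add: c_def)
  have Ksub: "K n \<subseteq> box 0 1" for n
  proof
    fix x assume "x \<in> K n"
    then have "c n \<le> x $ i" "x $ i \<le> 1 - c n" for i by (auto simp: K_def mem_box_cart)
    then show "x \<in> box 0 1"
      unfolding mem_box_cart using cpos[of n] by (smt (verit) one_index zero_index)
  qed
  have "\<exists>t. trig_poly t \<and> (\<forall>x\<in>K n. \<bar>t x - g' n x\<bar> < c n) \<and> (\<forall>x\<in>cbox 0 1. \<bar>t x\<bar> \<le> 1 + c n)" for n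
    by (rule trig_poly_approx[OF g'c g'b _ Ksub cpos, of n n n]) (auto simp: K_def)
  then obtain t where t: "\<And>n. trig_poly (t n)" "\<And>n x. x \<in> K n \<Longrightarrow> \<bar>t n x - g' n x\<bar> < c n"
    "\<And>n x. x \<in> cbox 0 1 \<Longrightarrow> \<bar>t n x\<bar> \<le> 1 + c n"
    by metis
  have c0: "c \<longlonglongrightarrow> 0"
    unfolding c_def by (rule LIMSEQ_ignore_initial_segment[OF lim_1_over_n])
  have lim: "(\<lambda>n. t n x) \<longlonglongrightarrow> sgn (f x)" if "x \<notin> N" "x \<in> box 0 1" for x
  proof -
    have x: "0 < x $ i" "x $ i < 1" for i using that by (auto simp: mem_box_cart)
    define m where "m = min (min (x $ 1) (x $ 2)) (min (1 - x $ 1) (1 - x $ 2))"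
    have "m > 0" using x by (auto simp: m_def)
    then have "eventually (\<lambda>n. c n < m) sequentially"
      using c0 by (simp add: order_tendstoD)
    then have "eventually (\<lambda>n. x \<in> K n) sequentially"
    proof eventually_elim
      case (elim n)
      then show ?case
        unfolding K_def m_def using x by (auto simp: mem_box_cart forall_2 less_imp_le)
    qed
    then have "eventually (\<lambda>n. norm (t n x - g' n x) \<le> c n) sequentially"
      by eventually_elim (use t(2) in \<open>auto intro: less_imp_le\<close>)
    then have "(\<lambda>n. t n x - g' n x) \<longlonglongrightarrow> 0"
      by (rule Lim_null_comparison[OF _ c0])
    moreover have "x \<in> cbox 0 1" using that(2) box_subset_cbox by blast
    ultimately show ?thesis
      using tendsto_add[OF _ g'[OF that(1)]] by fastforce
  qed
  have "(\<lambda>n. \<integral>x. f x * t n x \<partial>cell) \<longlonglongrightarrow> (\<integral>x. f x * sgn (f x) \<partial>cell)"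
  proof (rule integral_dominated_convergence[where w = "\<lambda>x. 2 * norm (f x)"])
    show "integrable cell (\<lambda>x. 2 * norm (f x))" using f by simp
    have tm: "t n \<in> borel_measurable cell" for n
      using integrable_cell_continuous[OF trig_poly_continuous[OF t(1)]] by (rule borel_measurable_integrable)
    show "(\<lambda>x. f x * t n x) \<in> borel_measurable cell" for n
      using tm by measurable
    show "(\<lambda>x. f x * sgn (f x)) \<in> borel_measurable cell" by measurable
    have "AE x in lebesgue. x \<notin> N"
      using N by (intro AE_not_in) (simp add: negligible_iff_null_sets)
    then have "AE x in cell. x \<notin> N"
      by (auto simp: AE_restrict_space_iff elim!: eventually_mono)
    with null_cell_boundary show "AE x in cell. (\<lambda>n. f x * t n x) \<longlonglongrightarrow> f x * sgn (f x)"
      by eventually_elim (intro tendsto_intros lim)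
    have "c n \<le> 1" for n by (simp add: c_def)
    then have "\<bar>t n x\<bar> \<le> 2" if "x \<in> cbox 0 1" for n x
      using t(3)[OF that, of n] by (smt (verit))
    then have "norm (f x * t n x) \<le> 2 * norm (f x)" if "x \<in> cbox 0 1" for n x
      using mult_left_mono[of "\<bar>t n x\<bar>" 2 "\<bar>f x\<bar>"] that by (simp add: abs_mult mult.commute)
    then show "AE x in cell. norm (f x * t n x) \<le> 2 * norm (f x)" for n
      by (intro AE_I2) (simp add: space_restrict_space)
  qed
  then have "(\<integral>x. f x * sgn (f x) \<partial>cell) = 0"
    using ortho[OF t(1)] by (simp add: LIMSEQ_const_iff)
  then have "(\<integral>x. \<bar>f x\<bar> \<partial>cell) = 0"
    by (simp add: abs_sgn[symmetric])
  then have "AE x in cell. \<bar>f x\<bar> = 0"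
    using integral_nonneg_eq_0_iff_AE[of cell "\<lambda>x. \<bar>f x\<bar>"] f by simp
  then show ?thesis by simp
qed

section \<open>Waves as test functions\<close>

lemma has_derivative_wave:
  "(wave k l \<theta> has_derivative (\<lambda>v. v $ 1 * (2 * pi * of_int k * wave k l (\<theta> + pi / 2) x) +
      v $ 2 * (2 * pi * of_int l * wave k l (\<theta> + pi / 2) x))) (at x)"
proof -
  define C where "C = cos (2 * pi * (of_int k * x $ 1 + of_int l * x $ 2) + \<theta>)"
  have C: "wave k l (\<theta> + pi / 2) x = C"
    unfolding wave_def add.assoc[symmetric] C_def by (simp add: sin_add)
  have "((\<lambda>x. 2 * pi * (of_int k * x $ 1 + of_int l * x $ 2) + \<theta>) has_derivative
      (\<lambda>v. 2 * pi * (of_int k * v $ 1 + of_int l * v $ 2))) (at x)"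
    by (auto intro!: derivative_eq_intros bounded_linear_imp_has_derivative bounded_linear_vec_nth)
  from has_derivative_sin[OF this] have
    "(wave k l \<theta> has_derivative (\<lambda>v. (2 * pi * (of_int k * v $ 1 + of_int l * v $ 2)) * C)) (at x)"
    unfolding C_def wave_def[abs_def] .
  then show ?thesis
    unfolding C by (rule has_derivative_eq_rhs) (simp add: fun_eq_iff algebra_simps)
qed

text \<open>Each derivative multiplies by \<open>2 * pi\<close> times a frequency and advances the
  phase by \<open>pi / 2\<close>, so all mixed derivatives have the closed form
  \<open>?D\<close>.\<close>

lemma test_function_wave: "test_function (wave k l \<theta>)"
proof -
  let ?D = "\<lambda>m n x. (2 * pi * of_int k) ^ m * (2 * pi * of_int l) ^ n * wave k l (\<theta> + real (m + n) * (pi / 2)) x"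
  have e: "\<theta> + real (Suc m + n) * (pi / 2) = (\<theta> + real (m + n) * (pi / 2)) + pi / 2"
    "\<theta> + real (m + Suc n) * (pi / 2) = (\<theta> + real (m + n) * (pi / 2)) + pi / 2" for m n
    by (simp_all add: algebra_simps add_divide_distrib)
  have "(?D m n has_derivative (\<lambda>v. v $ 1 * ?D (Suc m) n x + v $ 2 * ?D m (Suc n) x)) (at x)" for m n x
    unfolding e
    by (rule has_derivative_eq_rhs[OF has_derivative_mult_right[OF has_derivative_wave]])
       (simp add: fun_eq_iff algebra_simps)
  then have "smooth (wave k l \<theta>)"
    unfolding smooth_def by (intro exI[of _ ?D]) simp
  moreover have "cell_periodic (wave k l \<theta>)"
    unfolding cell_periodic_def
  proof (intro allI)
    fix x :: "real^2" and i :: 2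
    obtain m :: int where m: "of_int k * (x + axis i 1) $ 1 + of_int l * (x + axis i 1) $ 2 =
        of_int k * x $ 1 + of_int l * x $ 2 + of_int m"
      using exhaust_2[of i]
    proof
      assume "i = 1" then show ?thesis by (intro that[of k]) (simp add: axis_def algebra_simps)
    next
      assume "i = 2" then show ?thesis by (intro that[of l]) (simp add: axis_def algebra_simps)
    qed
    have "2 * pi * (of_int k * x $ 1 + of_int l * x $ 2 + of_int m) + \<theta> =
        (2 * pi * (of_int k * x $ 1 + of_int l * x $ 2) + \<theta>) + 2 * pi * of_int m"
      by (simp add: algebra_simps)
    then show "wave k l \<theta> (x + axis i 1) = wave k l \<theta> x"
      unfolding wave_def m by (simp only: sin_add sin_int_2pin cos_int_2pin) simp
  qed
  ultimately show ?thesis by (simp add: test_function_def)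
qed

lemma grad_wave: "grad (wave k l \<theta>) x = (2 * pi * wave k l (\<theta> + pi / 2) x) *\<^sub>R vector [of_int k, of_int l]"
  by (rule grad_eqI) (use has_derivative_wave[of k l \<theta> x] in \<open>simp add: inner_vec2 algebra_simps\<close>)

subsection \<open>Hodge decomposition on the torus\<close>

lemma R_perp_mult: "R_perp *v x = vector [- x $ 2, x $ 1]"
  by (simp add: R_perp_def matrix_vector_mult_def vec_eq_iff forall_2 sum_2)

lemma R_perp_inner: "(R_perp *v x) \<bullet> y = - (x \<bullet> (R_perp *v y))"
  by (simp add: R_perp_mult inner_vec2)

lemma R_perp_inner_R_perp: "(R_perp *v x) \<bullet> (R_perp *v y) = x \<bullet> y"
  by (simp add: R_perp_mult inner_vec2)

lemma R_perp_R_perp: "R_perp *v (R_perp *v x) = - x"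
  by (simp add: R_perp_mult vec_eq_iff forall_2)

lemma integral_cell_nth:
  fixes f :: "real^2 \<Rightarrow> real^2"
  assumes "integrable cell f"
  shows "(\<integral>x. f x \<partial>cell) $ i = (\<integral>x. f x $ i \<partial>cell)"
  using integral_bounded_linear[OF bounded_linear_vec_nth assms] by simp

lemma integral_cell_matrix:
  fixes f :: "real^2 \<Rightarrow> real^2" and A :: "real^2^2"
  assumes "integrable cell f"
  shows "(\<integral>x. A *v f x \<partial>cell) = A *v (\<integral>x. f x \<partial>cell)"
  by (rule integral_bounded_linear[OF matrix_vector_mul_bounded_linear assms])

lemma integral_grad_test_function:
  assumes "test_function \<psi>"
  shows "(\<integral>x. grad \<psi> x \<partial>cell) = 0"
  using integral_gradient_periodic[OF has_derivative_grad] test_functionD[OF assms]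
  by (simp add: vec_eq_iff integral_cell_nth square_integrable_imp_integrable)

lemma orthogonal_trig_poly_if_wave:
  assumes f: "square_integrable f" and w: "\<And>k l \<theta>. (\<integral>x. f x * wave k l \<theta> x \<partial>cell) = 0" and t: "trig_poly t"
  shows "(\<integral>x. f x * t x \<partial>cell) = 0"
  using t
proof (induction rule: trig_poly.induct)
  case (wave c k l \<theta>)
  have "(\<integral>x. f x * (c * wave k l \<theta> x) \<partial>cell) = (\<integral>x. c * (f x * wave k l \<theta> x) \<partial>cell)"
    by (simp only: mult.left_commute)
  then show ?case using w by simp
next
  case (add s t)
  then have "integrable cell (\<lambda>x. f x * s x)" "integrable cell (\<lambda>x. f x * t x)"
    by (auto intro!: integrable_mult_cell f square_integrable_continuous trig_poly_continuous)
  then show ?case using add by (simp add: distrib_left)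
qed

text \<open>Testing against the gradients of a wave with frequency \<open>(k, l)\<close> and their rotations shows that
  the Fourier coefficient at \<open>(k, l)\<close> is orthogonal to both \<open>(k, l)\<close> and \<open>(- l, k)\<close>.\<close>

lemma curl_and_divergence_free_imp_zero:
  assumes D: "square_integrable D" and mean: "(\<integral>x. D x \<partial>cell) = 0"
    and div: "\<And>\<psi>. test_function \<psi> \<Longrightarrow> (\<integral>x. D x \<bullet> grad \<psi> x \<partial>cell) = 0"
    and curl: "\<And>\<psi>. test_function \<psi> \<Longrightarrow> (\<integral>x. D x \<bullet> (R_perp *v grad \<psi> x) \<partial>cell) = 0"
  shows "AE x in cell. D x = 0"
proof -
  have sD: "square_integrable (\<lambda>x. D x $ i)" for i using D by blast
  have w: "(\<integral>x. D x $ i * wave k l \<theta> x \<partial>cell) = 0" for i k l \<theta>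
  proof (cases "k = 0 \<and> l = 0")
    case True
    \<comment> \<open>Constant waves have zero gradient, so frequency zero is covered by the mean
      instead.\<close>
    have "(\<integral>x. D x $ i \<partial>cell) = 0"
      using mean integral_cell_nth[OF square_integrable_imp_integrable[OF D], of i] by simp
    then show ?thesis using True by (simp add: wave_def)
  next
    case False
    have int: "integrable cell (\<lambda>x. D x $ i * wave k l \<theta> x)" for i
      by (intro integrable_mult_cell sD square_integrable_continuous continuous_wave)
    define c where "c i = (\<integral>x. D x $ i * wave k l \<theta> x \<partial>cell)" for i
    \<comment> \<open>A gradient advances the phase by \<open>pi / 2\<close>; starting from
      \<open>\<theta> - pi / 2\<close> makes the tested wave carry the phase \<open>\<theta>\<close>
      itself.\<close>
    have "D x \<bullet> grad (wave k l (\<theta> - pi / 2)) x =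
        2 * pi * of_int k * (D x $ 1 * wave k l \<theta> x) + 2 * pi * of_int l * (D x $ 2 * wave k l \<theta> x)" for x
      by (simp add: grad_wave inner_vec2 algebra_simps)
    then have "2 * pi * of_int k * c 1 + 2 * pi * of_int l * c 2 = 0"
      using div[OF test_function_wave[of k l "\<theta> - pi / 2"]] int by (simp add: c_def)
    then have 1: "of_int k * c 1 + of_int l * c 2 = 0"
      using pi_gt_zero by (simp add: mult.assoc flip: distrib_left)
    have "D x \<bullet> (R_perp *v grad (wave k l (\<theta> - pi / 2)) x) =
        2 * pi * of_int k * (D x $ 2 * wave k l \<theta> x) - 2 * pi * of_int l * (D x $ 1 * wave k l \<theta> x)" for x
      by (simp add: grad_wave inner_vec2 R_perp_mult algebra_simps)
    then have "2 * pi * of_int k * c 2 - 2 * pi * of_int l * c 1 = 0"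
      using curl[OF test_function_wave[of k l "\<theta> - pi / 2"]] int by (simp add: c_def)
    then have 2: "of_int k * c 2 - of_int l * c 1 = 0"
      using pi_gt_zero by (simp add: mult.assoc flip: right_diff_distrib)
    have kl: "(of_int k)\<^sup>2 + (of_int l)\<^sup>2 \<noteq> (0::real)"
      using False by (simp add: sum_power2_eq_zero_iff)
    have "((of_int k)\<^sup>2 + (of_int l)\<^sup>2) * c 1 = of_int k * (of_int k * c 1 + of_int l * c 2) - of_int l * (of_int k * c 2 - of_int l * c 1)"
      by (simp add: algebra_simps power2_eq_square)
    then have "((of_int k)\<^sup>2 + (of_int l)\<^sup>2) * c 1 = 0" unfolding 1 2 by simp
    with kl have c1: "c 1 = 0" using mult_eq_0_iff by blast
    have "((of_int k)\<^sup>2 + (of_int l)\<^sup>2) * c 2 = of_int l * (of_int k * c 1 + of_int l * c 2) + of_int k * (of_int k * c 2 - of_int l * c 1)"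
      by (simp add: algebra_simps power2_eq_square)
    then have "((of_int k)\<^sup>2 + (of_int l)\<^sup>2) * c 2 = 0" unfolding 1 2 by simp
    with kl have c2: "c 2 = 0" using mult_eq_0_iff by blast
    show ?thesis using exhaust_2[of i] c1 c2 by (auto simp: c_def)
  qed
  have "AE x in cell. D x $ i = 0" for i
    by (rule AE_eq_0_if_orthogonal_trig_poly[OF square_integrable_imp_integrable[OF sD]])
       (rule orthogonal_trig_poly_if_wave[OF sD w])
  from this[of 1] this[of 2] show ?thesis
    by eventually_elim (simp add: vec_eq_iff forall_2)
qed

text \<open>Testing the weak gradient against the partial derivatives of \<open>\<psi>\<close> moves
  both terms onto \<open>\<phi>\<close>, where the mixed second derivatives of \<open>\<psi>\<close>
  cancel.\<close>

lemma weak_gradient_curl_free: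
  assumes "has_weak_gradient \<phi> G" "square_integrable G" "test_function \<psi>"
  shows "(\<integral>x. G x \<bullet> (R_perp *v grad \<psi> x) \<partial>cell) = 0"
proof -
  have sp: "square_integrable (\<lambda>x. grad \<psi> x $ i)" for i
    using test_functionD(6)[OF assms(3)] by blast
  have int: "integrable cell (\<lambda>x. G x $ i * grad \<psi> x $ j)" for i j
    by (intro integrable_mult_cell sp square_integrable_nth assms)
  have *: "(\<integral>x. G x $ i * grad \<psi> x $ j \<partial>cell) = - (\<integral>x. \<phi> x * grad (\<lambda>x. grad \<psi> x $ j) x $ i \<partial>cell)" for i j
    using assms(1) test_function_partial[OF assms(3), of j] by (simp add: has_weak_gradient_def)
  have "G x \<bullet> (R_perp *v grad \<psi> x) = G x $ 2 * grad \<psi> x $ 1 - G x $ 1 * grad \<psi> x $ 2" for x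
    by (simp add: R_perp_mult inner_vec2)
  then have "(\<integral>x. G x \<bullet> (R_perp *v grad \<psi> x) \<partial>cell) = (\<integral>x. G x $ 2 * grad \<psi> x $ 1 \<partial>cell) - (\<integral>x. G x $ 1 * grad \<psi> x $ 2 \<partial>cell)"
    using int by simp
  also have "\<dots> = 0"
    unfolding * using smooth_partial(2)[OF test_functionD(1)[OF assms(3)]] by simp
  finally show ?thesis .
qed

lemma H1_perD:
  assumes "H1_per \<phi> G"
  shows "has_weak_gradient \<phi> G" "square_integrable G" "integrable cell G" "(\<integral>x. G x \<partial>cell) = 0"
proof -
  show w: "has_weak_gradient \<phi> G" and s: "square_integrable G"
    using assms by (auto simp: H1_per_def)
  then show i: "integrable cell G" by (simp add: square_integrable_imp_integrable)
  \<comment> \<open>The constant \<open>1\<close> is a test function with zero gradient.\<close>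
  have "(\<integral>x. G x $ i \<partial>cell) = 0" for i
    using w[unfolded has_weak_gradient_def, rule_format, OF test_function_const(1)[of 1], of i]
    by (simp add: test_function_const(2))
  then show "(\<integral>x. G x \<partial>cell) = 0"
    by (simp add: vec_eq_iff integral_cell_nth[OF i])
qed

text \<open>\<open>K\<close> is projected onto the closure of the gradients of test functions. The
  remainder is orthogonal to gradients by construction, and it is mean-free and orthogonal to
  rotated gradients because both \<open>K\<close> and the projection are; hence it vanishes.\<close>

lemma hodge:
  assumes K: "square_integrable K" and mean: "(\<integral>x. K x \<partial>cell) = 0"
    and curl: "\<And>\<psi>. test_function \<psi> \<Longrightarrow> (\<integral>x. K x \<bullet> (R_perp *v grad \<psi> x) \<partial>cell) = 0"
  obtains t where "\<And>n. test_function (t n)" "L2_tendsto (\<lambda>n. grad (t n)) K"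
proof -
  define V where "V = grad ` {\<psi>. test_function \<psi>}"
  obtain p v where p: "square_integrable p" and v: "\<And>n. v n \<in> V" and lim: "L2_tendsto v p"
    and ortho: "\<And>w. w \<in> V \<Longrightarrow> (\<integral>x. (K x - p x) \<bullet> w x \<partial>cell) = 0"
  proof (rule L2_projection[where V = V and f = K])
    show "square_integrable w" if "w \<in> V" for w
      using that test_functionD(6) by (auto simp: V_def)
    show "(\<lambda>x. 0) \<in> V"
      unfolding V_def using test_function_const[of 0] by (force intro!: image_eqI)
    show "(\<lambda>x. v x + w x) \<in> V" if vw: "v \<in> V" "w \<in> V" for v w
    proof -
      obtain a b where "test_function a" "test_function b" "v = grad a" "w = grad b"
        using vw by (auto simp: V_def)
      then show ?thesis
        unfolding V_def using test_function_lincomb[of a b 1 1] by (intro image_eqI[of _ _ "\<lambda>x. 1 * a x + 1 * b x"]) auto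
    qed
    show "(\<lambda>x. c *\<^sub>R v x) \<in> V" if vw: "v \<in> V" for v c
    proof -
      obtain a where "test_function a" "v = grad a"
        using vw by (auto simp: V_def)
      then show ?thesis
        unfolding V_def using test_function_lincomb[of a a c 0] by (intro image_eqI[of _ _ "\<lambda>x. c * a x + 0 * a x"]) auto
    qed
  qed (use K in auto)
  have "\<exists>t. \<forall>n. test_function (t n) \<and> v n = grad (t n)"
    by (rule choice) (use v in \<open>auto simp: V_def\<close>)
  then obtain t where t: "\<And>n. test_function (t n)" "\<And>n. v n = grad (t n)" by blast
  have sv: "square_integrable (v n)" for n using test_functionD(6)[OF t(1)] t(2) by simp
  have sR: "square_integrable (\<lambda>x. R_perp *v grad \<psi> x)" if "test_function \<psi>" for \<psi>
    using test_functionD(6)[OF that] by blast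
  have "(\<integral>x. p x \<bullet> (R_perp *v grad \<psi> x) \<partial>cell) = 0" if psi: "test_function \<psi>" for \<psi>
    using L2_tendsto_inner[OF lim sv p sR[OF psi]]
      weak_gradient_curl_free[OF has_weak_gradient_grad test_functionD(6)] t psi
    by (simp add: LIMSEQ_const_iff)
  then have c0: "(\<integral>x. (K x - p x) \<bullet> (R_perp *v grad \<psi> x) \<partial>cell) = 0" if psi: "test_function \<psi>" for \<psi>
    using curl[OF psi] integrable_inner_cell[OF K sR[OF psi]] integrable_inner_cell[OF p sR[OF psi]] psi
    by (simp add: inner_diff_left)
  have "(\<integral>x. p x \<bullet> axis i 1 \<partial>cell) = 0" for i
  proof -
    have "(\<integral>x. v n x \<bullet> axis i 1 \<partial>cell) = 0" for n
      using integral_grad_test_function[OF t(1), of n]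
        integral_cell_nth[OF square_integrable_imp_integrable[OF test_functionD(6)[OF t(1)]], of n i]
      by (simp add: t(2) inner_axis)
    then show ?thesis
      using L2_tendsto_inner[OF lim sv p square_integrable_const[of "axis i 1"]]
      by (simp add: LIMSEQ_const_iff)
  qed
  then have "(\<integral>x. p x \<partial>cell) = 0"
    by (simp add: vec_eq_iff inner_axis integral_cell_nth[OF square_integrable_imp_integrable[OF p]])
  then have m0: "(\<integral>x. K x - p x \<partial>cell) = 0"
    using mean K p by (simp add: square_integrable_imp_integrable)
  have "AE x in cell. K x - p x = 0"
    by (rule curl_and_divergence_free_imp_zero[OF square_integrable_diff[OF K p] m0 _ c0])
      (use ortho in \<open>auto simp: V_def\<close>)
  then have "AE x in cell. (norm (v n x - p x))\<^sup>2 = (norm (v n x - K x))\<^sup>2" for n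
    by eventually_elim simp
  then have "(\<integral>x. (norm (v n x - p x))\<^sup>2 \<partial>cell) = (\<integral>x. (norm (v n x - K x))\<^sup>2 \<partial>cell)" for n
    using square_integrable_norm[OF square_integrable_diff[OF sv p], of n]
      square_integrable_norm[OF square_integrable_diff[OF sv K], of n]
    by (intro integral_cong_AE) auto
  then have "L2_tendsto (\<lambda>n. grad (t n)) K"
    using lim by (simp add: L2_tendsto_def t(2))
  then show ?thesis using that t by blast
qed

text \<open>Divergence-freeness is tested only on smooth gradients; \<open>hodge\<close> makes these
  dense among the gradients of \<open>H1_per\<close> functions, and the pairing is continuous in
  mean square.\<close>

lemma integral_divergence_free_gradient:
  assumes J: "divergence_free J" and G: "H1_per \<phi> G"
  shows "(\<integral>x. J x \<bullet> G x \<partial>cell) = 0"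
proof -
  obtain t where t: "\<And>n. test_function (t n)" "L2_tendsto (\<lambda>n. grad (t n)) G"
    using hodge[OF H1_perD(2)[OF G] H1_perD(4)[OF G]] weak_gradient_curl_free[OF H1_perD(1)[OF G] H1_perD(2)[OF G]]
    by blast
  have sJ: "square_integrable J" using J by (simp add: divergence_free_def)
  have "(\<integral>x. grad (t n) x \<bullet> J x \<partial>cell) = 0" for n
    using J t(1) by (simp add: divergence_free_def inner_commute)
  then have "(\<integral>x. G x \<bullet> J x \<partial>cell) = 0"
    using L2_tendsto_inner[OF t(2) test_functionD(6)[OF t(1)] H1_perD(2)[OF G] sJ]
    by (simp add: LIMSEQ_const_iff)
  then show ?thesis by (simp add: inner_commute)
qed

text \<open>Rotation exchanges the divergence test and the curl test, so the rotated fluctuation of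
  \<open>J\<close> is curl-free and mean-free, and \<open>hodge\<close> with the Poincare argument
  supplies a potential. This is the stream function on which duality rests.\<close>

lemma rotated_divergence_free_is_gradient:
  assumes J: "divergence_free J"
  obtains \<phi> where "H1_per \<phi> (\<lambda>x. R_perp *v (J x - (\<integral>x. J x \<partial>cell)))"
proof -
  define m where "m = (\<integral>x. J x \<partial>cell)"
  have sJ: "square_integrable J" using J by (simp add: divergence_free_def)
  let ?K = "\<lambda>x. R_perp *v (J x - m)"
  have sK: "square_integrable ?K"
    by (intro square_integrable_matrix square_integrable_diff sJ square_integrable_const)
  have "(\<integral>x. ?K x \<partial>cell) = R_perp *v (\<integral>x. J x - m \<partial>cell)"
    by (intro integral_cell_matrix square_integrable_imp_integrable) (use sJ in auto)
  also have "(\<integral>x. J x - m \<partial>cell) = 0"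
    using sJ by (simp add: square_integrable_imp_integrable m_def)
  finally have mean: "(\<integral>x. ?K x \<partial>cell) = 0" by simp
  have curl: "(\<integral>x. ?K x \<bullet> (R_perp *v grad \<psi> x) \<partial>cell) = 0" if psi: "test_function \<psi>" for \<psi>
  proof -
    have "(\<integral>x. m \<bullet> grad \<psi> x \<partial>cell) = m \<bullet> (\<integral>x. grad \<psi> x \<partial>cell)"
      using test_functionD(6)[OF psi] by (intro integral_inner_right) (simp add: square_integrable_imp_integrable)
    then show ?thesis
      unfolding R_perp_inner_R_perp using J psi
        integrable_inner_cell[OF sJ test_functionD(6)[OF psi]]
        integrable_inner_cell[OF square_integrable_const[of m] test_functionD(6)[OF psi]]
      by (simp add: inner_diff_left divergence_free_def integral_grad_test_function)
  qed
  obtain t where "\<And>n. test_function (t n)" "L2_tendsto (\<lambda>n. grad (t n)) ?K"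
    using hodge[OF sK mean curl] by blast
  then obtain \<phi> where "H1_per \<phi> ?K"
    using H1_per_L2_limit[OF _ sK] by blast
  then show ?thesis using that by (simp add: m_def)
qed

text \<open>\<open>R_perp\<close> is antisymmetric, so the divergence test of the rotated field is
  the curl test of the gradient; the constant \<open>e0\<close> pairs to zero with the mean-free
  rotated gradient of \<open>\<psi>\<close>.\<close>

lemma divergence_free_rotated_gradient:
  assumes G: "H1_per \<phi> G"
  shows "divergence_free (\<lambda>x. R_perp *v (e0 + G x))"
  unfolding divergence_free_def
proof (intro conjI allI impI)
  note sG = H1_perD(2)[OF G]
  show "square_integrable (\<lambda>x. R_perp *v (e0 + G x))"
    by (intro square_integrable_matrix square_integrable_add sG square_integrable_const)
  fix \<psi> assume psi: "test_function \<psi>"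
  have sR: "square_integrable (\<lambda>x. R_perp *v grad \<psi> x)"
    using test_functionD(6)[OF psi] by blast
  have "(\<integral>x. e0 \<bullet> (R_perp *v grad \<psi> x) \<partial>cell) = e0 \<bullet> (\<integral>x. R_perp *v grad \<psi> x \<partial>cell)"
    using sR by (intro integral_inner_right) (simp add: square_integrable_imp_integrable)
  also have "\<dots> = 0"
    using integral_cell_matrix[OF square_integrable_imp_integrable[OF test_functionD(6)[OF psi]]]
      integral_grad_test_function[OF psi] by simp
  finally show "(\<integral>x. (R_perp *v (e0 + G x)) \<bullet> grad \<psi> x \<partial>cell) = 0"
    unfolding R_perp_inner
    using weak_gradient_curl_free[OF H1_perD(1)[OF G] sG psi]
      integrable_inner_cell[OF sG sR] integrable_inner_cell[OF square_integrable_const[of e0] sR]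
    by (simp add: inner_add_left)
qed

section \<open>Linear combinations of potentials and of fluxes\<close>

lemma H1_per_lincomb:
  assumes "H1_per \<phi> G" "H1_per \<eta> H"
  shows "H1_per (\<lambda>x. a * \<phi> x + b * \<eta> x) (\<lambda>x. a *\<^sub>R G x + b *\<^sub>R H x)"
proof -
  have s: "square_integrable \<phi>" "square_integrable \<eta>" "square_integrable G" "square_integrable H"
    using assms by (auto simp: H1_per_def)
  have "has_weak_gradient (\<lambda>x. a * \<phi> x + b * \<eta> x) (\<lambda>x. a *\<^sub>R G x + b *\<^sub>R H x)"
    unfolding has_weak_gradient_def
  proof (intro allI impI)
    fix \<psi> i assume psi: "test_function \<psi>"
    have sp: "square_integrable (\<lambda>x. grad \<psi> x $ i)" "square_integrable \<psi>"
      using test_functionD(5,6)[OF psi] by auto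
    have i: "integrable cell (\<lambda>x. \<phi> x * grad \<psi> x $ i)" "integrable cell (\<lambda>x. \<eta> x * grad \<psi> x $ i)"
      "integrable cell (\<lambda>x. G x $ i * \<psi> x)" "integrable cell (\<lambda>x. H x $ i * \<psi> x)"
      by (intro integrable_mult_cell square_integrable_nth s sp)+
    have "(\<integral>x. (a * \<phi> x + b * \<eta> x) * grad \<psi> x $ i \<partial>cell) =
        a * (\<integral>x. \<phi> x * grad \<psi> x $ i \<partial>cell) + b * (\<integral>x. \<eta> x * grad \<psi> x $ i \<partial>cell)"
      using i by (simp add: distrib_right mult.assoc)
    also have "\<dots> = - (a * (\<integral>x. G x $ i * \<psi> x \<partial>cell) + b * (\<integral>x. H x $ i * \<psi> x \<partial>cell))"
      using assms psi by (simp add: H1_per_def has_weak_gradient_def)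
    also have "a * (\<integral>x. G x $ i * \<psi> x \<partial>cell) + b * (\<integral>x. H x $ i * \<psi> x \<partial>cell) =
        (\<integral>x. (a *\<^sub>R G x + b *\<^sub>R H x) $ i * \<psi> x \<partial>cell)"
      using i by (simp add: distrib_right mult.assoc)
    finally show "(\<integral>x. (a * \<phi> x + b * \<eta> x) * grad \<psi> x $ i \<partial>cell) =
        - (\<integral>x. (a *\<^sub>R G x + b *\<^sub>R H x) $ i * \<psi> x \<partial>cell)" .
  qed
  moreover have "square_integrable (\<lambda>x. a * \<phi> x + b * \<eta> x)"
    using square_integrable_add[OF square_integrable_scaleR[OF s(1), of a] square_integrable_scaleR[OF s(2), of b]] by simp
  moreover have "square_integrable (\<lambda>x. a *\<^sub>R G x + b *\<^sub>R H x)"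
    by (intro square_integrable_add square_integrable_scaleR s)
  ultimately show ?thesis
    using assms by (simp add: H1_per_def cell_periodic_def)
qed

lemma divergence_free_lincomb:
  assumes "divergence_free J" "divergence_free K"
  shows "divergence_free (\<lambda>x. a *\<^sub>R J x + b *\<^sub>R K x)"
  unfolding divergence_free_def
proof (intro conjI allI impI)
  have s: "square_integrable J" "square_integrable K"
    using assms by (auto simp: divergence_free_def)
  show "square_integrable (\<lambda>x. a *\<^sub>R J x + b *\<^sub>R K x)"
    by (intro square_integrable_add square_integrable_scaleR s)
  fix \<psi> assume psi: "test_function \<psi>"
  show "(\<integral>x. (a *\<^sub>R J x + b *\<^sub>R K x) \<bullet> grad \<psi> x \<partial>cell) = 0"
    using assms psi integrable_inner_cell[OF s(1) test_functionD(6)[OF psi]]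
      integrable_inner_cell[OF s(2) test_functionD(6)[OF psi]]
    by (simp add: inner_add_left divergence_free_def)
qed

lemma matrix_eq_if_mult_eq:
  fixes A B :: "real^2^2"
  assumes "\<And>x. A *v x = B *v x"
  shows "A = B"
  using assms by (simp add: matrix_eq)

subsection \<open>Effective conductivity of isotropic media\<close>

text \<open>The bounds hold at every point of the plane, so square roots and reciprocals of
  \<open>a\<close> involve no exceptional null set.\<close>

locale conductivity =
  fixes a :: "real^2 \<Rightarrow> real" and lo hi :: real
  assumes measurable_weight [measurable]: "a \<in> borel_measurable cell"
    and lo_pos: "0 < lo" and lo_le: "\<And>x. lo \<le> a x" and le_hi: "\<And>x. a x \<le> hi"
begin

text \<open>Scalar counterpart of \<open>conduction_field\<close>;
  \<open>effective_conductivity_eq\<close> links the two for matrices acting as multiplication by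
  \<open>a\<close>.\<close>

definition field :: "real^2 \<Rightarrow> (real^2 \<Rightarrow> real^2) \<Rightarrow> bool" where
  "field e0 e \<longleftrightarrow> (\<exists>\<phi> G. H1_per \<phi> G \<and> (\<forall>x. e x = e0 + G x)) \<and> divergence_free (\<lambda>x. a x *\<^sub>R e x)"

lemma weight_pos: "0 < a x"
  using lo_pos lo_le by (rule less_le_trans)

lemma square_integrable_flux: "square_integrable e \<Longrightarrow> square_integrable (\<lambda>x. a x *\<^sub>R e x)"
  using le_hi weight_pos by (intro square_integrable_weight[where B = hi]) (auto simp: abs_of_pos)

lemma fieldE:
  assumes "field e0 e"
  obtains \<phi> G where "H1_per \<phi> G" "e = (\<lambda>x. e0 + G x)"
  using assms unfolding field_def fun_eq_iff[symmetric] by blast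

lemma field_divergence_free: "field e0 e \<Longrightarrow> divergence_free (\<lambda>x. a x *\<^sub>R e x)"
  by (simp add: field_def)

lemma field_square_integrable:
  assumes "field e0 e"
  shows "square_integrable e"
proof -
  obtain \<phi> G where G: "H1_per \<phi> G" "e = (\<lambda>x. e0 + G x)" using assms by (rule fieldE)
  show ?thesis
    unfolding G(2) by (intro square_integrable_add square_integrable_const H1_perD(2)[OF G(1)])
qed

lemma field_mean:
  assumes "field e0 e"
  shows "(\<integral>x. e x \<partial>cell) = e0"
proof -
  obtain \<phi> G where G: "H1_per \<phi> G" "e = (\<lambda>x. e0 + G x)" using assms by (rule fieldE)
  show ?thesis unfolding G(2) using H1_perD(3,4)[OF G(1)] by simp
qed

lemma field_lincomb:
  assumes "field e0 e" "field f0 f"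
  shows "field (c *\<^sub>R e0 + d *\<^sub>R f0) (\<lambda>x. c *\<^sub>R e x + d *\<^sub>R f x)"
proof -
  obtain \<phi> G where G: "H1_per \<phi> G" "e = (\<lambda>x. e0 + G x)"
    using assms(1) by (rule fieldE)
  obtain \<eta> H where H: "H1_per \<eta> H" "f = (\<lambda>x. f0 + H x)"
    using assms(2) by (rule fieldE)
  have "divergence_free (\<lambda>x. a x *\<^sub>R (c *\<^sub>R e x + d *\<^sub>R f x))"
    using divergence_free_lincomb[OF assms[THEN field_divergence_free], of c d] by (simp add: scaleR_add_right mult.commute)
  moreover have "c *\<^sub>R e x + d *\<^sub>R f x = (c *\<^sub>R e0 + d *\<^sub>R f0) + (c *\<^sub>R G x + d *\<^sub>R H x)" for x
    unfolding G(2) H(2) by (simp add: scaleR_add_right)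
  ultimately show ?thesis
    unfolding field_def using H1_per_lincomb[OF G(1) H(1)] by blast
qed

text \<open>The energy \<open>\<integral> a \<bar>e\<^sub>0 + \<nabla>\<psi>\<bar>\<^sup>2\<close> is minimised over the closure of the gradients of test functions,
  as a projection in the unweighted space after multiplication by \<open>\<surd>a\<close>.\<close>

lemma field_exists: obtains e where "field e0 e"
proof -
  define s where "s x = sqrt (a x)" for x
  have [measurable]: "s \<in> borel_measurable cell"
    unfolding s_def by measurable
  have s_pos: "s x > 0" and s2: "s x * s x = a x" for x
    using weight_pos[of x] by (auto simp: s_def)
  have s_hi: "\<bar>s x\<bar> \<le> sqrt hi" for x
    using s_pos[of x] le_hi[of x] by (simp add: s_def abs_of_nonneg weight_pos less_imp_le)
  have s_lo: "\<bar>1 / s x\<bar> \<le> 1 / sqrt lo" for x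
    using s_pos[of x] lo_le[of x] lo_pos by (simp add: s_def frac_le)
  have sW: "square_integrable (\<lambda>x. s x *\<^sub>R w x)" if "square_integrable w" for w :: "real^2 \<Rightarrow> real^2"
    using that s_hi by (intro square_integrable_weight[where B = "sqrt hi"]) auto
  have sI: "square_integrable (\<lambda>x. (1 / s x) *\<^sub>R w x)" if "square_integrable w" for w :: "real^2 \<Rightarrow> real^2"
    using that s_lo by (intro square_integrable_weight[where B = "1 / sqrt lo"]) auto
  define V where "V = (\<lambda>\<psi> x. s x *\<^sub>R grad \<psi> x) ` {\<psi>. test_function \<psi>}"
  \<comment> \<open>Projecting \<open>- s e0\<close> onto the fields \<open>s grad \<psi>\<close>
    makes \<open>s (e0 + G)\<close> orthogonal to all of them, which is the weak equation for the
    coefficient \<open>s\<^sup>2 = a\<close>.\<close>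
  define f where "f x = - (s x *\<^sub>R e0)" for x
  have sf: "square_integrable f"
    unfolding f_def by (intro square_integrable_uminus sW square_integrable_const)
  obtain p v where p: "square_integrable p" and v: "\<And>n. v n \<in> V" and lim: "L2_tendsto v p"
    and ortho: "\<And>w. w \<in> V \<Longrightarrow> (\<integral>x. (f x - p x) \<bullet> w x \<partial>cell) = 0"
  proof (rule L2_projection[where V = V and f = f])
    show "square_integrable w" if "w \<in> V" for w
      using that test_functionD(6) sW by (auto simp: V_def)
    show "(\<lambda>x. 0) \<in> V"
      unfolding V_def using test_function_const[of 0] by (force intro!: image_eqI)
    show "(\<lambda>x. v x + w x) \<in> V" if vw: "v \<in> V" "w \<in> V" for v w
    proof -
      obtain b c where "test_function b" "test_function c" "v = (\<lambda>x. s x *\<^sub>R grad b x)" "w = (\<lambda>x. s x *\<^sub>R grad c x)"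
        using vw by (auto simp: V_def)
      then show ?thesis
        unfolding V_def using test_function_lincomb[of b c 1 1]
        by (intro image_eqI[of _ _ "\<lambda>x. 1 * b x + 1 * c x"]) (auto simp: scaleR_add_right)
    qed
    show "(\<lambda>x. c *\<^sub>R v x) \<in> V" if vw: "v \<in> V" for v c
    proof -
      obtain b where "test_function b" "v = (\<lambda>x. s x *\<^sub>R grad b x)"
        using vw by (auto simp: V_def)
      then show ?thesis
        unfolding V_def using test_function_lincomb[of b b c 0]
        by (intro image_eqI[of _ _ "\<lambda>x. c * b x + 0 * b x"]) (auto simp: mult.commute)
    qed
  qed (use sf in auto)
  have "\<exists>t. \<forall>n. test_function (t n) \<and> v n = (\<lambda>x. s x *\<^sub>R grad (t n) x)"
    by (rule choice) (use v in \<open>auto simp: V_def\<close>)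
  then obtain t where t: "\<And>n. test_function (t n)" "\<And>n. v n = (\<lambda>x. s x *\<^sub>R grad (t n) x)" by blast
  define G where "G x = (1 / s x) *\<^sub>R p x" for x
  have sG: "square_integrable G" unfolding G_def by (rule sI[OF p])
  have pG: "p x = s x *\<^sub>R G x" for x using s_pos[of x] by (simp add: G_def)
  have sv: "square_integrable (v n)" for n unfolding t(2) by (intro sW test_functionD(6) t(1))
  \<comment> \<open>The lower bound \<open>lo\<close> controls the unweighted norm by the weighted
    one, so the gradients themselves converge and their limit is again a gradient.\<close>
  have "L2_tendsto (\<lambda>n. grad (t n)) G"
    unfolding L2_tendsto_def
  proof (rule Lim_null_comparison)
    show "(\<lambda>n. 1 / lo * (\<integral>x. (norm (v n x - p x))\<^sup>2 \<partial>cell)) \<longlonglongrightarrow> 0"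
      using tendsto_mult_right_zero[OF lim[unfolded L2_tendsto_def], of "1 / lo"] by simp
    have "norm (\<integral>x. (norm (grad (t n) x - G x))\<^sup>2 \<partial>cell) \<le> 1 / lo * (\<integral>x. (norm (v n x - p x))\<^sup>2 \<partial>cell)" for n
    proof -
      have "(norm (grad (t n) x - G x))\<^sup>2 \<le> 1 / lo * (norm (v n x - p x))\<^sup>2" for x
      proof -
        have "v n x - p x = s x *\<^sub>R (grad (t n) x - G x)"
          by (simp add: t(2) pG scaleR_diff_right)
        then have "(norm (v n x - p x))\<^sup>2 = a x * (norm (grad (t n) x - G x))\<^sup>2"
          using s2[of x] by (simp add: power_mult_distrib power2_eq_square[of "s x"])
        moreover have "lo * (norm (grad (t n) x - G x))\<^sup>2 \<le> a x * (norm (grad (t n) x - G x))\<^sup>2"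
          by (intro mult_right_mono lo_le) simp
        ultimately show ?thesis using lo_pos by (simp add: field_simps)
      qed
      then have "(\<integral>x. (norm (grad (t n) x - G x))\<^sup>2 \<partial>cell) \<le> (\<integral>x. 1 / lo * (norm (v n x - p x))\<^sup>2 \<partial>cell)"
        using square_integrable_norm[OF square_integrable_diff[OF sv p], of n]
          square_integrable_norm[OF square_integrable_diff[OF test_functionD(6)[OF t(1)] sG], of n]
        by (intro Bochner_Integration.integral_mono) auto
      moreover have "0 \<le> (\<integral>x. (norm (grad (t n) x - G x))\<^sup>2 \<partial>cell)"
        by (rule Bochner_Integration.integral_nonneg) simp
      ultimately show ?thesis by simp
    qed
    then show "\<forall>\<^sub>F n in sequentially. norm (\<integral>x. (norm (grad (t n) x - G x))\<^sup>2 \<partial>cell)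
        \<le> 1 / lo * (\<integral>x. (norm (v n x - p x))\<^sup>2 \<partial>cell)" by simp
  qed
  then obtain \<phi> where G: "H1_per \<phi> G"
    using H1_per_L2_limit[of t, OF t(1) sG] by blast
  have "divergence_free (\<lambda>x. a x *\<^sub>R (e0 + G x))"
    unfolding divergence_free_def
  proof (intro conjI allI impI)
    show "square_integrable (\<lambda>x. a x *\<^sub>R (e0 + G x))"
      by (intro square_integrable_flux square_integrable_add square_integrable_const sG)
    fix \<psi> assume psi: "test_function \<psi>"
    have "(f x - p x) \<bullet> (s x *\<^sub>R grad \<psi> x) = - ((a x *\<^sub>R (e0 + G x)) \<bullet> grad \<psi> x)" for x
      unfolding f_def pG s2[symmetric] by (simp add: inner_add_left inner_diff_left algebra_simps)
    then show "(\<integral>x. (a x *\<^sub>R (e0 + G x)) \<bullet> grad \<psi> x \<partial>cell) = 0"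
      using ortho[of "\<lambda>x. s x *\<^sub>R grad \<psi> x"] psi by (simp add: V_def)
  qed
  then have "field e0 (\<lambda>x. e0 + G x)"
    unfolding field_def using G by blast
  then show ?thesis by (rule that)
qed

text \<open>Known as Hill's lemma: the fluctuation of \<open>e\<close> is a gradient and pairs to
  zero with \<open>J\<close>, so only the mean field remains. Uniqueness, symmetry and positivity
  all follow from it.\<close>

lemma integral_flux_field:
  assumes J: "divergence_free J" and e: "field e0 e"
  shows "(\<integral>x. J x \<bullet> e x \<partial>cell) = (\<integral>x. J x \<partial>cell) \<bullet> e0"
proof -
  obtain \<phi> G where G: "H1_per \<phi> G" "e = (\<lambda>x. e0 + G x)" using e by (rule fieldE)
  have sJ: "square_integrable J" using J by (simp add: divergence_free_def)
  have "(\<integral>x. J x \<bullet> e x \<partial>cell) = (\<integral>x. J x \<bullet> e0 \<partial>cell) + (\<integral>x. J x \<bullet> G x \<partial>cell)"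
    unfolding G(2) using integrable_inner_cell[OF sJ square_integrable_const[of e0]]
      integrable_inner_cell[OF sJ H1_perD(2)[OF G(1)]] by (simp add: inner_add_right)
  also have "\<dots> = (\<integral>x. J x \<partial>cell) \<bullet> e0"
    using integral_divergence_free_gradient[OF J G(1)] square_integrable_imp_integrable[OF sJ] by simp
  finally show ?thesis .
qed

text \<open>By Hill's lemma the second hypothesis says that the energy of \<open>e\<close> vanishes.
  With \<open>e0 = 0\<close> this yields uniqueness; in general it makes the effective matrix
  strictly positive.\<close>

lemma field_zero_AE:
  assumes "field e0 e" "e0 \<bullet> (\<integral>x. a x *\<^sub>R e x \<partial>cell) = 0"
  shows "AE x in cell. e x = 0"
proof -
  have df: "divergence_free (\<lambda>x. a x *\<^sub>R e x)" using assms(1) by (rule field_divergence_free)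
  have se: "square_integrable e" by (rule field_square_integrable[OF assms(1)])
  have "(\<integral>x. (a x *\<^sub>R e x) \<bullet> e x \<partial>cell) = 0"
    using integral_flux_field[OF df assms(1)] assms(2) by (simp add: inner_commute)
  moreover have "0 \<le> (a x *\<^sub>R e x) \<bullet> e x" for x
    using weight_pos[of x] by simp
  ultimately have "AE x in cell. (a x *\<^sub>R e x) \<bullet> e x = 0"
    using integral_nonneg_eq_0_iff_AE[OF integrable_inner_cell[OF square_integrable_flux[OF se] se]] by simp
  then show ?thesis
    by eventually_elim (use weight_pos in \<open>simp add: less_imp_neq[symmetric]\<close>)
qed

lemma field_unique_flux:
  assumes "field e0 e" "field e0 e'"
  shows "(\<integral>x. a x *\<^sub>R e x \<partial>cell) = (\<integral>x. a x *\<^sub>R e' x \<partial>cell)"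
proof -
  have d: "field 0 (\<lambda>x. e x - e' x)"
    using field_lincomb[OF assms, of 1 "-1"] by simp
  have "AE x in cell. e x - e' x = 0"
    by (rule field_zero_AE[OF d]) simp
  then have "AE x in cell. a x *\<^sub>R e x = a x *\<^sub>R e' x"
    by eventually_elim simp
  then show ?thesis
    using square_integrable_measurable[OF square_integrable_flux[OF field_square_integrable]] assms
    by (intro integral_cong_AE) auto
qed

lemma effective_matrix_exists:
  "\<exists>S. \<forall>e0 e. field e0 e \<longrightarrow> (\<integral>x. a x *\<^sub>R e x \<partial>cell) = S *v e0"
proof -
  \<comment> \<open>The choice of field is immaterial by \<open>field_unique_flux\<close>, so
    linearity of \<open>F\<close> follows by superposing any two fields.\<close>
  define F where "F e0 = (\<integral>x. a x *\<^sub>R (SOME e. field e0 e) x \<partial>cell)" for e0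
  have F: "(\<integral>x. a x *\<^sub>R e x \<partial>cell) = F e0" if "field e0 e" for e0 e
    unfolding F_def by (rule field_unique_flux[OF that]) (rule someI[of "field e0", OF that])
  have comb: "F (c *\<^sub>R e0 + d *\<^sub>R f0) = c *\<^sub>R F e0 + d *\<^sub>R F f0" for c d e0 f0
  proof -
    obtain e f where ef: "field e0 e" "field f0 f" using field_exists by meson
    have i: "integrable cell (\<lambda>x. a x *\<^sub>R e x)" "integrable cell (\<lambda>x. a x *\<^sub>R f x)"
      using ef[THEN field_square_integrable]
      by (auto intro!: square_integrable_imp_integrable square_integrable_flux)
    have "F (c *\<^sub>R e0 + d *\<^sub>R f0) = (\<integral>x. a x *\<^sub>R (c *\<^sub>R e x + d *\<^sub>R f x) \<partial>cell)"
      by (rule F[OF field_lincomb[OF ef], symmetric])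
    also have "\<dots> = (\<integral>x. c *\<^sub>R (a x *\<^sub>R e x) + d *\<^sub>R (a x *\<^sub>R f x) \<partial>cell)"
      by (simp add: scaleR_add_right mult.commute)
    also have "\<dots> = (\<integral>x. c *\<^sub>R (a x *\<^sub>R e x) \<partial>cell) + (\<integral>x. d *\<^sub>R (a x *\<^sub>R f x) \<partial>cell)"
      by (intro Bochner_Integration.integral_add integrable_scaleR_right i)
    also have "\<dots> = c *\<^sub>R F e0 + d *\<^sub>R F f0"
      by (simp only: integral_scaleR_right F[OF ef(1)] F[OF ef(2)])
    finally show ?thesis .
  qed
  have "linear F"
    using comb[of 1 _ 1] comb[of _ _ 0] by (intro linearI) simp_all
  then have "matrix F *v e0 = F e0" for e0
    by (simp add: matrix_works)
  then show ?thesis using F by (intro exI[of _ "matrix F"]) simp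
qed

definition effective :: "real^2^2" where
  "effective = (SOME S. \<forall>e0 e. field e0 e \<longrightarrow> (\<integral>x. a x *\<^sub>R e x \<partial>cell) = S *v e0)"

lemma effective:
  assumes "field e0 e"
  shows "(\<integral>x. a x *\<^sub>R e x \<partial>cell) = effective *v e0"
  using someI_ex[OF effective_matrix_exists] assms unfolding effective_def by simp

lemma effective_conductivity_eq:
  assumes "\<And>x v. \<sigma> x *v v = a x *\<^sub>R v"
  shows "effective_conductivity \<sigma> = effective"
  unfolding effective_conductivity_def
proof (rule the_equality)
  have cf: "conduction_field \<sigma> e0 e \<longleftrightarrow> field e0 e" for e0 e
    unfolding conduction_field_def field_def assms ..
  show "\<forall>e0. \<exists>e. conduction_field \<sigma> e0 e \<and> effective *v e0 = (\<integral>x. \<sigma> x *v e x \<partial>cell)"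
    unfolding cf assms using field_exists effective by metis
  fix S assume S: "\<forall>e0. \<exists>e. conduction_field \<sigma> e0 e \<and> S *v e0 = (\<integral>x. \<sigma> x *v e x \<partial>cell)"
  show "S = effective"
  proof (rule matrix_eq_if_mult_eq)
    fix e0
    obtain e where e: "field e0 e" "S *v e0 = (\<integral>x. a x *\<^sub>R e x \<partial>cell)"
      using S unfolding cf assms by blast
    then show "S *v e0 = effective *v e0" using effective by simp
  qed
qed

text \<open>Both sides equal the integral of \<open>a e \<bullet> f\<close>: each flux is paired
  with the other field.\<close>

lemma effective_symmetric: "(effective *v e0) \<bullet> f0 = (effective *v f0) \<bullet> e0"
proof -
  obtain e f where e: "field e0 e" and f: "field f0 f" using field_exists by meson
  have "divergence_free (\<lambda>x. a x *\<^sub>R e x)" "divergence_free (\<lambda>x. a x *\<^sub>R f x)"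
    using e f by (auto intro: field_divergence_free)
  from integral_flux_field[OF this(1) f] integral_flux_field[OF this(2) e] show ?thesis
    unfolding effective[OF e] effective[OF f] by (simp add: inner_commute)
qed

lemma effective_positive:
  assumes "e0 \<noteq> 0"
  shows "0 < e0 \<bullet> (effective *v e0)"
proof -
  obtain e where e: "field e0 e" by (rule field_exists)
  have df: "divergence_free (\<lambda>x. a x *\<^sub>R e x)" using e by (rule field_divergence_free)
  have "0 \<le> (\<integral>x. (a x *\<^sub>R e x) \<bullet> e x \<partial>cell)"
    by (intro Bochner_Integration.integral_nonneg) (simp add: weight_pos less_imp_le)
  then have "0 \<le> e0 \<bullet> (effective *v e0)"
    unfolding integral_flux_field[OF df e] effective[OF e] by (simp add: inner_commute)
  moreover have "e0 \<bullet> (effective *v e0) \<noteq> 0"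
  proof
    assume "e0 \<bullet> (effective *v e0) = 0"
    then have "AE x in cell. e x = 0"
      using field_zero_AE[OF e] effective[OF e] by simp
    then have "(\<integral>x. e x \<partial>cell) = 0"
      using integral_cong_AE[of e cell "\<lambda>x. 0"] square_integrable_measurable[OF field_square_integrable[OF e]] by simp
    then show False using field_mean[OF e] assms by simp
  qed
  ultimately show ?thesis by simp
qed

lemma effective_entries:
  "effective $ 1 $ 2 = effective $ 2 $ 1" "0 < det effective"
proof -
  have mv: "effective *v x = vector [effective $ 1 $ 1 * x $ 1 + effective $ 1 $ 2 * x $ 2,
      effective $ 2 $ 1 * x $ 1 + effective $ 2 $ 2 * x $ 2]" for x
    by (simp add: matrix_vector_mult_def vec_eq_iff forall_2 sum_2)
  show sym: "effective $ 1 $ 2 = effective $ 2 $ 1"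
    using effective_symmetric[of "axis 1 1" "axis 2 1"] by (simp add: mv inner_vec2 axis_def)
  have p: "0 < effective $ 1 $ 1"
    using effective_positive[of "axis 1 1"] by (simp add: mv inner_vec2 axis_def vec_eq_iff)
  \<comment> \<open>Orthogonal to the first row: \<open>effective\<close> maps it to
    \<open>det effective\<close> times the second axis vector, so positivity of the form decides the
    sign of the determinant.\<close>
  let ?w = "vector [- effective $ 1 $ 2, effective $ 1 $ 1] :: real^2"
  have "0 < ?w \<bullet> (effective *v ?w)"
    by (rule effective_positive) (use p in \<open>auto simp: vec_eq_iff forall_2\<close>)
  also have "?w \<bullet> (effective *v ?w) = effective $ 1 $ 1 * det effective"
    by (simp add: mv inner_vec2 det_2 sym algebra_simps)
  finally show "0 < det effective"
    using p by (simp add: zero_less_mult_iff)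
qed

end

text \<open>Keller's duality: in two dimensions the rotated flux of a field for \<open>a\<close> is a field for \<open>1/a\<close>.\<close>

lemma effective_dual:
  assumes "conductivity a lo hi" "conductivity b lo' hi'" and ab: "\<And>x. a x * b x = 1"
  shows "conductivity.effective b = (1 / det (conductivity.effective a)) *\<^sub>R conductivity.effective a"
proof -
  interpret a: conductivity a lo hi by fact
  interpret b: conductivity b lo' hi' by fact
  let ?S = "a.effective"
  \<comment> \<open>The rotated flux has mean \<open>R_perp *v (?S *v e0)\<close>, and its own flux
    under \<open>b\<close> is the rotated original field, whose mean is
    \<open>R_perp *v e0\<close>.\<close>
  have key: "b.effective *v (R_perp *v (?S *v e0)) = R_perp *v e0" for e0
  proof -
    obtain e where e: "a.field e0 e" by (rule a.field_exists)
    obtain \<phi> G where G: "H1_per \<phi> G" "e = (\<lambda>x. e0 + G x)"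
      using e by (rule a.fieldE)
    have df: "divergence_free (\<lambda>x. a x *\<^sub>R e x)"
      using e by (rule a.field_divergence_free)
    obtain \<eta> where eta: "H1_per \<eta> (\<lambda>x. R_perp *v (a x *\<^sub>R e x - (\<integral>x. a x *\<^sub>R e x \<partial>cell)))"
      by (rule rotated_divergence_free_is_gradient[OF df])
    define e' where "e' x = R_perp *v (a x *\<^sub>R e x)" for x
    have e'_eq: "e' x = R_perp *v (?S *v e0) + R_perp *v (a x *\<^sub>R e x - (\<integral>x. a x *\<^sub>R e x \<partial>cell))" for x
      unfolding a.effective[OF e] e'_def by (simp add: matrix_vector_mult_diff_distrib)
    have flux: "b x *\<^sub>R e' x = R_perp *v e x" for x
      unfolding e'_def by (simp add: matrix_vector_mult_scaleR ab mult.commute[of "b x"])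
    have "b.field (R_perp *v (?S *v e0)) e'"
      unfolding b.field_def flux using eta e'_eq divergence_free_rotated_gradient[OF G(1), of e0]
      by (auto simp: G(2))
    from b.effective[OF this] show ?thesis
      unfolding flux
      using integral_cell_matrix[OF square_integrable_imp_integrable[OF a.field_square_integrable[OF e]]]
        a.field_mean[OF e] by simp
  qed
  have mv: "?S *v x = vector [?S $ 1 $ 1 * x $ 1 + ?S $ 1 $ 2 * x $ 2, ?S $ 2 $ 1 * x $ 1 + ?S $ 2 $ 2 * x $ 2]" for x
    by (simp add: matrix_vector_mult_def vec_eq_iff forall_2 sum_2)
  note sym = a.effective_entries(1) and pos = a.effective_entries(2)
  show ?thesis
  proof (rule matrix_eq_if_mult_eq)
    fix w :: "real^2"
    \<comment> \<open>Chosen so that the rotated mean flux is \<open>w\<close>; this rests on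
      \<open>S R S = det S * R\<close> for symmetric \<open>S\<close> and the rotation
      \<open>R\<close>.\<close>
    define e0 where "e0 = (- 1 / det ?S) *\<^sub>R (R_perp *v (?S *v w))"
    have nz: "det ?S \<noteq> 0" using pos by simp
    have "?S *v (R_perp *v (?S *v w)) = det ?S *\<^sub>R (R_perp *v w)"
      by (simp add: mv R_perp_mult vec_eq_iff forall_2 det_2 sym algebra_simps)
    then have "?S *v e0 = (- 1 / det ?S) *\<^sub>R (det ?S *\<^sub>R (R_perp *v w))"
      by (simp only: e0_def matrix_vector_mult_scaleR)
    then have "?S *v e0 = - (R_perp *v w)"
      using nz by simp
    then have "R_perp *v (?S *v e0) = w"
      by (simp add: R_perp_mult vec_eq_iff forall_2)
    moreover have "R_perp *v e0 = ((1 / det ?S) *\<^sub>R ?S) *v w"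
      by (simp only: e0_def matrix_vector_mult_scaleR R_perp_R_perp scaleR_matrix_vector_assoc[symmetric]) simp
    ultimately show "b.effective *v w = ((1 / det ?S) *\<^sub>R ?S) *v w"
      using key[of e0] by simp
  qed
qed

subsection \<open>The coupled problem\<close>

definition comb :: "real^2 \<Rightarrow> field_pair \<Rightarrow> real^2" where
  "comb u E = u $ 1 *\<^sub>R E $ 1 + u $ 2 *\<^sub>R E $ 2"

lemma apply_kron: "((A \<otimes> B) \<star> E) $ i = A $ i $ 1 *\<^sub>R (B *v E $ 1) + A $ i $ 2 *\<^sub>R (B *v E $ 2)"
  by (simp add: apply_block_def kron_def sum_2 scaleR_matrix_vector_assoc)

lemma apply_T_op: "(T_op \<star> E) $ 1 = - (R_perp *v E $ 2)" "(T_op \<star> E) $ 2 = R_perp *v E $ 1"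
  unfolding T_op_def apply_kron by (simp_all add: R_perp_def)

lemma apply_block_add: "((L + M) \<star> E) = L \<star> E + M \<star> E"
  by (simp add: apply_block_def vec_eq_iff sum_2 matrix_vector_mult_def algebra_simps)

lemma apply_block_scaleR: "((r *\<^sub>R L) \<star> E) = r *\<^sub>R (L \<star> E)"
  by (simp add: apply_block_def vec_eq_iff sum_2 matrix_vector_mult_def algebra_simps)

lemma block_op_eqI:
  assumes "\<And>E. L \<star> E = M \<star> E"
  shows "L = M"
proof -
  have "L $ i $ j *v x = M $ i $ j *v x" for i j x
  proof -
    have "(N \<star> axis j x) $ i = N $ i $ j *v x" for N
      using exhaust_2[of j] by (auto simp: apply_block_def sum_2 axis_def)
    then show ?thesis using assms by metis
  qed
  then show ?thesis
    by (simp add: vec_eq_iff[of L] vec_eq_iff[of "L $ _"] matrix_eq_if_mult_eq)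
qed

text \<open>The mean flux of the coupled problem is an integral of field pairs, but integrability is
  available only component by component; the injections \<open>axis i\<close> reassemble the
  pair.\<close>

lemma integrable_vec_components:
  fixes F :: "real^2 \<Rightarrow> field_pair"
  assumes "\<And>i. integrable cell (\<lambda>x. F x $ i)"
  shows "integrable cell F" and "(\<integral>x. F x \<partial>cell) $ i = (\<integral>x. F x $ i \<partial>cell)"
proof -
  have "linear (axis i :: real^2 \<Rightarrow> field_pair)" for i :: 2
    by (rule linearI) (simp_all add: axis_def vec_eq_iff)
  then have bl: "bounded_linear (axis i :: real^2 \<Rightarrow> field_pair)" for i :: 2
    by (simp add: linear_conv_bounded_linear)
  have F: "F = (\<lambda>x. axis 1 (F x $ 1) + axis 2 (F x $ 2))"
    by (auto simp: fun_eq_iff vec_eq_iff[of "F _"] forall_2 axis_def)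
  show int: "integrable cell F"
    by (subst F) (intro Bochner_Integration.integrable_add integrable_bounded_linear[OF bl] assms)
  show "(\<integral>x. F x \<partial>cell) $ i = (\<integral>x. F x $ i \<partial>cell)"
    using integral_bounded_linear[OF bounded_linear_vec_nth int] by simp
qed

text \<open>\<open>L\<close> is given by its action, that of
  \<open>(b \<alpha> u u^T + a \<beta> v v^T) \<otimes> I + r T\<close>. Independence of
  \<open>u\<close> and \<open>v\<close> means that the two contractions determine a field pair and
  that the two scalar fluxes can be isolated.\<close>

locale decoupled = a: conductivity a lo hi + b: conductivity b lo' hi'
  for a b :: "real^2 \<Rightarrow> real" and lo hi lo' hi' :: real +
  fixes u v :: "real^2" and \<alpha> \<beta> r :: real and L :: "real^2 \<Rightarrow> block_op"
  assumes independent: "u $ 1 * v $ 2 - u $ 2 * v $ 1 \<noteq> 0" and nonzero: "\<alpha> \<noteq> 0" "\<beta> \<noteq> 0"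
    and L: "\<And>x E i. (L x \<star> E) $ i = (\<alpha> * u $ i) *\<^sub>R (b x *\<^sub>R comb u E) + (\<beta> * v $ i) *\<^sub>R (a x *\<^sub>R comb v E) + r *\<^sub>R (T_op \<star> E) $ i"
begin

lemma coupled_fieldE:
  assumes "coupled_field L E0 E"
  obtains \<phi>1 \<phi>2 G1 G2 where "H1_per \<phi>1 G1" "H1_per \<phi>2 G2"
    "(\<lambda>x. E x $ 1) = (\<lambda>x. E0 $ 1 + G1 x)" "(\<lambda>x. E x $ 2) = (\<lambda>x. E0 $ 2 + G2 x)"
proof -
  obtain \<phi>1 \<phi>2 G1 G2 where "H1_per \<phi>1 G1" "H1_per \<phi>2 G2" "\<forall>x. E x = E0 + vector [G1 x, G2 x]"
    using assms unfolding coupled_field_def by blast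
  then show ?thesis by (intro that[of \<phi>1 G1 \<phi>2 G2]) (auto simp: fun_eq_iff)
qed

lemma T_op_divergence_free:
  assumes "H1_per \<phi>1 G1" "H1_per \<phi>2 G2"
    "(\<lambda>x. E x $ 1) = (\<lambda>x. E0 $ 1 + G1 x)" "(\<lambda>x. E x $ 2) = (\<lambda>x. E0 $ 2 + G2 x)"
  shows "divergence_free (\<lambda>x. (T_op \<star> E x) $ i)"
    and "(\<integral>x. (T_op \<star> E x) $ i \<partial>cell) = (T_op \<star> E0) $ i"
proof -
  have E: "E x $ 1 = E0 $ 1 + G1 x" "E x $ 2 = E0 $ 2 + G2 x" for x
    using fun_cong[OF assms(3)] fun_cong[OF assms(4)] by auto
  have d: "divergence_free (\<lambda>x. R_perp *v (E x $ 1))" "divergence_free (\<lambda>x. R_perp *v (E x $ 2))"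
    unfolding E by (intro divergence_free_rotated_gradient[OF assms(1)] divergence_free_rotated_gradient[OF assms(2)])+
  have d': "divergence_free (\<lambda>x. - (R_perp *v (E x $ 2)))"
    using divergence_free_lincomb[OF d(2) d(2), of "-1" 0] by simp
  show "divergence_free (\<lambda>x. (T_op \<star> E x) $ i)"
    using exhaust_2[of i] d(1) d' by (auto simp: apply_T_op)
  have m: "(\<integral>x. R_perp *v (E0 $ j + G x) \<partial>cell) = R_perp *v (E0 $ j)" if "H1_per \<phi> G" for \<phi> G j
    using integral_cell_matrix[of "\<lambda>x. E0 $ j + G x" R_perp] H1_perD(3,4)[OF that] by simp
  show "(\<integral>x. (T_op \<star> E x) $ i \<partial>cell) = (T_op \<star> E0) $ i"
    using exhaust_2[of i] m[OF assms(1), of 1] m[OF assms(2), of 2] by (auto simp: apply_T_op E)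
qed

lemma coupled_field_imp_fields:
  assumes E: "coupled_field L E0 E"
  shows "b.field (comb u E0) (\<lambda>x. comb u (E x))" "a.field (comb v E0) (\<lambda>x. comb v (E x))"
    and "\<And>i. divergence_free (\<lambda>x. (T_op \<star> E x) $ i)"
    and "\<And>i. (\<integral>x. (T_op \<star> E x) $ i \<partial>cell) = (T_op \<star> E0) $ i"
proof -
  obtain \<phi>1 \<phi>2 G1 G2 where G: "H1_per \<phi>1 G1" "H1_per \<phi>2 G2"
    "(\<lambda>x. E x $ 1) = (\<lambda>x. E0 $ 1 + G1 x)" "(\<lambda>x. E x $ 2) = (\<lambda>x. E0 $ 2 + G2 x)"
    by (rule coupled_fieldE[OF E])
  have Ex: "E x $ 1 = E0 $ 1 + G1 x" "E x $ 2 = E0 $ 2 + G2 x" for x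
    using fun_cong[OF G(3)] fun_cong[OF G(4)] by auto
  show T: "divergence_free (\<lambda>x. (T_op \<star> E x) $ i)" for i by (rule T_op_divergence_free(1)[OF G])
  show "(\<integral>x. (T_op \<star> E x) $ i \<partial>cell) = (T_op \<star> E0) $ i" for i by (rule T_op_divergence_free(2)[OF G])
  \<comment> \<open>The flux without its rotation part, which is divergence-free by itself.\<close>
  define w where "w i x = (L x \<star> E x) $ i - r *\<^sub>R (T_op \<star> E x) $ i" for i x
  have "divergence_free (\<lambda>x. (L x \<star> E x) $ i)" for i
    using E by (simp add: coupled_field_def)
  then have dw: "divergence_free (w i)" for i
    unfolding w_def using divergence_free_lincomb[of "\<lambda>x. (L x \<star> E x) $ i" "\<lambda>x. (T_op \<star> E x) $ i" 1 "- r"] T by simp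
  have w: "w i x = (\<alpha> * u $ i) *\<^sub>R (b x *\<^sub>R comb u (E x)) + (\<beta> * v $ i) *\<^sub>R (a x *\<^sub>R comb v (E x))" for i x
    by (simp add: w_def L)
  define d where "d = u $ 1 * v $ 2 - u $ 2 * v $ 1"
  have d: "d \<noteq> 0" using independent by (simp add: d_def)
  \<comment> \<open>Cramer's rule: weights orthogonal to \<open>v\<close> eliminate the
    \<open>a\<close> term and isolate the flux for \<open>b\<close>; weights orthogonal to
    \<open>u\<close> do the opposite below.\<close>
  have "(v $ 2) *\<^sub>R w 1 x + (- v $ 1) *\<^sub>R w 2 x = (\<alpha> * d) *\<^sub>R (b x *\<^sub>R comb u (E x))" for x
    unfolding w d_def by (simp add: vec_eq_iff algebra_simps)
  then have 1: "b x *\<^sub>R comb u (E x) = (v $ 2 / (\<alpha> * d)) *\<^sub>R w 1 x + (- v $ 1 / (\<alpha> * d)) *\<^sub>R w 2 x" for x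
    using d nonzero by (simp add: vec_eq_iff field_simps)
  have "(- u $ 2) *\<^sub>R w 1 x + (u $ 1) *\<^sub>R w 2 x = (\<beta> * d) *\<^sub>R (a x *\<^sub>R comb v (E x))" for x
    unfolding w d_def by (simp add: vec_eq_iff algebra_simps)
  then have 2: "a x *\<^sub>R comb v (E x) = (- u $ 2 / (\<beta> * d)) *\<^sub>R w 1 x + (u $ 1 / (\<beta> * d)) *\<^sub>R w 2 x" for x
    using d nonzero by (simp add: vec_eq_iff field_simps)
  have c: "comb z (E x) = comb z E0 + (z $ 1 *\<^sub>R G1 x + z $ 2 *\<^sub>R G2 x)" for z x
    by (simp add: comb_def Ex scaleR_add_right)
  show "b.field (comb u E0) (\<lambda>x. comb u (E x))"
    unfolding b.field_def 1 using H1_per_lincomb[OF G(1,2)] c divergence_free_lincomb[OF dw dw] by blast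
  show "a.field (comb v E0) (\<lambda>x. comb v (E x))"
    unfolding a.field_def 2 using H1_per_lincomb[OF G(1,2)] c divergence_free_lincomb[OF dw dw] by blast
qed

lemma coupled_field_exists: obtains E where "coupled_field L E0 E"
proof -
  obtain f where f: "b.field (comb u E0) f" by (rule b.field_exists)
  obtain g where g: "a.field (comb v E0) g" by (rule a.field_exists)
  obtain \<phi> F where F: "H1_per \<phi> F" "f = (\<lambda>x. comb u E0 + F x)" using f by (rule b.fieldE)
  obtain \<eta> H where H: "H1_per \<eta> H" "g = (\<lambda>x. comb v E0 + H x)" using g by (rule a.fieldE)
  define d where "d = u $ 1 * v $ 2 - u $ 2 * v $ 1"
  have d: "d \<noteq> 0" using independent by (simp add: d_def)
  \<comment> \<open>\<open>G1\<close> and \<open>G2\<close> solve \<open>u \<bullet> G = F\<close>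
    and \<open>v \<bullet> G = H\<close>, again by Cramer's rule.\<close>
  define G1 where "G1 x = (v $ 2 / d) *\<^sub>R F x + (- u $ 2 / d) *\<^sub>R H x" for x
  define G2 where "G2 x = (- v $ 1 / d) *\<^sub>R F x + (u $ 1 / d) *\<^sub>R H x" for x
  define E where "E x = E0 + vector [G1 x, G2 x]" for x
  obtain \<phi>1 \<phi>2 where h: "H1_per \<phi>1 G1" "H1_per \<phi>2 G2"
    unfolding G1_def[abs_def] G2_def[abs_def] using H1_per_lincomb[OF F(1) H(1)] by meson
  have uF: "u $ 1 *\<^sub>R G1 x + u $ 2 *\<^sub>R G2 x = F x" and vH: "v $ 1 *\<^sub>R G1 x + v $ 2 *\<^sub>R G2 x = H x" for x
  proof -
    have "u $ 1 *\<^sub>R G1 x + u $ 2 *\<^sub>R G2 x = ((u $ 1 * v $ 2 - u $ 2 * v $ 1) / d) *\<^sub>R F x"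
      using d unfolding G1_def G2_def by (simp add: vec_eq_iff field_simps)
    then show "u $ 1 *\<^sub>R G1 x + u $ 2 *\<^sub>R G2 x = F x" using d by (simp flip: d_def)
    have "v $ 1 *\<^sub>R G1 x + v $ 2 *\<^sub>R G2 x = ((u $ 1 * v $ 2 - u $ 2 * v $ 1) / d) *\<^sub>R H x"
      using d unfolding G1_def G2_def by (simp add: vec_eq_iff field_simps)
    then show "v $ 1 *\<^sub>R G1 x + v $ 2 *\<^sub>R G2 x = H x" using d by (simp flip: d_def)
  qed
  have uE: "comb u (E x) = f x" for x
    using uF[of x] by (simp add: comb_def E_def F(2) scaleR_add_right)
  have vE: "comb v (E x) = g x" for x
    using vH[of x] by (simp add: comb_def E_def H(2) scaleR_add_right)
  have T: "divergence_free (\<lambda>x. (T_op \<star> E x) $ i)" for i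
    by (rule T_op_divergence_free(1)[OF h]) (simp_all add: E_def fun_eq_iff)
  have "divergence_free (\<lambda>x. (L x \<star> E x) $ i)" for i
    unfolding L uE vE
    using divergence_free_lincomb[OF divergence_free_lincomb[OF b.field_divergence_free[OF f] a.field_divergence_free[OF g],
      of "\<alpha> * u $ i" "\<beta> * v $ i"] T[of i], of 1 r] by simp
  then have "coupled_field L E0 E"
    unfolding coupled_field_def using h E_def by blast
  then show ?thesis by (rule that)
qed

text \<open>The rotation term has constant coefficients, so its mean depends only on the mean field;
  this is why \<open>r\<close> enters the effective tensor unchanged.\<close>

lemma coupled_field_mean:
  assumes E: "coupled_field L E0 E"
  shows "(\<integral>x. L x \<star> E x \<partial>cell) $ i = (\<alpha> * u $ i) *\<^sub>R (b.effective *v comb u E0) +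
    (\<beta> * v $ i) *\<^sub>R (a.effective *v comb v E0) + r *\<^sub>R (T_op \<star> E0) $ i"
proof -
  note f = coupled_field_imp_fields[OF E]
  have "divergence_free (\<lambda>x. (L x \<star> E x) $ i)" for i
    using E by (simp add: coupled_field_def)
  then have "integrable cell (\<lambda>x. (L x \<star> E x) $ i)" for i
    by (simp add: divergence_free_def square_integrable_imp_integrable)
  then have "(\<integral>x. L x \<star> E x \<partial>cell) $ i = (\<integral>x. (L x \<star> E x) $ i \<partial>cell)"
    by (rule integrable_vec_components(2))
  also have "\<dots> = (\<integral>x. (\<alpha> * u $ i) *\<^sub>R (b x *\<^sub>R comb u (E x)) + (\<beta> * v $ i) *\<^sub>R (a x *\<^sub>R comb v (E x)) \<partial>cell) +
      (\<integral>x. r *\<^sub>R (T_op \<star> E x) $ i \<partial>cell)"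
  proof -
    have i: "integrable cell (\<lambda>x. b x *\<^sub>R comb u (E x))" "integrable cell (\<lambda>x. a x *\<^sub>R comb v (E x))"
      "integrable cell (\<lambda>x. (T_op \<star> E x) $ i)"
      using b.field_divergence_free[OF f(1)] a.field_divergence_free[OF f(2)] f(3)
      by (simp_all add: divergence_free_def square_integrable_imp_integrable)
    show ?thesis
      unfolding L by (intro Bochner_Integration.integral_add Bochner_Integration.integrable_add integrable_scaleR_right i)
  qed
  also have "(\<integral>x. (\<alpha> * u $ i) *\<^sub>R (b x *\<^sub>R comb u (E x)) + (\<beta> * v $ i) *\<^sub>R (a x *\<^sub>R comb v (E x)) \<partial>cell) =
      (\<integral>x. (\<alpha> * u $ i) *\<^sub>R (b x *\<^sub>R comb u (E x)) \<partial>cell) + (\<integral>x. (\<beta> * v $ i) *\<^sub>R (a x *\<^sub>R comb v (E x)) \<partial>cell)"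
    using b.field_divergence_free[OF f(1)] a.field_divergence_free[OF f(2)]
    by (intro Bochner_Integration.integral_add integrable_scaleR_right)
      (simp_all add: divergence_free_def square_integrable_imp_integrable)
  finally show ?thesis
    by (simp only: integral_scaleR_right b.effective[OF f(1)] a.effective[OF f(2)] f(4))
qed

lemma effective_tensor_eq:
  assumes "\<And>E0 i. (M \<star> E0) $ i = (\<alpha> * u $ i) *\<^sub>R (b.effective *v comb u E0) +
    (\<beta> * v $ i) *\<^sub>R (a.effective *v comb v E0) + r *\<^sub>R (T_op \<star> E0) $ i"
  shows "effective_tensor L = M"
proof -
  have M: "M \<star> E0 = (\<integral>x. L x \<star> E x \<partial>cell)" if "coupled_field L E0 E" for E0 E
    unfolding vec_eq_iff[of "M \<star> E0"] using coupled_field_mean[OF that] assms by simp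
  show ?thesis
    unfolding effective_tensor_def
  proof (rule the_equality)
    show "\<forall>E0. \<exists>E. coupled_field L E0 E \<and> M \<star> E0 = (\<integral>x. L x \<star> E x \<partial>cell)"
      using coupled_field_exists M by metis
    fix M' assume "\<forall>E0. \<exists>E. coupled_field L E0 E \<and> M' \<star> E0 = (\<integral>x. L x \<star> E x \<partial>cell)"
    then show "M' = M"
      using M by (intro block_op_eqI) metis
  qed
qed

end

subsection \<open>Simultaneous diagonalisation\<close>

text \<open>A nonzero upper left entry makes the second row a multiple of the first; otherwise only
  the lower right entry can survive. The separate factor \<open>\<alpha>\<close> avoids square roots
  and a case distinction on signs.\<close>

lemma rank_one_symmetric:
  fixes N :: "real^2^2"
  assumes "N $ 1 $ 2 = N $ 2 $ 1" "det N = 0"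
  obtains \<alpha> :: real and u :: "real^2" where "\<And>i j. N $ i $ j = \<alpha> * u $ i * u $ j"
proof (cases "N $ 1 $ 1 = 0")
  case True
  then have "N $ 1 $ 2 = 0" using assms by (simp add: det_2)
  then have "N $ i $ j = N $ 2 $ 2 * (vector [0, 1] :: real^2) $ i * (vector [0, 1] :: real^2) $ j" for i j
    using exhaust_2[of i] exhaust_2[of j] True assms by auto
  then show ?thesis by (rule that)
next
  case False
  have "N $ i $ j = (1 / N $ 1 $ 1) * (vector [N $ 1 $ 1, N $ 1 $ 2] :: real^2) $ i * (vector [N $ 1 $ 1, N $ 1 $ 2] :: real^2) $ j" for i j
    using exhaust_2[of i] exhaust_2[of j] False assms
    by (auto simp: det_2 field_simps)
  then show ?thesis by (rule that)
qed

lemma sym_pos_def_entries: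
  assumes "sym_pos_def A"
  shows "A $ 1 $ 2 = A $ 2 $ 1" "0 < A $ 1 $ 1" "0 < A $ 2 $ 2"
proof -
  have mv: "A *v x = vector [A $ 1 $ 1 * x $ 1 + A $ 1 $ 2 * x $ 2, A $ 2 $ 1 * x $ 1 + A $ 2 $ 2 * x $ 2]" for x
    by (simp add: matrix_vector_mult_def vec_eq_iff forall_2 sum_2)
  have "transpose A $ 1 $ 2 = A $ 1 $ 2" using assms by (simp add: sym_pos_def_def)
  then show "A $ 1 $ 2 = A $ 2 $ 1" by (simp add: transpose_def)
  have p: "0 < x \<bullet> (A *v x)" if "x \<noteq> 0" for x using assms that by (simp add: sym_pos_def_def)
  show "0 < A $ 1 $ 1"
    using p[of "axis 1 1"] by (simp add: mv inner_vec2 axis_def vec_eq_iff)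
  show "0 < A $ 2 $ 2"
    using p[of "axis 2 1"] by (simp add: mv inner_vec2 axis_def vec_eq_iff)
qed

lemma det_pencil:
  fixes A B :: "real^2^2"
  shows "det (B - l *\<^sub>R A) =
    det A * l\<^sup>2 - (A $ 1 $ 1 * B $ 2 $ 2 + A $ 2 $ 2 * B $ 1 $ 1 - A $ 1 $ 2 * B $ 2 $ 1 - A $ 2 $ 1 * B $ 1 $ 2) * l + det B"
  by (simp add: det_2 power2_eq_square algebra_simps)

text \<open>The polar form of the determinant is positive on positive definite pairs:
  \<open>(p * r' + r * p')\<^sup>2\<close> is at least \<open>4 * p * r * p' * r'\<close>, which
  exceeds \<open>(2 * q * q')\<^sup>2\<close>. In the pencil this number is, up to sign, the linear
  coefficient, and it makes the roots positive.\<close>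

lemma mixed_discriminant_pos:
  fixes p q r p' q' r' :: real
  assumes "0 < p" "0 < r" "0 < p'" "0 < r'" "q * q < p * r" "q' * q' < p' * r'"
  shows "0 < p * r' + r * p' - 2 * q * q'"
proof -
  have "(q * q) * (q' * q') < (p * r) * (p' * r')"
    by (rule mult_strict_mono'[OF assms(5,6)]) simp_all
  moreover have "(p * r' + r * p')\<^sup>2 = (p * r' - r * p')\<^sup>2 + 4 * ((p * r) * (p' * r'))"
    "(2 * q * q')\<^sup>2 = 4 * ((q * q) * (q' * q'))"
    by (simp_all add: power2_eq_square algebra_simps)
  ultimately have "(2 * q * q')\<^sup>2 < (p * r' + r * p')\<^sup>2"
    using zero_le_power2[of "p * r' - r * p'"] by linarith
  moreover have "0 \<le> p * r' + r * p'" using assms by simp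
  ultimately have "2 * q * q' < p * r' + r * p'"
    by (rule power2_less_imp_less)
  then show ?thesis by simp
qed

text \<open>With equal determinants, a double root of the pencil would be \<open>1\<close>, and then \<open>\<sigma>\<^sub>2 = \<sigma>\<^sub>1\<close>.\<close>

lemma pencil_roots:
  fixes A B :: "real^2^2"
  assumes A: "sym_pos_def A" and B: "sym_pos_def B" and dA: "0 < det A" and dAB: "det A = det B" and ne: "A \<noteq> B"
    and roots: "{l. det (B - l *\<^sub>R A) = 0} = {l1, l2}"
  shows "l1 \<noteq> l2" "l1 * l2 = 1" "0 < l1" "0 < l2"
proof -
  note eA = sym_pos_def_entries[OF A] and eB = sym_pos_def_entries[OF B]
  define d where "d = det A"
  define c where "c = A $ 1 $ 1 * B $ 2 $ 2 + A $ 2 $ 2 * B $ 1 $ 1 - 2 * A $ 1 $ 2 * B $ 1 $ 2"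
  have d: "0 < d" using dA by (simp add: d_def)
  have dA': "d = A $ 1 $ 1 * A $ 2 $ 2 - A $ 1 $ 2 * A $ 1 $ 2" and dB': "d = B $ 1 $ 1 * B $ 2 $ 2 - B $ 1 $ 2 * B $ 1 $ 2"
    using dAB eA(1) eB(1) by (simp_all add: d_def det_2)
  have c: "0 < c"
    unfolding c_def by (rule mixed_discriminant_pos) (use eA eB d dA' dB' in linarith)+
  have q: "det (B - l *\<^sub>R A) = d * l\<^sup>2 - c * l + d" for l
    unfolding det_pencil using eA(1) eB(1) dAB by (simp add: d_def c_def)
  have root: "d * l\<^sup>2 - c * l + d = 0 \<longleftrightarrow> l = l1 \<or> l = l2" for l
    using roots unfolding q by auto
  have pos: "0 < l" if "d * l\<^sup>2 - c * l + d = 0" for l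
  proof (rule ccontr)
    assume "\<not> 0 < l"
    then have "c * l \<le> 0" using c by (simp add: mult_le_0_iff)
    moreover have "0 \<le> d * l\<^sup>2" using d by simp
    ultimately show False using that d by linarith
  qed
  show p1: "0 < l1" and p2: "0 < l2" using pos root by auto
  \<comment> \<open>Leading and constant coefficients agree, so the polynomial is palindromic and
    its nonzero roots are closed under \<open>l \<mapsto> 1 / l\<close>.\<close>
  have swap: "d * (1 / l)\<^sup>2 - c * (1 / l) + d = 0" if "d * l\<^sup>2 - c * l + d = 0" "0 < l" for l
  proof -
    have "d * (1 / l)\<^sup>2 - c * (1 / l) + d = (d * l\<^sup>2 - c * l + d) / l\<^sup>2"
      using that(2) by (simp add: field_simps power2_eq_square)
    then show ?thesis using that(1) by simp
  qed
  have "\<not> d * 1\<^sup>2 - c * 1 + d = 0"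
  proof
    assume "d * 1\<^sup>2 - c * 1 + d = 0"
    then have c2: "c = 2 * d" by simp
    \<comment> \<open>With \<open>B = A + X\<close>, the condition \<open>c = 2 * d\<close> that 1
      is a root removes the part of \<open>det B\<close> linear in \<open>X\<close>; equality of the
      determinants then leaves \<open>det X = 0\<close>.\<close>
    define x y z where "x = B $ 1 $ 1 - A $ 1 $ 1" and "y = B $ 1 $ 2 - A $ 1 $ 2" and "z = B $ 2 $ 2 - A $ 2 $ 2"
    let ?p = "A $ 1 $ 1" and ?q = "A $ 1 $ 2" and ?r = "A $ 2 $ 2"
    have lin: "?p * z + ?r * x = 2 * ?q * y"
      using c2 unfolding c_def x_def y_def z_def dA' by (simp add: algebra_simps)
    have xz: "x * z = y * y"
      using dA' dB' lin unfolding x_def y_def z_def by (simp add: algebra_simps)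
    \<comment> \<open>Substituting \<open>lin\<close> and \<open>xz\<close> writes zero as a square
      plus \<open>4 * (d * (y * y))\<close>; as \<open>d\<close> is positive, both vanish.\<close>
    have "(?p * z - ?r * x)\<^sup>2 + 4 * (d * (y * y)) = (?p * z + ?r * x)\<^sup>2 - 4 * (?p * ?r) * (x * z) + 4 * (d * (y * y))"
      by (simp add: power2_eq_square algebra_simps)
    also have "\<dots> = 0"
      unfolding lin xz dA' by (simp add: power2_eq_square algebra_simps)
    finally have sum0: "(?p * z - ?r * x)\<^sup>2 + 4 * (d * (y * y)) = 0" .
    moreover have "0 \<le> 4 * (d * (y * y))" using d by simp
    ultimately have "(?p * z - ?r * x)\<^sup>2 = 0" "4 * (d * (y * y)) = 0"
      using add_nonneg_eq_0_iff[OF zero_le_power2] by blast+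
    then have y: "y = 0" and pz: "?p * z = ?r * x" using d by simp_all
    moreover have "?p * z + ?r * x = 0" using lin y by simp
    ultimately have "?p * z = 0" "?r * x = 0" by linarith+
    then have "x = 0" "z = 0" using eA(2,3) by auto
    then have "A = B" using y eA(1) eB(1) by (simp add: vec_eq_iff forall_2 x_def y_def z_def)
    then show False using ne by simp
  qed
  then have ne1: "l1 \<noteq> 1" using root[of 1] by blast
  have r1: "d * l1\<^sup>2 - c * l1 + d = 0" using root by blast
  from swap[OF r1 p1] have "1 / l1 = l1 \<or> 1 / l1 = l2" using root by blast
  moreover have "1 / l1 \<noteq> l1"
  proof
    assume "1 / l1 = l1"
    then have "l1\<^sup>2 = 1" using p1 by (simp add: field_simps power2_eq_square)
    then show False using p1 ne1 by (simp add: power2_eq_1_iff)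
  qed
  ultimately have "1 / l1 = l2" by blast
  with \<open>1 / l1 \<noteq> l1\<close> show "l1 \<noteq> l2" by auto
  show "l1 * l2 = 1" using \<open>1 / l1 = l2\<close> p1 by (auto simp: field_simps)
qed

section \<open>The two-phase composite\<close>

lemma conductivity_two_phase:
  assumes "A \<in> sets lebesgue" "0 < h"
  shows "conductivity (two_phase A 1 h) (min 1 h) (max 1 h)"
proof
  have "two_phase A 1 h \<in> borel_measurable lebesgue"
    unfolding two_phase_def[abs_def] using assms(1) by (intro measurable_If_set) auto
  then show "two_phase A 1 h \<in> borel_measurable cell"
    by (rule measurable_restrict_space1)
qed (use assms in \<open>auto simp: two_phase_def\<close>)

theorem mainTheorem8:
  fixes A1 A2 :: "(real^2) set"
    and \<sigma>1 \<sigma>2 S1 S2 \<sigma>s :: "real^2^2"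
    and r0 lam1 lam2 :: real
  assumes "A1 \<in> sets lebesgue" and "A2 \<in> sets lebesgue"
    and "A1 \<union> A2 = cbox 0 1" and "A1 \<inter> A2 = {}"
    and "sym_pos_def \<sigma>1" and "sym_pos_def \<sigma>2"
    and "r0\<^sup>2 < det \<sigma>1" and "r0\<^sup>2 < det \<sigma>2"
    and "\<nexists>c. \<sigma>2 = c *\<^sub>R \<sigma>1" and "\<nexists>c. \<sigma>1 = c *\<^sub>R \<sigma>2"
    and "det \<sigma>1 = det \<sigma>2"
    and "{l. det (\<sigma>2 - l *\<^sub>R \<sigma>1) = 0} = {lam1, lam2}"
    and "S1 = (1 / (lam2 - lam1)) *\<^sub>R (\<sigma>2 - lam1 *\<^sub>R \<sigma>1)"
    and "S2 = (1 / (lam1 - lam2)) *\<^sub>R (\<sigma>2 - lam2 *\<^sub>R \<sigma>1)"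
    and "\<sigma>s = Sigma_eff A1 lam1"
  shows "effective_tensor (two_phase A1 (isotropic_phase \<sigma>1 r0) (isotropic_phase \<sigma>2 r0))
           = r0 *\<^sub>R T_op + ((1 / det \<sigma>s) *\<^sub>R S1 + S2) \<otimes> \<sigma>s"
proof -
  note S1 = assms(13) and S2 = assms(14)
  have dpos: "0 < det \<sigma>1" using assms(7) zero_le_power2[of r0] by linarith
  have ne: "\<sigma>1 \<noteq> \<sigma>2" using assms(9) scaleR_one by metis
  note lam = pencil_roots[OF assms(5,6) dpos assms(11) ne assms(12)]
  have lne: "lam2 - lam1 \<noteq> 0" "lam1 - lam2 \<noteq> 0" using lam(1) by auto
  \<comment> \<open>This fixes which root goes with which matrix: in the second phase
    \<open>S1\<close> has weight \<open>lam2\<close> and \<open>S2\<close> has weight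
    \<open>lam1\<close>.\<close>
  have sum: "S1 $ i $ j + S2 $ i $ j = \<sigma>1 $ i $ j"
    and sum2: "lam2 * S1 $ i $ j + lam1 * S2 $ i $ j = \<sigma>2 $ i $ j" for i j
  proof -
    define t where "t = 1 / (lam2 - lam1)"
    have t: "t * (lam2 - lam1) = 1" using lne by (simp add: t_def)
    have t': "1 / (lam1 - lam2) = - t"
      by (simp add: t_def minus_divide_right)
    have e: "S1 $ i $ j = t * (\<sigma>2 $ i $ j - lam1 * \<sigma>1 $ i $ j)" "S2 $ i $ j = - t * (\<sigma>2 $ i $ j - lam2 * \<sigma>1 $ i $ j)"
      unfolding S1 S2 t'[symmetric] unfolding t_def by simp_all
    have "S1 $ i $ j + S2 $ i $ j = t * (lam2 - lam1) * \<sigma>1 $ i $ j"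
      "lam2 * S1 $ i $ j + lam1 * S2 $ i $ j = t * (lam2 - lam1) * \<sigma>2 $ i $ j"
      unfolding e by (simp_all add: algebra_simps)
    then show "S1 $ i $ j + S2 $ i $ j = \<sigma>1 $ i $ j" "lam2 * S1 $ i $ j + lam1 * S2 $ i $ j = \<sigma>2 $ i $ j"
      unfolding t by simp_all
  qed
  have roots: "det (\<sigma>2 - lam1 *\<^sub>R \<sigma>1) = 0" "det (\<sigma>2 - lam2 *\<^sub>R \<sigma>1) = 0"
    using assms(12) by auto
  have scale: "det (k *\<^sub>R N) = k\<^sup>2 * det N" for k and N :: "real^2^2"
    by (simp add: det_2 power2_eq_square algebra_simps)
  have sdet: "det S1 = 0" "det S2 = 0"
    unfolding S1 S2 scale using roots by auto
  have ssym: "S1 $ 1 $ 2 = S1 $ 2 $ 1" "S2 $ 1 $ 2 = S2 $ 2 $ 1"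
    unfolding S1 S2 using sym_pos_def_entries(1)[OF assms(5)] sym_pos_def_entries(1)[OF assms(6)] by simp_all
  obtain \<alpha> u where u: "\<And>i j. S1 $ i $ j = \<alpha> * u $ i * u $ j"
    using rank_one_symmetric[OF ssym(1) sdet(1)] by metis
  obtain \<beta> v where v: "\<And>i j. S2 $ i $ j = \<beta> * v $ i * v $ j"
    using rank_one_symmetric[OF ssym(2) sdet(2)] by metis
  \<comment> \<open>One identity yields all that decoupling requires: a positive determinant
    excludes zero \<open>\<alpha>\<close> or \<open>\<beta>\<close> and dependence of
    \<open>u\<close> and \<open>v\<close>.\<close>
  have "det \<sigma>1 = \<alpha> * \<beta> * (u $ 1 * v $ 2 - u $ 2 * v $ 1)\<^sup>2"
    unfolding det_2 sum[symmetric] u v by (simp add: power2_eq_square algebra_simps)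
  then have nz: "\<alpha> \<noteq> 0" "\<beta> \<noteq> 0" "u $ 1 * v $ 2 - u $ 2 * v $ 1 \<noteq> 0"
    using dpos by auto
  \<comment> \<open>\<open>a\<close> goes with \<open>S2\<close> and has effective matrix
    \<open>\<sigma>s\<close>; \<open>b\<close> goes with \<open>S1\<close> and is its pointwise
    reciprocal. Off \<open>A1\<close>, even outside the cell, both take their second-phase value, so
    the bounds hold globally.\<close>
  define a where "a = two_phase A1 1 lam1"
  define b where "b = two_phase A1 1 lam2"
  have ca: "conductivity a (min 1 lam1) (max 1 lam1)" and cb: "conductivity b (min 1 lam2) (max 1 lam2)"
    unfolding a_def b_def using conductivity_two_phase assms(1) lam by auto
  interpret decoupled a b "min 1 lam1" "max 1 lam1" "min 1 lam2" "max 1 lam2" u v \<alpha> \<beta> r0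
    "two_phase A1 (isotropic_phase \<sigma>1 r0) (isotropic_phase \<sigma>2 r0)"
  proof (intro decoupled.intro decoupled_axioms.intro ca cb nz)
    fix x E and i :: 2
    \<comment> \<open>On \<open>A1\<close> the identity \<open>sum\<close> applies, elsewhere
      \<open>sum2\<close>.\<close>
    have "(two_phase A1 (isotropic_phase \<sigma>1 r0) (isotropic_phase \<sigma>2 r0) x \<star> E) $ i =
        (b x * S1 $ i $ 1 + a x * S2 $ i $ 1) *\<^sub>R E $ 1 + (b x * S1 $ i $ 2 + a x * S2 $ i $ 2) *\<^sub>R E $ 2
        + r0 *\<^sub>R (T_op \<star> E) $ i"
      by (simp add: two_phase_def isotropic_phase_def apply_block_add apply_block_scaleR apply_kron
          a_def b_def sum sum2)
    then show "(two_phase A1 (isotropic_phase \<sigma>1 r0) (isotropic_phase \<sigma>2 r0) x \<star> E) $ i =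
        (\<alpha> * u $ i) *\<^sub>R (b x *\<^sub>R comb u E) + (\<beta> * v $ i) *\<^sub>R (a x *\<^sub>R comb v E) + r0 *\<^sub>R (T_op \<star> E) $ i"
      unfolding u v by (simp add: comb_def vec_eq_iff[of "_ :: real^2"] algebra_simps)
  qed
  have sa: "\<sigma>s = a.effective"
    unfolding assms(15) Sigma_eff_def
    by (rule a.effective_conductivity_eq)
      (simp add: two_phase_def a_def scaleR_matrix_vector_assoc[symmetric])
  have "a x * b x = 1" for x
    using lam(2) by (simp add: a_def b_def two_phase_def)
  from effective_dual[OF ca cb this] have sb: "b.effective = (1 / det \<sigma>s) *\<^sub>R \<sigma>s"
    unfolding sa .
  show ?thesis
  proof (rule effective_tensor_eq)
    fix E0 and i :: 2
    have "((r0 *\<^sub>R T_op + ((1 / det \<sigma>s) *\<^sub>R S1 + S2) \<otimes> \<sigma>s) \<star> E0) $ i =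
      (1 / det \<sigma>s * (\<alpha> * u $ i * u $ 1) + \<beta> * v $ i * v $ 1) *\<^sub>R (\<sigma>s *v E0 $ 1)
      + (1 / det \<sigma>s * (\<alpha> * u $ i * u $ 2) + \<beta> * v $ i * v $ 2) *\<^sub>R (\<sigma>s *v E0 $ 2) + r0 *\<^sub>R (T_op \<star> E0) $ i"
      by (simp add: apply_block_add apply_block_scaleR apply_kron u v)
    also have "\<dots> = (\<alpha> * u $ i) *\<^sub>R (b.effective *v comb u E0) + (\<beta> * v $ i) *\<^sub>R (a.effective *v comb v E0)
      + r0 *\<^sub>R (T_op \<star> E0) $ i"
      unfolding sb sa[symmetric] comb_def
      by (simp add: matrix_vector_right_distrib matrix_vector_mult_scaleR scaleR_matrix_vector_assoc[symmetric]
          vec_eq_iff[of "_ :: real^2"] algebra_simps)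
    finally show "((r0 *\<^sub>R T_op + ((1 / det \<sigma>s) *\<^sub>R S1 + S2) \<otimes> \<sigma>s) \<star> E0) $ i =
      (\<alpha> * u $ i) *\<^sub>R (b.effective *v comb u E0) + (\<beta> * v $ i) *\<^sub>R (a.effective *v comb v E0)
      + r0 *\<^sub>R (T_op \<star> E0) $ i" .
  qed
qed

end
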